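(* Let $\rho>0$ and let $A=(A_1,\ldots,A_n)\in B(\mathcal H)^n$ be in $\mathcal C_\rho$. The following statements are equivalent: (i) $\omega_\rho(A_1,\ldots,A_n)<1$; (ii) $A\overset{H}{\sim}0$; (iii) $r(A_1,\ldots,A_n)<1$ and $P_\rho(A,R)\ge aI$ for some constant $a>0$.
   Context: Let $n\ge1$, $\mathcal H$ a complex Hilbert space, $\mathcal K$ an infinite-dimensional Hilbert space. $\mathbb F_n^+$ is the unital free semigroup on generators $g_1,\ldots,g_n$ with identity $g_0$; $|\alpha|$ is the length and $\tilde\alpha$ the reverse word of $\alpha$. $T_\alpha:=T_{i_1}\cdots T_{i_k}$ if $\alpha=g_{i_1}\cdots g_{i_k}$, $T_{g_0}:=I$. $T\in B(\mathcal H)^n$ is in the class $\mathcal C_\rho$ if there exist a Hilbert space $\mathcal G\supseteq\mathcal H$ and isometries $V_1,\ldots,V_n\in B(\mathcal G)$ with mutually orthogonal ranges such that $T_\alpha=\rho P_{\mathcal H}V_\alpha|_{\mathcal H}$ for all $\alpha\ne g_0$. The joint operator radius is $\omega_\rho(T):=\inf\{t>0:\frac1tT\in\mathcal C_\rho\}$, and the joint spectral radius is $r(T):=\lim_{k\to\infty}\|\sum_{|\alpha|=k}T_\alpha T_\alpha^*\|^{1/2k}$. $R_i\varphi:=\varphi\otimes e_i$ are the right creation operators on the full Fock space $F^2(H_n)=\mathbb C1\oplus\bigoplus_{k\ge1}H_n^{\otimes k}$ ($e_1,\ldots,e_n$ an orthonormal basis of the $n$-dimensional Hilbert space $H_n$).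 For $X\in B(\mathcal H)^n$ with $r(X)<1$, $$P_\rho(X,R):=\sum_{k=1}^\infty\sum_{|\alpha|=k}X_\alpha\otimes R_{\tilde\alpha}^*+\rho I\otimes I+\sum_{k=1}^\infty\sum_{|\alpha|=k}X_\alpha^*\otimes R_{\tilde\alpha}$$ (norm convergent in $k$). Harnack domination: for $A,B\in\mathcal C_\rho$, $A\overset{H}{\prec}B$ means that there exists $c>0$ such that $\Re p(A)+(\rho-1)\Re p(0)\le c^2[\Re p(B)+(\rho-1)\Re p(0)]$ for every noncommutative polynomial $p\in\mathbb C[X_1,\ldots,X_n]\otimes M_m$, $m\in\mathbb N$, such that $\Re p(X):=\frac12(p(X)^*+p(X))\ge0$ for all $X\in B(\mathcal K)^n$ with $\|\sum_iX_iX_i^*\|<1$; here $p(A)=\sum_\alpha A_\alpha\otimes M_\alpha$ for $p=\sum_\alpha X_\alpha\otimes M_\alpha$. $A\overset{H}{\sim}B$ means $A\overset{H}{\prec}B$ and $B\overset{H}{\prec}A$. $0$ denotes the zero $n$-tuple. *)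

theory Defs
  imports "HOL-Analysis.Analysis"
begin

section \<open>Complex Hilbert spaces\<close>

class complex_normed_vector = real_normed_vector +
  fixes scaleC :: "complex \<Rightarrow> 'a \<Rightarrow> 'a" (infixr "*\<^sub>C" 75)
  assumes scaleC_add_right: "c *\<^sub>C (x + y) = c *\<^sub>C x + c *\<^sub>C y"
    and scaleC_add_left: "(c + d) *\<^sub>C x = c *\<^sub>C x + d *\<^sub>C x"
    and scaleC_scaleC: "c *\<^sub>C d *\<^sub>C x = (c * d) *\<^sub>C x"
    and scaleC_of_real: "complex_of_real r *\<^sub>C x = r *\<^sub>R x"
    and norm_scaleC: "norm (c *\<^sub>C x) = cmod c * norm x"

text \<open>The inner product is linear in its first argument.\<close>

class complex_inner = complex_normed_vector +
  fixes cinner :: "'a \<Rightarrow> 'a \<Rightarrow> complex"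
  assumes cinner_commute: "cinner x y = cnj (cinner y x)"
    and cinner_add_left: "cinner (x + y) z = cinner x z + cinner y z"
    and cinner_scaleC_left: "cinner (c *\<^sub>C x) y = c * cinner x y"
    and cinner_self: "cinner x x = complex_of_real ((norm x)\<^sup>2)"

class chilbert_space = complex_inner + complete_space

subclass (in chilbert_space) banach ..

global_interpretation complex_vector: vector_space "scaleC :: complex \<Rightarrow> 'a \<Rightarrow> 'a::complex_normed_vector"
  defines cspan = complex_vector.span
  by standard (use scaleC_of_real[of 1] in \<open>auto simp: scaleC_add_right scaleC_add_left scaleC_scaleC\<close>)

text \<open>Bounded operators are the real-linear ones of the library; membership in $B(H)$ additionally
  asks for compatibility with complex scalars.\<close>

definition clinear_op :: "('a::complex_normed_vector \<Rightarrow>\<^sub>L 'b::complex_normed_vector) \<Rightarrow> bool" where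
  "clinear_op T \<longleftrightarrow> (\<forall>c x. T (c *\<^sub>C x) = c *\<^sub>C T x)"

instantiation complex :: chilbert_space
begin
definition scaleC_complex :: "complex \<Rightarrow> complex \<Rightarrow> complex" where "scaleC_complex c x = c * x"
definition cinner_complex :: "complex \<Rightarrow> complex \<Rightarrow> complex" where "cinner_complex x y = x * cnj y"
instance
  by standard (auto simp: scaleC_complex_def cinner_complex_def algebra_simps scaleR_conv_of_real
      norm_mult complex_norm_square[symmetric])
end

instantiation blinfun :: (real_normed_vector, complex_normed_vector) complex_normed_vector
begin
lift_definition scaleC_blinfun :: "complex \<Rightarrow> 'a \<Rightarrow>\<^sub>L 'b \<Rightarrow> 'a \<Rightarrow>\<^sub>L 'b" is "\<lambda>c T x. c *\<^sub>C T x"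
proof -
  fix c and f :: "'a \<Rightarrow> 'b" assume "bounded_linear f"
  then interpret bounded_linear f .
  obtain K where K: "\<And>x. norm (f x) \<le> norm x * K" using bounded by blast
  show "bounded_linear (\<lambda>x. c *\<^sub>C f x)"
  proof (rule bounded_linear_intro)
    show "c *\<^sub>C f (x + y) = c *\<^sub>C f x + c *\<^sub>C f y" for x y by (simp add: add scaleC_add_right)
    show "c *\<^sub>C f (r *\<^sub>R x) = r *\<^sub>R c *\<^sub>C f x" for r x
      by (simp add: scaleR scaleC_of_real[symmetric] scaleC_scaleC mult.commute)
    show "norm (c *\<^sub>C f x) \<le> norm x * (cmod c * K)" for x
      using mult_left_mono[OF K[of x], of "cmod c"] by (simp add: norm_scaleC mult_ac)
  qed
qed
instance
proof
  fix c d :: complex and x y :: "'a \<Rightarrow>\<^sub>L 'b" and r :: real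
  show "c *\<^sub>C (x + y) = c *\<^sub>C x + c *\<^sub>C y" by transfer (simp add: scaleC_add_right)
  show "(c + d) *\<^sub>C x = c *\<^sub>C x + d *\<^sub>C x" by transfer (simp add: scaleC_add_left)
  show "c *\<^sub>C d *\<^sub>C x = (c * d) *\<^sub>C x" by transfer (simp add: scaleC_scaleC)
  show "complex_of_real r *\<^sub>C x = r *\<^sub>R x" by transfer (simp add: scaleC_of_real)
  show "norm (c *\<^sub>C x) = cmod c * norm x"
  proof transfer
    fix c and f :: "'a \<Rightarrow> 'b" assume f: "bounded_linear f"
    have "onorm (\<lambda>x. c *\<^sub>C f x) = onorm (\<lambda>x. cmod c *\<^sub>R f x)"
      unfolding onorm_def by (simp add: norm_scaleC)
    also have "\<dots> = cmod c * onorm f" using onorm_scaleR[OF f, of "cmod c"] by simp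
    finally show "onorm (\<lambda>x. c *\<^sub>C f x) = cmod c * onorm f" .
  qed
qed
end

subsection \<open>Elementary facts on inner products\<close>

lemma scaleC_zero_right [simp]: "c *\<^sub>C (0::'a::complex_normed_vector) = 0"
  and scaleC_zero_left [simp]: "0 *\<^sub>C (x::'a::complex_normed_vector) = 0"
  and scaleC_one [simp]: "1 *\<^sub>C (x::'a::complex_normed_vector) = x"
  and scaleC_minus_left: "(-c) *\<^sub>C (x::'a::complex_normed_vector) = -(c *\<^sub>C x)"
  and scaleC_minus_right: "c *\<^sub>C (- x::'a::complex_normed_vector) = -(c *\<^sub>C x)"
  and scaleC_diff_right: "c *\<^sub>C (x - y::'a::complex_normed_vector) = c *\<^sub>C x - c *\<^sub>C y"
  using complex_vector.scale_minus_left[of c x] complex_vector.scale_minus_right[of c x]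
    complex_vector.scale_right_diff_distrib[of c x y] by simp_all

context complex_inner
begin
lemma cinner_add_right: "cinner x (y + z) = cinner x y + cinner x z"
  by (metis cinner_commute cinner_add_left complex_cnj_add)
lemma cinner_scaleC_right: "cinner x (c *\<^sub>C y) = cnj c * cinner x y"
  by (metis cinner_commute cinner_scaleC_left complex_cnj_mult)
lemma cinner_scaleR_left: "cinner (r *\<^sub>R x) y = r * cinner x y"
  by (metis cinner_scaleC_left scaleC_of_real)
lemma cinner_scaleR_right: "cinner x (r *\<^sub>R y) = r * cinner x y"
  by (metis cinner_scaleC_right scaleC_of_real complex_cnj_complex_of_real)
lemma cinner_zero_left [simp]: "cinner 0 x = 0"
  using cinner_add_left[of 0 0 x] by simp
lemma cinner_zero_right [simp]: "cinner x 0 = 0"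
  using cinner_add_right[of x 0 0] by simp
lemma cinner_minus_left: "cinner (-x) y = - cinner x y"
  by (rule group_add_class.minus_unique[symmetric]) (simp add: cinner_add_left[symmetric])
lemma cinner_minus_right: "cinner x (-y) = - cinner x y"
  by (rule group_add_class.minus_unique[symmetric]) (simp add: cinner_add_right[symmetric])
lemma cinner_diff_left: "cinner (x - y) z = cinner x z - cinner y z"
  using cinner_add_left[of x "-y" z] by (simp add: cinner_minus_left)
lemma cinner_diff_right: "cinner x (y - z) = cinner x y - cinner x z"
  using cinner_add_right[of x y "-z"] by (simp add: cinner_minus_right)
lemma cinner_sum_left: "cinner (sum f A) y = (\<Sum>i\<in>A. cinner (f i) y)"
  by (induction A rule: infinite_finite_induct) (auto simp: cinner_add_left)
lemma cinner_sum_right: "cinner y (sum f A) = (\<Sum>i\<in>A. cinner y (f i))"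
  by (induction A rule: infinite_finite_induct) (auto simp: cinner_add_right)
lemma cinner_eq_zero_iff [simp]: "cinner x x = 0 \<longleftrightarrow> x = 0"
  by (simp add: cinner_self)
lemma norm_add_sq: "(norm (x + y))\<^sup>2 = (norm x)\<^sup>2 + 2 * Re (cinner x y) + (norm y)\<^sup>2"
proof -
  have "complex_of_real ((norm (x + y))\<^sup>2) = cinner (x + y) (x + y)" by (simp add: cinner_self)
  also have "\<dots> = cinner x x + (cinner x y + cnj (cinner x y)) + cinner y y"
    using cinner_commute[of y x] by (simp add: cinner_add_left cinner_add_right)
  also have "\<dots> = complex_of_real ((norm x)\<^sup>2 + 2 * Re (cinner x y) + (norm y)\<^sup>2)"
    by (simp add: cinner_self complex_add_cnj)
  finally show ?thesis by (simp only: of_real_eq_iff)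
qed
lemma norm_diff_sq: "(norm (x - y))\<^sup>2 = (norm x)\<^sup>2 - 2 * Re (cinner x y) + (norm y)\<^sup>2"
  using norm_add_sq[of x "-y"] by (simp add: cinner_minus_right)
lemma norm_add_orth: "cinner x y = 0 \<Longrightarrow> (norm (x + y))\<^sup>2 = (norm x)\<^sup>2 + (norm y)\<^sup>2"
  by (simp add: norm_add_sq)
lemma cinner_ext: "(\<And>z. cinner x z = cinner y z) \<Longrightarrow> x = y"
  using cinner_eq_zero_iff[of "x - y"] by (simp add: cinner_diff_left)
lemma cinner_ext_right: "(\<And>z. cinner z x = cinner z y) \<Longrightarrow> x = y"
  using cinner_eq_zero_iff[of "x - y"] by (simp add: cinner_diff_right)

lemma cauchy_schwarz: "cmod (cinner x y) \<le> norm x * norm y"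
proof (cases "y = 0")
  case False
  define c where "c = cinner x y / cinner y y"
  have yy: "cinner y y \<noteq> 0" using False by simp
  have o: "cinner (x - c *\<^sub>C y) (c *\<^sub>C y) = 0"
    using yy by (simp add: cinner_diff_left cinner_scaleC_left cinner_scaleC_right c_def)
  have "(norm x)\<^sup>2 = (norm (x - c *\<^sub>C y))\<^sup>2 + (norm (c *\<^sub>C y))\<^sup>2"
    using norm_add_orth[OF o] by simp
  then have "(cmod c * norm y)\<^sup>2 \<le> (norm x)\<^sup>2" by (simp add: norm_scaleC)
  then have "cmod c * norm y \<le> norm x" by (rule power2_le_imp_le) simp
  moreover have "cmod c * norm y = cmod (cinner x y) / norm y"
    using False by (simp add: c_def norm_divide cinner_self power2_eq_square norm_mult)
  ultimately show ?thesis using False by (simp add: field_simps)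
qed simp
end

lemma bounded_linear_cinner_left: "bounded_linear (\<lambda>x. cinner x (y::'a::complex_inner))"
  by (rule bounded_linear_intro[where K="norm y"])
     (auto simp: cinner_add_left cinner_scaleR_left scaleR_conv_of_real cauchy_schwarz)
lemma bounded_linear_cinner_right: "bounded_linear (\<lambda>x. cinner (y::'a::complex_inner) x)"
  by (rule bounded_linear_intro[where K="norm y"])
     (auto simp: cinner_add_right cinner_scaleR_right scaleR_conv_of_real intro: order_trans[OF cauchy_schwarz])
lemma bounded_linear_scaleC: "bounded_linear (\<lambda>x::'a::complex_normed_vector. c *\<^sub>C x)"
  by (rule bounded_linear_intro[where K="cmod c"])
     (auto simp: scaleC_add_right norm_scaleC scaleC_of_real[symmetric] scaleC_scaleC mult.commute)

section \<open>The Hilbert space of square-summable families\<close>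

typedef (overloaded) ('i, 'a) ell2 = "{f :: 'i \<Rightarrow> 'a::chilbert_space. (\<lambda>i. (norm (f i))\<^sup>2) summable_on UNIV}"
  morphisms ell2_apply Abs_ell2
  by (rule exI[of _ "\<lambda>_. 0"]) simp

setup_lifting type_definition_ell2

lemma sq_summable_add:
  fixes f g :: "'i \<Rightarrow> 'a::real_normed_vector"
  assumes "(\<lambda>i. (norm (f i))\<^sup>2) summable_on A" "(\<lambda>i. (norm (g i))\<^sup>2) summable_on A"
  shows "(\<lambda>i. (norm (f i + g i))\<^sup>2) summable_on A"
proof (rule summable_on_comparison_test)
  show "(\<lambda>i. 2 * (norm (f i))\<^sup>2 + 2 * (norm (g i))\<^sup>2) summable_on A"
    using assms by (intro summable_on_add summable_on_cmult_right)
  fix i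
  have "(norm (f i + g i))\<^sup>2 \<le> (norm (f i) + norm (g i))\<^sup>2"
    by (intro power_mono norm_triangle_ineq) simp
  also have "\<dots> \<le> 2 * (norm (f i))\<^sup>2 + 2 * (norm (g i))\<^sup>2"
    using zero_le_power2[of "norm (f i) - norm (g i)"] unfolding power2_diff power2_sum by linarith
  finally show "(norm (f i + g i))\<^sup>2 \<le> 2 * (norm (f i))\<^sup>2 + 2 * (norm (g i))\<^sup>2" .
qed simp

lemma sq_summable_cinner:
  fixes f g :: "'i \<Rightarrow> 'a::complex_inner"
  assumes "(\<lambda>i. (norm (f i))\<^sup>2) summable_on A" "(\<lambda>i. (norm (g i))\<^sup>2) summable_on A"
  shows "(\<lambda>i. cinner (f i) (g i)) summable_on A"
proof (rule abs_summable_summable, rule summable_on_comparison_test)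
  show "(\<lambda>i. (norm (f i))\<^sup>2 + (norm (g i))\<^sup>2) summable_on A"
    using assms by (rule summable_on_add)
  fix i
  have "norm (cinner (f i) (g i)) \<le> norm (f i) * norm (g i)" by (rule cauchy_schwarz)
  also have "\<dots> \<le> (norm (f i))\<^sup>2 + (norm (g i))\<^sup>2"
    using zero_le_power2[of "norm (f i) - norm (g i)"] mult_nonneg_nonneg[OF norm_ge_zero[of "f i"] norm_ge_zero[of "g i"]]
    unfolding power2_diff by linarith
  finally show "norm (cinner (f i) (g i)) \<le> (norm (f i))\<^sup>2 + (norm (g i))\<^sup>2" .
qed simp

lemma sq_summable_scaleC:
  fixes f :: "'i \<Rightarrow> 'a::complex_normed_vector"
  assumes "(\<lambda>i. (norm (f i))\<^sup>2) summable_on A"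
  shows "(\<lambda>i. (norm (c *\<^sub>C f i))\<^sup>2) summable_on A"
  using assms by (simp add: norm_scaleC power_mult_distrib summable_on_cmult_right)

instantiation ell2 :: (type, chilbert_space) complex_inner
begin

lift_definition zero_ell2 :: "('a, 'b) ell2" is "\<lambda>_. 0" by simp
lift_definition plus_ell2 :: "('a, 'b) ell2 \<Rightarrow> ('a, 'b) ell2 \<Rightarrow> ('a, 'b) ell2"
  is "\<lambda>f g i. f i + g i" by (rule sq_summable_add)
lift_definition uminus_ell2 :: "('a, 'b) ell2 \<Rightarrow> ('a, 'b) ell2"
  is "\<lambda>f i. - f i" by simp
lift_definition minus_ell2 :: "('a, 'b) ell2 \<Rightarrow> ('a, 'b) ell2 \<Rightarrow> ('a, 'b) ell2"
  is "\<lambda>f g i. f i - g i" using sq_summable_add[of _ UNIV "\<lambda>i. - g i" for g] by simp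
lift_definition scaleC_ell2 :: "complex \<Rightarrow> ('a, 'b) ell2 \<Rightarrow> ('a, 'b) ell2"
  is "\<lambda>c f i. c *\<^sub>C f i" by (rule sq_summable_scaleC)
lift_definition scaleR_ell2 :: "real \<Rightarrow> ('a, 'b) ell2 \<Rightarrow> ('a, 'b) ell2"
  is "\<lambda>r f i. r *\<^sub>R f i" using sq_summable_scaleC[of _ UNIV "complex_of_real r" for r] by (simp add: scaleC_of_real)
lift_definition cinner_ell2 :: "('a, 'b) ell2 \<Rightarrow> ('a, 'b) ell2 \<Rightarrow> complex"
  is "\<lambda>f g. \<Sum>\<^sub>\<infinity>i. cinner (f i) (g i)" .
lift_definition norm_ell2 :: "('a, 'b) ell2 \<Rightarrow> real"
  is "\<lambda>f. sqrt (\<Sum>\<^sub>\<infinity>i. (norm (f i))\<^sup>2)" .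

definition sgn_ell2 :: "('a, 'b) ell2 \<Rightarrow> ('a, 'b) ell2" where "sgn_ell2 x = inverse (norm x) *\<^sub>R x"
definition dist_ell2 :: "('a, 'b) ell2 \<Rightarrow> ('a, 'b) ell2 \<Rightarrow> real" where "dist_ell2 x y = norm (x - y)"
definition [code del]:
  "(uniformity :: (('a, 'b) ell2 \<times> ('a, 'b) ell2) filter) = (INF e\<in>{0 <..}. principal {(x, y). dist x y < e})"
definition open_ell2 :: "('a, 'b) ell2 set \<Rightarrow> bool" where
  [code del]: "open_ell2 S = (\<forall>x\<in>S. \<forall>\<^sub>F (x', y) in uniformity. x' = x \<longrightarrow> y \<in> S)"

instance
proof
  fix x y z :: "('a, 'b) ell2" and c d :: complex and r s :: real
  show "x + y + z = x + (y + z)" "x + y = y + x" "0 + x = x" "- x + x = 0" "x - y = x + - y"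
    by (transfer, simp add: algebra_simps fun_eq_iff)+
  show "r *\<^sub>R (x + y) = r *\<^sub>R x + r *\<^sub>R y" "(r + s) *\<^sub>R x = r *\<^sub>R x + s *\<^sub>R x"
    "r *\<^sub>R s *\<^sub>R x = (r * s) *\<^sub>R x" "1 *\<^sub>R x = x"
    by (transfer, simp add: algebra_simps fun_eq_iff)+
  show "c *\<^sub>C (x + y) = c *\<^sub>C x + c *\<^sub>C y" "(c + d) *\<^sub>C x = c *\<^sub>C x + d *\<^sub>C x"
    "c *\<^sub>C d *\<^sub>C x = (c * d) *\<^sub>C x" "complex_of_real r *\<^sub>C x = r *\<^sub>R x"
    by (transfer, simp add: scaleC_add_right scaleC_add_left scaleC_scaleC scaleC_of_real)+
  show "sgn x = inverse (norm x) *\<^sub>R x" by (simp add: sgn_ell2_def)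
  show "dist x y = norm (x - y)" by (simp add: dist_ell2_def)
  show "(uniformity :: (('a, 'b) ell2 \<times> ('a, 'b) ell2) filter) = (INF e\<in>{0 <..}. principal {(x, y). dist x y < e})"
    by (rule uniformity_ell2_def)
  show "open U = (\<forall>x\<in>U. \<forall>\<^sub>F (x', y) in uniformity. x' = x \<longrightarrow> y \<in> U)" for U :: "('a, 'b) ell2 set"
    by (rule open_ell2_def)
  show "(norm x = 0) = (x = 0)"
  proof transfer
    fix f :: "'a \<Rightarrow> 'b" assume f: "(\<lambda>i. (norm (f i))\<^sup>2) summable_on UNIV"
    show "(sqrt (\<Sum>\<^sub>\<infinity>i. (norm (f i))\<^sup>2) = 0) = (f = (\<lambda>_. 0))"
      using nonneg_infsum_le_0D[OF _ f] by (auto simp: fun_eq_iff)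
  qed
  show scale: "norm (c *\<^sub>C x) = cmod c * norm x" for c and x :: "('a, 'b) ell2"
    by transfer (simp add: norm_scaleC power_mult_distrib infsum_cmult_right' real_sqrt_mult)
  show "norm (r *\<^sub>R x) = \<bar>r\<bar> * norm x"
    by transfer (simp add: power_mult_distrib infsum_cmult_right' real_sqrt_mult)
  show "norm (x + y) \<le> norm x + norm y"
  proof transfer
    fix f g :: "'a \<Rightarrow> 'b"
    assume f: "(\<lambda>i. (norm (f i))\<^sup>2) summable_on UNIV" and g: "(\<lambda>i. (norm (g i))\<^sup>2) summable_on UNIV"
    have fin: "sqrt (\<Sum>i\<in>F. (norm (f i + g i))\<^sup>2)
        \<le> sqrt (\<Sum>\<^sub>\<infinity>i. (norm (f i))\<^sup>2) + sqrt (\<Sum>\<^sub>\<infinity>i. (norm (g i))\<^sup>2)" if "finite F" for F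
    proof -
      have "sqrt (\<Sum>i\<in>F. (norm (f i + g i))\<^sup>2) \<le> L2_set (\<lambda>i. norm (f i) + norm (g i)) F"
        unfolding L2_set_def by (intro real_sqrt_le_mono sum_mono power_mono norm_triangle_ineq) simp
      also have "\<dots> \<le> L2_set (\<lambda>i. norm (f i)) F + L2_set (\<lambda>i. norm (g i)) F"
        by (rule L2_set_triangle_ineq)
      also have "\<dots> \<le> sqrt (\<Sum>\<^sub>\<infinity>i. (norm (f i))\<^sup>2) + sqrt (\<Sum>\<^sub>\<infinity>i. (norm (g i))\<^sup>2)"
        unfolding L2_set_def using f g that
        by (intro add_mono real_sqrt_le_mono finite_sum_le_infsum) auto
      finally show ?thesis .
    qed
    let ?K = "sqrt (\<Sum>\<^sub>\<infinity>i. (norm (f i))\<^sup>2) + sqrt (\<Sum>\<^sub>\<infinity>i. (norm (g i))\<^sup>2)"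
    have K0: "0 \<le> ?K" by (simp add: infsum_nonneg)
    have "(\<Sum>\<^sub>\<infinity>i. (norm (f i + g i))\<^sup>2) \<le> ?K\<^sup>2"
    proof (rule infsum_le_finite_sums)
      show "(\<lambda>i. (norm (f i + g i))\<^sup>2) summable_on UNIV" by (rule sq_summable_add[OF f g])
      show "(\<Sum>i\<in>F. (norm (f i + g i))\<^sup>2) \<le> ?K\<^sup>2" if "finite F" for F
        using fin[OF that] by (rule sqrt_le_D)
    qed
    then show "sqrt (\<Sum>\<^sub>\<infinity>i. (norm (f i + g i))\<^sup>2) \<le> ?K"
      by (rule real_le_lsqrt[OF K0])
  qed
  show "cinner x y = cnj (cinner y x)"
  proof -
    have "cnj (cinner y x) = (\<Sum>\<^sub>\<infinity>i. cnj (cinner (ell2_apply y i) (ell2_apply x i)))"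
      unfolding cinner_ell2.rep_eq by (rule infsum_cnj[symmetric])
    also have "\<dots> = cinner x y"
      unfolding cinner_ell2.rep_eq by (rule infsum_cong) (rule cinner_commute[symmetric])
    finally show ?thesis by (rule sym)
  qed
  have sm: "(\<lambda>i. cinner (ell2_apply x i) (ell2_apply y i)) summable_on UNIV" for x y :: "('a, 'b) ell2"
    using ell2_apply[of x] ell2_apply[of y] by (intro sq_summable_cinner) simp_all
  show "cinner (x + y) z = cinner x z + cinner y z"
    unfolding cinner_ell2.rep_eq plus_ell2.rep_eq cinner_add_left by (rule infsum_add[OF sm sm])
  show "cinner (c *\<^sub>C x) y = c * cinner x y"
    unfolding cinner_ell2.rep_eq scaleC_ell2.rep_eq cinner_scaleC_left by (rule infsum_cmult_right')
  show "cinner x x = complex_of_real ((norm x)\<^sup>2)"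
  proof -
    have f: "(\<lambda>i. (norm (ell2_apply x i))\<^sup>2) summable_on UNIV" using ell2_apply[of x] by simp
    have "((\<lambda>i. complex_of_real ((norm (ell2_apply x i))\<^sup>2)) has_sum
        complex_of_real (\<Sum>\<^sub>\<infinity>i. (norm (ell2_apply x i))\<^sup>2)) UNIV"
      by (intro has_sum_of_real has_sum_infsum f)
    then have "cinner x x = complex_of_real (\<Sum>\<^sub>\<infinity>i. (norm (ell2_apply x i))\<^sup>2)"
      unfolding cinner_ell2.rep_eq cinner_self by (rule infsumI)
    then show ?thesis by (simp add: norm_ell2.rep_eq infsum_nonneg)
  qed
qed
end

lemma ell2_summable: "(\<lambda>i. (norm (ell2_apply x i))\<^sup>2) summable_on A"
  using ell2_apply[of x] by (intro summable_on_subset_banach[of _ UNIV A]) simp_all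

lemma norm_ell2_sq: "(norm x)\<^sup>2 = (\<Sum>\<^sub>\<infinity>i. (norm (ell2_apply x i))\<^sup>2)"
  by (simp add: norm_ell2.rep_eq infsum_nonneg)

lemma norm_ell2_apply_le: "norm (ell2_apply x i) \<le> norm x"
proof -
  have "(norm (ell2_apply x i))\<^sup>2 \<le> (norm x)\<^sup>2"
    using finite_sum_le_infsum[OF ell2_summable[of x UNIV], of "{i}"] by (simp add: norm_ell2_sq)
  then show ?thesis by (rule power2_le_imp_le) simp
qed

lemmas ell2_apply_simps [simp] = zero_ell2.rep_eq plus_ell2.rep_eq uminus_ell2.rep_eq minus_ell2.rep_eq
  scaleC_ell2.rep_eq scaleR_ell2.rep_eq

lemma ell2_eqI: "(\<And>i. ell2_apply x i = ell2_apply y i) \<Longrightarrow> x = y"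
  by (rule iffD1[OF ell2_apply_inject]) (rule ext)

lemma ell2_sum_apply: "ell2_apply (sum f A) i = (\<Sum>a\<in>A. ell2_apply (f a) i)"
  by (induction A rule: infinite_finite_induct) auto

instance ell2 :: (type, chilbert_space) chilbert_space
proof
  fix X :: "nat \<Rightarrow> ('a, 'b) ell2" assume X: "Cauchy X"
  have "\<exists>l. (\<lambda>n. ell2_apply (X n) i) \<longlonglongrightarrow> l" for i
  proof -
    have "Cauchy (\<lambda>n. ell2_apply (X n) i)"
    proof (rule metric_CauchyI)
      fix e :: real assume "e > 0"
      then obtain M where M: "\<And>m n. m \<ge> M \<Longrightarrow> n \<ge> M \<Longrightarrow> dist (X m) (X n) < e"
        using metric_CauchyD[OF X] by blast
      have le: "dist (ell2_apply (X m) i) (ell2_apply (X n) i) \<le> dist (X m) (X n)" for m n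
        using norm_ell2_apply_le[of "X m - X n" i] by (simp add: dist_norm)
      show "\<exists>M. \<forall>m\<ge>M. \<forall>n\<ge>M. dist (ell2_apply (X m) i) (ell2_apply (X n) i) < e"
        by (intro exI[of _ M] allI impI) (rule le_less_trans[OF le M])
    qed
    then show ?thesis by (simp add: Cauchy_convergent_iff convergent_def)
  qed
  then have "\<exists>l. \<forall>i. (\<lambda>n. ell2_apply (X n) i) \<longlonglongrightarrow> l i" by (intro choice allI)
  then obtain l where l: "\<And>i. (\<lambda>n. ell2_apply (X n) i) \<longlonglongrightarrow> l i" by blast
  have key: "\<exists>M. \<forall>n\<ge>M. \<forall>F. finite F \<longrightarrow> (\<Sum>i\<in>F. (norm (ell2_apply (X n) i - l i))\<^sup>2) \<le> e\<^sup>2" if "e > 0" for e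
  proof -
    obtain M where M: "\<And>m n. m \<ge> M \<Longrightarrow> n \<ge> M \<Longrightarrow> dist (X m) (X n) < e"
      using metric_CauchyD[OF X \<open>e > 0\<close>] by blast
    have "(\<Sum>i\<in>F. (norm (ell2_apply (X n) i - l i))\<^sup>2) \<le> e\<^sup>2" if n: "n \<ge> M" and F: "finite F" for n F
    proof (rule LIMSEQ_le_const2)
      show "(\<lambda>m. \<Sum>i\<in>F. (norm (ell2_apply (X n) i - ell2_apply (X m) i))\<^sup>2)
          \<longlonglongrightarrow> (\<Sum>i\<in>F. (norm (ell2_apply (X n) i - l i))\<^sup>2)"
        by (intro tendsto_intros l)
      have "(\<Sum>i\<in>F. (norm (ell2_apply (X n) i - ell2_apply (X m) i))\<^sup>2) \<le> e\<^sup>2" if m: "m \<ge> M" for m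
      proof -
        have "(\<Sum>i\<in>F. (norm (ell2_apply (X n) i - ell2_apply (X m) i))\<^sup>2) \<le> (norm (X n - X m))\<^sup>2"
          using finite_sum_le_infsum[OF ell2_summable[of "X n - X m" UNIV] F] by (simp add: norm_ell2_sq)
        also have "\<dots> \<le> e\<^sup>2" using M[OF n m] by (intro power_mono) (auto simp: dist_norm)
        finally show ?thesis .
      qed
      then show "\<exists>N. \<forall>m\<ge>N. (\<Sum>i\<in>F. (norm (ell2_apply (X n) i - ell2_apply (X m) i))\<^sup>2) \<le> e\<^sup>2" by blast
    qed
    then show ?thesis by blast
  qed
  obtain M1 where M1: "\<forall>n\<ge>M1. \<forall>F. finite F \<longrightarrow> (\<Sum>i\<in>F. (norm (ell2_apply (X n) i - l i))\<^sup>2) \<le> 1\<^sup>2"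
    using key[OF zero_less_one] by (rule exE)
  have "(\<lambda>i. (norm (ell2_apply (X M1) i - l i))\<^sup>2) summable_on UNIV"
  proof (rule nonneg_bounded_partial_sums_imp_summable_on[where C="1\<^sup>2"])
    show "\<forall>\<^sub>F F in finite_subsets_at_top UNIV. (\<Sum>i\<in>F. (norm (ell2_apply (X M1) i - l i))\<^sup>2) \<le> 1\<^sup>2"
      using M1 by (intro eventually_finite_subsets_at_top_weakI) blast
  qed simp
  then have "(\<lambda>i. (norm (- (ell2_apply (X M1) i - l i)))\<^sup>2) summable_on UNIV"
    unfolding norm_minus_cancel .
  from sq_summable_add[OF ell2_summable[of "X M1"] this]
  have L: "(\<lambda>i. (norm (l i))\<^sup>2) summable_on UNIV" by simp
  define Y where Y_def: "Y = Abs_ell2 l"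
  have Y: "ell2_apply Y = l" unfolding Y_def using L by (simp add: Abs_ell2_inverse)
  have "X \<longlonglongrightarrow> Y"
  proof (rule metric_LIMSEQ_I)
    fix e :: real assume e: "e > 0"
    then obtain M where M: "\<forall>n\<ge>M. \<forall>F. finite F \<longrightarrow> (\<Sum>i\<in>F. (norm (ell2_apply (X n) i - l i))\<^sup>2) \<le> (e/2)\<^sup>2"
      using key[OF half_gt_zero] by blast
    have "dist (X n) Y < e" if "n \<ge> M" for n
    proof -
      have "(norm (X n - Y))\<^sup>2 \<le> (e/2)\<^sup>2"
        unfolding norm_ell2_sq minus_ell2.rep_eq Y
        by (rule infsum_le_finite_sums[OF ell2_summable[of "X n - Y", unfolded minus_ell2.rep_eq Y]])
          (use M that in blast)
      then have "norm (X n - Y) \<le> e/2" by (rule power2_le_imp_le) (use e in simp)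
      then show ?thesis using e by (simp add: dist_norm)
    qed
    then show "\<exists>M. \<forall>n\<ge>M. dist (X n) Y < e" by blast
  qed
  then show "convergent X" by (auto simp: convergent_def)
qed

definition ket :: "'i \<Rightarrow> 'a::chilbert_space \<Rightarrow> ('i, 'a) ell2" where
  "ket i x = Abs_ell2 (\<lambda>j. if j = i then x else 0)"

lemma ket_apply: "ell2_apply (ket i x) j = (if j = i then x else 0)"
proof -
  have "(\<lambda>j. (norm (if j = i then x else 0))\<^sup>2) summable_on {i}" by simp
  then have "(\<lambda>j. (norm (if j = i then x else 0))\<^sup>2) summable_on UNIV"
    by (subst summable_on_cong_neutral[of "{i}" UNIV]) auto
  then show ?thesis unfolding ket_def by (simp add: Abs_ell2_inverse)
qed

lemma cinner_ket_left: "cinner (ket i x) f = cinner x (ell2_apply f i)"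
proof -
  have "cinner (ket i x) f = (\<Sum>\<^sub>\<infinity>j. cinner (if j = i then x else 0) (ell2_apply f j))"
    by (simp add: cinner_ell2.rep_eq ket_apply)
  also have "\<dots> = (\<Sum>\<^sub>\<infinity>j\<in>{i}. cinner x (ell2_apply f j))"
    by (rule infsum_cong_neutral) auto
  finally show ?thesis by simp
qed

text \<open>For injective \<open>s\<close>, the isometry with \<open>ket i x \<mapsto> ket (s i) x\<close>.\<close>

lift_definition reindex_ell2 :: "('i \<Rightarrow> 'j) \<Rightarrow> ('i, 'a::chilbert_space) ell2 \<Rightarrow> ('j, 'a) ell2"
  is "\<lambda>s f j. if inj s \<and> j \<in> range s then f (the_inv s j) else 0"
proof -
  fix s :: "'i \<Rightarrow> 'j" and f :: "'i \<Rightarrow> 'a" assume f: "(\<lambda>i. (norm (f i))\<^sup>2) summable_on UNIV"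
  show "(\<lambda>j. (norm (if inj s \<and> j \<in> range s then f (the_inv s j) else 0))\<^sup>2) summable_on UNIV"
  proof (cases "inj s")
    case True
    have "(\<lambda>j. (norm (f (the_inv s j)))\<^sup>2) summable_on range s"
      using f by (subst summable_on_reindex) (auto simp: o_def the_inv_f_f True)
    then show ?thesis using True
      by (subst summable_on_cong_neutral[of "range s" UNIV]) auto
  qed simp
qed

lemma reindex_ell2_apply:
  "inj s \<Longrightarrow> ell2_apply (reindex_ell2 s f) (s i) = ell2_apply f i"
  "j \<notin> range s \<Longrightarrow> ell2_apply (reindex_ell2 s f) j = 0"
  by (transfer; simp add: the_inv_f_f)+

lemma reindex_ell2_ket: "inj s \<Longrightarrow> reindex_ell2 s (ket i x) = ket (s i) x"
proof (rule ell2_eqI)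
  fix j assume s: "inj s"
  show "ell2_apply (reindex_ell2 s (ket i x)) j = ell2_apply (ket (s i) x) j"
    using s by (cases "j \<in> range s") (auto simp: ket_apply inj_eq reindex_ell2_apply)
qed

lemma cinner_reindex_ell2: "inj s \<Longrightarrow> cinner (reindex_ell2 s f) (reindex_ell2 s g) = cinner f g"
proof -
  assume s: "inj s"
  have "cinner (reindex_ell2 s f) (reindex_ell2 s g)
      = (\<Sum>\<^sub>\<infinity>j\<in>range s. cinner (ell2_apply (reindex_ell2 s f) j) (ell2_apply (reindex_ell2 s g) j))"
    unfolding cinner_ell2.rep_eq by (rule infsum_cong_neutral) (auto simp: reindex_ell2_apply)
  also have "\<dots> = cinner f g"
    using s by (subst infsum_reindex) (auto simp: o_def reindex_ell2_apply cinner_ell2.rep_eq)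
  finally show ?thesis .
qed

lemma norm_reindex_ell2: "inj s \<Longrightarrow> norm (reindex_ell2 s f) = norm f"
  using cinner_reindex_ell2[of s f f] by (simp add: cinner_self flip: of_real_power)

lemma scaleC_reindex_ell2: "reindex_ell2 s (c *\<^sub>C f) = c *\<^sub>C reindex_ell2 s f"
  by transfer (auto simp: fun_eq_iff)

lemma bounded_linear_reindex_ell2: "bounded_linear (reindex_ell2 s)"
proof (cases "inj s")
  case True
  show ?thesis
  proof (rule bounded_linear_intro[where K=1])
    show "reindex_ell2 s (x + y) = reindex_ell2 s x + reindex_ell2 s y" for x y
      by transfer (auto simp: fun_eq_iff)
    show "reindex_ell2 s (r *\<^sub>R x) = r *\<^sub>R reindex_ell2 s x" for r x
      by transfer (auto simp: fun_eq_iff)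
  qed (simp add: norm_reindex_ell2 True)
next
  case False
  then have z: "reindex_ell2 s = (\<lambda>_. 0)" by (intro ext ell2_eqI) (simp add: reindex_ell2.rep_eq)
  show ?thesis unfolding z by (rule bounded_linear_zero)
qed

lift_definition reindex_op :: "('i \<Rightarrow> 'j) \<Rightarrow> ('i, 'a::chilbert_space) ell2 \<Rightarrow>\<^sub>L ('j, 'a) ell2"
  is reindex_ell2 by (rule bounded_linear_reindex_ell2)

lemma clinear_reindex_op: "clinear_op (reindex_op s)"
  by (simp add: clinear_op_def reindex_op.rep_eq scaleC_reindex_ell2)

section \<open>Adjoints and positive operators\<close>

definition adj :: "('a::chilbert_space \<Rightarrow>\<^sub>L 'b::chilbert_space) \<Rightarrow> ('b \<Rightarrow>\<^sub>L 'a)" where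
  "adj T = (THE S :: 'b \<Rightarrow>\<^sub>L 'a. \<forall>x y. cinner (T x) y = cinner x (S y))"

definition nonneg_op :: "('a::complex_inner \<Rightarrow>\<^sub>L 'a) \<Rightarrow> bool" where
  "nonneg_op T \<longleftrightarrow> (\<forall>x. Im (cinner (T x) x) = 0 \<and> 0 \<le> Re (cinner (T x) x))"

lemma orth_projection_exists:
  fixes M :: "'a::chilbert_space set"
  assumes cl: "closed M" and sub: "complex_vector.subspace M"
  shows "\<exists>y\<in>M. \<forall>z\<in>M. cinner (x - y) z = 0"
proof -
  define d where "d = (INF y\<in>M. (norm (x - y))\<^sup>2)"
  have M0: "0 \<in> M" using sub by (rule complex_vector.subspace_0)
  have dle: "d \<le> (norm (x - y))\<^sup>2" if "y \<in> M" for y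
    unfolding d_def by (rule cINF_lower[OF bdd_belowI2[of _ 0] that]) simp
  have "\<exists>y\<in>M. (norm (x - y))\<^sup>2 < d + inverse (real (Suc n))" for n
  proof -
    have "d < d + inverse (real (Suc n))" by simp
    then show ?thesis unfolding d_def
      by (subst (asm) cINF_less_iff) (use M0 in \<open>auto intro!: bdd_belowI2[of _ 0]\<close>)
  qed
  then obtain y where yM: "\<And>n. y n \<in> M" and yd: "\<And>n. (norm (x - y n))\<^sup>2 < d + inverse (real (Suc n))"
    by metis
  have half: "(1/2) *\<^sub>R (a + b) \<in> M" if "a \<in> M" "b \<in> M" for a b
    using that complex_vector.subspace_scale[OF sub complex_vector.subspace_add[OF sub that], of "complex_of_real (1/2)"]
    by (simp only: scaleC_of_real)
  have par: "(norm (a - b))\<^sup>2 \<le> 2 * (norm (x - a))\<^sup>2 + 2 * (norm (x - b))\<^sup>2 - 4 * d"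
    if "a \<in> M" "b \<in> M" for a b
  proof -
    have "x - (1/2) *\<^sub>R (a + b) = (1/2) *\<^sub>R ((x - a) + (x - b))"
      by (simp add: algebra_simps flip: scaleR_add_left)
    then have n: "norm (x - (1/2) *\<^sub>R (a + b)) = norm ((x - a) + (x - b)) / 2" by simp
    have "4 * d \<le> (norm ((x - a) + (x - b)))\<^sup>2"
      using dle[OF half[OF that]] unfolding n by (simp add: power_divide)
    moreover have "(norm (a - b))\<^sup>2 = (norm ((x - b) - (x - a)))\<^sup>2" by simp
    ultimately show ?thesis
      unfolding norm_add_sq norm_diff_sq[of "x - b" "x - a"] using cinner_commute[of "x - a" "x - b"] by simp
  qed
  have "Cauchy y"
  proof (rule metric_CauchyI)
    fix e :: real assume e: "e > 0"
    then obtain N where N: "inverse (real (Suc N)) < e\<^sup>2 / 4"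
      using reals_Archimedean[of "e\<^sup>2/4"] by auto
    have "dist (y m) (y n) < e" if "m \<ge> N" "n \<ge> N" for m n
    proof -
      have "inverse (real (Suc m)) \<le> inverse (real (Suc N))" "inverse (real (Suc n)) \<le> inverse (real (Suc N))"
        using that by (auto intro!: le_imp_inverse_le)
      then have "(norm (y m - y n))\<^sup>2 < e\<^sup>2"
        using par[OF yM yM, of m n] yd[of m] yd[of n] N by linarith
      then show ?thesis using e by (simp add: dist_norm power_less_imp_less_base)
    qed
    then show "\<exists>M. \<forall>m\<ge>M. \<forall>n\<ge>M. dist (y m) (y n) < e" by blast
  qed
  then obtain l where l: "y \<longlonglongrightarrow> l" by (auto simp: Cauchy_convergent_iff convergent_def)
  have lM: "l \<in> M" using closed_sequentially[OF cl yM l] . 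
  have ld: "(norm (x - l))\<^sup>2 \<le> d"
  proof (rule LIMSEQ_le)
    show "(\<lambda>n. (norm (x - y n))\<^sup>2) \<longlonglongrightarrow> (norm (x - l))\<^sup>2" by (intro tendsto_intros l)
    show "(\<lambda>n. d + inverse (real (Suc n))) \<longlonglongrightarrow> d"
      using tendsto_add[OF tendsto_const LIMSEQ_inverse_real_of_nat, of d] by simp
    show "\<exists>N. \<forall>n\<ge>N. (norm (x - y n))\<^sup>2 \<le> d + inverse (real (Suc n))"
      using yd less_imp_le by blast
  qed
  have "cinner (x - l) z = 0" if z: "z \<in> M" for z
  proof (cases "z = 0")
    case False
    then have zz: "cinner z z \<noteq> 0" by simp
    define c where "c = cinner (x - l) z / cinner z z"
    have "l + c *\<^sub>C z \<in> M"
      by (intro complex_vector.subspace_add[OF sub] complex_vector.subspace_scale[OF sub] lM z)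
    then have "d \<le> (norm ((x - l) - c *\<^sub>C z))\<^sup>2" using dle by (simp add: diff_diff_add)
    moreover have "cinner ((x - l) - c *\<^sub>C z) (c *\<^sub>C z) = 0"
      using zz by (simp add: cinner_diff_left[of "x - l"] cinner_scaleC_left cinner_scaleC_right c_def)
    then have "(norm (x - l))\<^sup>2 = (norm ((x - l) - c *\<^sub>C z))\<^sup>2 + (norm (c *\<^sub>C z))\<^sup>2"
      using norm_add_orth[of "(x - l) - c *\<^sub>C z" "c *\<^sub>C z"] by simp
    ultimately have "(norm (c *\<^sub>C z))\<^sup>2 \<le> 0" using ld by linarith
    then have "c = 0" using False by (simp add: norm_scaleC)
    then show ?thesis using zz by (simp add: c_def)
  qed simp
  then show ?thesis using lM by blast
qed

lemma riesz_representation: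
  fixes f :: "'a::chilbert_space \<Rightarrow> complex"
  assumes bl: "bounded_linear f" and cl: "\<And>c x. f (c *\<^sub>C x) = c * f x"
  shows "\<exists>z. \<forall>x. f x = cinner x z"
proof (cases "\<forall>x. f x = 0")
  case True
  then show ?thesis by (intro exI[of _ 0]) simp
next
  case False
  then obtain x0 where x0: "f x0 \<noteq> 0" by blast
  interpret f: bounded_linear f by (rule bl)
  let ?M = "{x. f x = 0}"
  have "closed ?M"
    by (intro closed_Collect_eq continuous_intros bounded_linear.continuous_on[OF bl])
  moreover have "complex_vector.subspace ?M"
    by (auto simp: complex_vector.subspace_def f.zero f.add cl)
  ultimately obtain y where y: "f y = 0" "\<And>z. f z = 0 \<Longrightarrow> cinner (x0 - y) z = 0"
    using orth_projection_exists[of ?M x0] by auto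
  define u where "u = x0 - y"
  have fu: "f u \<noteq> 0" using x0 y by (simp add: u_def f.diff)
  then have u0: "cinner u u \<noteq> 0" using f.zero by auto
  have "f x = cinner x ((cnj (f u) / cinner u u) *\<^sub>C u)" for x
  proof -
    have "f (x - (f x / f u) *\<^sub>C u) = 0" using fu by (simp add: f.diff cl)
    then have "cinner u (x - (f x / f u) *\<^sub>C u) = 0" using y by (simp add: u_def)
    then have "cinner (x - (f x / f u) *\<^sub>C u) u = 0" using cinner_commute by (metis complex_cnj_zero)
    then have *: "cinner x u = (f x / f u) * cinner u u"
      by (simp add: cinner_diff_left cinner_scaleC_left)
    have "cnj (cinner u u) = cinner u u" by (rule cinner_commute[symmetric])
    then have "cinner x ((cnj (f u) / cinner u u) *\<^sub>C u) = (f u / cinner u u) * cinner x u"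
      by (simp add: cinner_scaleC_right)
    also have "\<dots> = f x" unfolding * using fu u0 by simp
    finally show ?thesis by simp
  qed
  then show ?thesis by blast
qed

lemma adj_exists:
  fixes T :: "'a::chilbert_space \<Rightarrow>\<^sub>L 'b::chilbert_space"
  assumes T: "clinear_op T"
  shows "\<exists>S::'b \<Rightarrow>\<^sub>L 'a. clinear_op S \<and> (\<forall>x y. cinner (T x) y = cinner x (S y))"
proof -
  have "\<exists>z. \<forall>x. cinner (T x) y = cinner x z" for y
    by (rule riesz_representation[OF bounded_linear_compose[OF bounded_linear_cinner_left blinfun.bounded_linear_right]])
       (use T in \<open>simp add: clinear_op_def cinner_scaleC_left\<close>)
  then obtain S where S: "\<And>x y. cinner (T x) y = cinner x (S y)" by metis
  have bl: "bounded_linear S"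
  proof (rule bounded_linear_intro[where K="norm T"])
    show "S (x + y) = S x + S y" for x y
      by (rule cinner_ext_right) (simp add: cinner_add_right S[symmetric])
    show "S (r *\<^sub>R x) = r *\<^sub>R S x" for r x
      by (rule cinner_ext_right) (simp add: cinner_scaleR_right S[symmetric])
    show "norm (S y) \<le> norm y * norm T" for y
    proof (cases "S y = 0")
      case False
      have "(norm (S y))\<^sup>2 = cmod (cinner (T (S y)) y)" by (simp add: S cinner_self norm_power)
      also have "\<dots> \<le> norm (T (S y)) * norm y" by (rule cauchy_schwarz)
      also have "\<dots> \<le> (norm T * norm (S y)) * norm y" by (intro mult_right_mono norm_blinfun) simp
      finally show ?thesis using False by (simp add: power2_eq_square mult_ac)
    qed simp
  qed
  have "S (c *\<^sub>C y) = c *\<^sub>C S y" for c y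
    by (rule cinner_ext_right) (simp add: cinner_scaleC_right S[symmetric])
  then show ?thesis
    by (intro exI[of _ "Blinfun S"]) (simp add: clinear_op_def bounded_linear_Blinfun_apply[OF bl] S)
qed

lemma adj_eqI:
  assumes "\<And>x y. cinner (blinfun_apply T x) y = cinner x (blinfun_apply S y)"
  shows "adj T = S"
  unfolding adj_def
proof (rule the_equality)
  fix S' assume "\<forall>x y. cinner (blinfun_apply T x) y = cinner x (blinfun_apply S' y)"
  then have "cinner z (blinfun_apply S' y) = cinner z (blinfun_apply S y)" for z y
    using assms[of z y] by simp
  then show "S' = S" by (intro blinfun_eqI) (rule cinner_ext_right)
qed (use assms in blast)

lemma cinner_adj: "clinear_op T \<Longrightarrow> cinner (blinfun_apply T x) y = cinner x (adj T y)"
  using adj_exists[of T] adj_eqI[of T] by metis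

lemma clinear_adj: "clinear_op T \<Longrightarrow> clinear_op (adj T)"
  using adj_exists[of T] adj_eqI[of T] by metis

section \<open>The class \<open>C\<^sub>\<rho>\<close> and the joint radii\<close>

text \<open>The generators of the free semigroup are indexed by a finite type \<open>'n\<close>; its elements are the
  words in \<open>'n list\<close>, with neutral element \<open>[]\<close>.\<close>

fun word_op :: "('n \<Rightarrow> ('a::real_normed_vector \<Rightarrow>\<^sub>L 'a)) \<Rightarrow> 'n list \<Rightarrow> ('a \<Rightarrow>\<^sub>L 'a)" where
  "word_op T [] = id_blinfun"
| "word_op T (i # \<alpha>) = T i o\<^sub>L word_op T \<alpha>"

definition isometry_op :: "('a::complex_normed_vector \<Rightarrow>\<^sub>L 'b::complex_normed_vector) \<Rightarrow> bool" where
  "isometry_op V \<longleftrightarrow> clinear_op V \<and> (\<forall>x. norm (V x) = norm x)"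

text \<open>The inclusion of \<open>H\<close> into \<open>G\<close> is an isometry \<open>J\<close>, so that \<open>adj J\<close> is the
  orthogonal projection onto \<open>H\<close>, regarded as a map \<open>G \<rightarrow> H\<close>.\<close>

definition rho_dilation ::
  "real \<Rightarrow> ('n \<Rightarrow> ('h::chilbert_space \<Rightarrow>\<^sub>L 'h)) \<Rightarrow> ('h \<Rightarrow>\<^sub>L 'g::chilbert_space) \<Rightarrow> ('n \<Rightarrow> ('g \<Rightarrow>\<^sub>L 'g)) \<Rightarrow> bool" where
  "rho_dilation \<rho> T J V \<longleftrightarrow>
     isometry_op J \<and> (\<forall>i. isometry_op (V i)) \<and>
     (\<forall>i j. i \<noteq> j \<longrightarrow> (\<forall>x y. cinner (V i x) (V j y) = 0)) \<and>
     (\<forall>\<alpha>. \<alpha> \<noteq> [] \<longrightarrow> word_op T \<alpha> = \<rho> *\<^sub>R (adj J o\<^sub>L word_op V \<alpha> o\<^sub>L J))"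

text \<open>HOL cannot quantify existentially over the type carrying \<open>G\<close>. The space \<open>G = \<ell>\<^sup>2(\<nat>; H)\<close> is
  large enough: see \<open>C_class_of_dilation\<close> below, which says that a dilation on any Hilbert space
  yields one on \<open>\<ell>\<^sup>2(\<nat>; H)\<close>.\<close>

definition C_class :: "real \<Rightarrow> ('n \<Rightarrow> ('h::chilbert_space \<Rightarrow>\<^sub>L 'h)) set" where
  "C_class \<rho> = {T. (\<forall>i. clinear_op (T i)) \<and>
     (\<exists>(J :: 'h \<Rightarrow>\<^sub>L (nat, 'h) ell2) V. rho_dilation \<rho> T J V)}"

definition joint_op_radius :: "real \<Rightarrow> ('n \<Rightarrow> ('h::chilbert_space \<Rightarrow>\<^sub>L 'h)) \<Rightarrow> real" where
  "joint_op_radius \<rho> T = Inf {t. t > 0 \<and> (\<lambda>i. (1 / t) *\<^sub>R T i) \<in> C_class \<rho>}"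

definition joint_spectral_radius :: "('n::finite \<Rightarrow> ('h::chilbert_space \<Rightarrow>\<^sub>L 'h)) \<Rightarrow> real" where
  "joint_spectral_radius T =
     lim (\<lambda>k. norm (\<Sum>\<alpha> | length \<alpha> = k. word_op T \<alpha> o\<^sub>L adj (word_op T \<alpha>)) powr (1 / (2 * real k)))"

section \<open>The kernel \<open>P\<^sub>\<rho>(X, R)\<close>\<close>

text \<open>The full Fock space, through its orthonormal basis \<open>e\<^sub>\<alpha> = e\<^bsub>i\<^sub>1\<^esub> \<otimes> \<dots> \<otimes> e\<^bsub>i\<^sub>k\<^esub>\<close> for
  \<open>\<alpha> = [i\<^sub>1, \<dots>, i\<^sub>k]\<close>, with \<open>e\<^bsub>[]\<^esub> = 1\<close>. Here \<open>e\<^sub>\<alpha>\<close> is \<open>ket \<alpha> 1\<close>.\<close>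

type_synonym 'n fock = "('n list, complex) ell2"

definition right_creation :: "'n \<Rightarrow> ('n fock \<Rightarrow>\<^sub>L 'n fock)" where
  "right_creation i = reindex_op (\<lambda>\<alpha>. \<alpha> @ [i])"

lemma right_creation_ket: "right_creation i (ket \<alpha> c) = ket (\<alpha> @ [i]) c"
  by (simp add: right_creation_def reindex_op.rep_eq reindex_ell2_ket inj_def)

text \<open>\<open>H \<otimes> \<ell>\<^sup>2(I)\<close> is \<open>\<ell>\<^sup>2(I; H)\<close>, with the elementary tensors \<open>tensor_vec x f\<close>; see
  \<open>cinner_tensor_vec\<close> and \<open>ket_has_sum\<close> below. For complex-linear \<open>X\<close> and \<open>S\<close> the operator
  \<open>X \<otimes> S\<close> exists and is unique: see \<open>tensor_op\<close> and \<open>tensor_op_eqI\<close>.\<close>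

lift_definition tensor_vec :: "'h::chilbert_space \<Rightarrow> ('i, complex) ell2 \<Rightarrow> ('i, 'h) ell2"
  is "\<lambda>x f i. f i *\<^sub>C x"
  by (simp add: norm_scaleC power_mult_distrib summable_on_cmult_left)

definition tensor_op ::
  "('h::chilbert_space \<Rightarrow>\<^sub>L 'h) \<Rightarrow> (('i, complex) ell2 \<Rightarrow>\<^sub>L ('i, complex) ell2) \<Rightarrow> (('i, 'h) ell2 \<Rightarrow>\<^sub>L ('i, 'h) ell2)" where
  "tensor_op X S = (THE Z :: ('i, 'h) ell2 \<Rightarrow>\<^sub>L ('i, 'h) ell2. \<forall>x f. Z (tensor_vec x f) = tensor_vec (X x) (S f))"

definition rho_kernel ::
  "real \<Rightarrow> ('n::finite \<Rightarrow> ('h::chilbert_space \<Rightarrow>\<^sub>L 'h)) \<Rightarrow> (('n list, 'h) ell2 \<Rightarrow>\<^sub>L ('n list, 'h) ell2)" where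
  "rho_kernel \<rho> X =
     (\<Sum>k. \<Sum>\<alpha> | length \<alpha> = Suc k. tensor_op (word_op X \<alpha>) (adj (word_op right_creation (rev \<alpha>))))
     + \<rho> *\<^sub>R tensor_op id_blinfun id_blinfun
     + (\<Sum>k. \<Sum>\<alpha> | length \<alpha> = Suc k. tensor_op (adj (word_op X \<alpha>)) (word_op right_creation (rev \<alpha>)))"

section \<open>Harnack domination\<close>

text \<open>\<open>B(H) \<otimes> M\<^sub>m\<close> is the algebra of \<open>m \<times> m\<close> matrices over \<open>B(H)\<close>, acting on
  \<open>H \<otimes> \<complex>\<^sup>m = H\<^sup>m\<close>; such a matrix is a function of two indices of which only the values below \<open>m\<close>
  matter. A polynomial \<open>p = \<Sum>\<^sub>\<alpha> X\<^sub>\<alpha> \<otimes> M\<^sub>\<alpha>\<close> is given by its coefficients \<open>M\<^sub>\<alpha> = p \<alpha>\<close>.\<close>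

type_synonym 'h op_matrix = "nat \<Rightarrow> nat \<Rightarrow> ('h \<Rightarrow>\<^sub>L 'h)"
type_synonym 'n matrix_poly = "'n list \<Rightarrow> nat \<Rightarrow> nat \<Rightarrow> complex"

definition poly_support :: "nat \<Rightarrow> 'n matrix_poly \<Rightarrow> 'n list set" where
  "poly_support m p = {\<alpha>. \<exists>i<m. \<exists>j<m. p \<alpha> i j \<noteq> 0}"

definition poly_eval :: "nat \<Rightarrow> 'n matrix_poly \<Rightarrow> ('n \<Rightarrow> ('h::chilbert_space \<Rightarrow>\<^sub>L 'h)) \<Rightarrow> 'h op_matrix" where
  "poly_eval m p X i j = (\<Sum>\<alpha>\<in>poly_support m p. p \<alpha> i j *\<^sub>C word_op X \<alpha>)"

definition Re_op_matrix :: "'h::chilbert_space op_matrix \<Rightarrow> 'h op_matrix" where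
  "Re_op_matrix Q i j = (1 / 2) *\<^sub>R (adj (Q j i) + Q i j)"

definition nonneg_op_matrix :: "nat \<Rightarrow> 'h::chilbert_space op_matrix \<Rightarrow> bool" where
  "nonneg_op_matrix m Q \<longleftrightarrow>
     (\<forall>x :: nat \<Rightarrow> 'h. let q = (\<Sum>i<m. cinner (\<Sum>j<m. Q i j (x j)) (x i)) in Im q = 0 \<and> 0 \<le> Re q)"

text \<open>\<open>K\<close> enters only through its type; its infinite-dimensionality is assumed where it is used.\<close>

definition positive_poly :: "'k::chilbert_space itself \<Rightarrow> nat \<Rightarrow> 'n::finite matrix_poly \<Rightarrow> bool" where
  "positive_poly K m p \<longleftrightarrow> finite (poly_support m p) \<and>
     (\<forall>X :: 'n \<Rightarrow> ('k \<Rightarrow>\<^sub>L 'k). (\<forall>i. clinear_op (X i)) \<and> norm (\<Sum>i\<in>UNIV. X i o\<^sub>L adj (X i)) < 1 \<longrightarrow>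
        nonneg_op_matrix m (Re_op_matrix (poly_eval m p X)))"

text \<open>\<open>\<Re> p(A) + (\<rho> - 1) \<Re> p(0)\<close>\<close>

definition rho_Re_poly ::
  "real \<Rightarrow> nat \<Rightarrow> 'n matrix_poly \<Rightarrow> ('n \<Rightarrow> ('h::chilbert_space \<Rightarrow>\<^sub>L 'h)) \<Rightarrow> 'h op_matrix" where
  "rho_Re_poly \<rho> m p A i j =
     Re_op_matrix (poly_eval m p A) i j + (\<rho> - 1) *\<^sub>R Re_op_matrix (poly_eval m p (\<lambda>_. 0)) i j"

definition harnack_dominated ::
  "'k::chilbert_space itself \<Rightarrow> real \<Rightarrow> ('n::finite \<Rightarrow> ('h::chilbert_space \<Rightarrow>\<^sub>L 'h)) \<Rightarrow> ('n \<Rightarrow> ('h \<Rightarrow>\<^sub>L 'h)) \<Rightarrow> bool" where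
  "harnack_dominated K \<rho> A B \<longleftrightarrow>
     (\<exists>c>0. \<forall>m p. positive_poly K m p \<longrightarrow>
        nonneg_op_matrix m (\<lambda>i j. c\<^sup>2 *\<^sub>R rho_Re_poly \<rho> m p B i j - rho_Re_poly \<rho> m p A i j))"

definition harnack_equivalent ::
  "'k::chilbert_space itself \<Rightarrow> real \<Rightarrow> ('n::finite \<Rightarrow> ('h::chilbert_space \<Rightarrow>\<^sub>L 'h)) \<Rightarrow> ('n \<Rightarrow> ('h \<Rightarrow>\<^sub>L 'h)) \<Rightarrow> bool" where
  "harnack_equivalent K \<rho> A B \<longleftrightarrow> harnack_dominated K \<rho> A B \<and> harnack_dominated K \<rho> B A"

section \<open>Dilations on arbitrary Hilbert spaces\<close>

definition orthonormal_on :: "'e set \<Rightarrow> ('e \<Rightarrow> 'a::complex_inner) \<Rightarrow> bool" where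
  "orthonormal_on E u \<longleftrightarrow> (\<forall>e\<in>E. \<forall>f\<in>E. cinner (u e) (u f) = (if e = f then 1 else 0))"

lemma norm_sum_orthonormal:
  assumes u: "orthonormal_on E u" and A: "finite A" "A \<subseteq> E"
  shows "(norm (\<Sum>e\<in>A. F e *\<^sub>C u e))\<^sup>2 = (\<Sum>e\<in>A. (cmod (F e))\<^sup>2)"
proof -
  have "complex_of_real ((norm (\<Sum>e\<in>A. F e *\<^sub>C u e))\<^sup>2)
      = (\<Sum>e\<in>A. \<Sum>f\<in>A. F f * (cnj (F e) * cinner (u f) (u e)))"
    by (simp add: cinner_self[symmetric] cinner_sum_left cinner_sum_right cinner_scaleC_left
        cinner_scaleC_right sum_distrib_left mult_ac del: of_real_power)
  also have "\<dots> = (\<Sum>e\<in>A. \<Sum>f\<in>A. if f = e then F e * cnj (F e) else 0)"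
  proof (intro sum.cong refl)
    fix e f assume "e \<in> A" "f \<in> A"
    then have "cinner (u f) (u e) = (if f = e then 1 else 0)"
      using u A unfolding orthonormal_on_def by blast
    then show "F f * (cnj (F e) * cinner (u f) (u e)) = (if f = e then F e * cnj (F e) else 0)" by simp
  qed
  also have "\<dots> = complex_of_real (\<Sum>e\<in>A. (cmod (F e))\<^sup>2)"
    using A by (simp add: sum.delta' flip: complex_norm_square)
  finally show ?thesis by (simp only: of_real_eq_iff)
qed

lemma bessel_finite:
  assumes u: "orthonormal_on E u" and A: "finite A" "A \<subseteq> E"
  shows "(\<Sum>e\<in>A. (cmod (cinner x (u e)))\<^sup>2) \<le> (norm x)\<^sup>2"
proof -
  define y where "y = (\<Sum>e\<in>A. cinner x (u e) *\<^sub>C u e)"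
  have "cinner (x - y) (u f) = 0" if f: "f \<in> A" for f
  proof -
    have "cinner y (u f) = (\<Sum>e\<in>A. if e = f then cinner x (u f) else 0)"
      unfolding y_def cinner_sum_left cinner_scaleC_left
    proof (intro sum.cong refl)
      fix e assume "e \<in> A"
      then have "cinner (u e) (u f) = (if e = f then 1 else 0)"
        using u A f unfolding orthonormal_on_def by blast
      then show "cinner x (u e) * cinner (u e) (u f) = (if e = f then cinner x (u f) else 0)" by simp
    qed
    then show ?thesis using A f by (simp add: cinner_diff_left sum.delta)
  qed
  then have "cinner (x - y) y = 0"
    unfolding y_def[of ] cinner_sum_right cinner_scaleC_right by (auto intro!: sum.neutral simp: y_def)
  then have "(norm x)\<^sup>2 = (norm (x - y))\<^sup>2 + (norm y)\<^sup>2" using norm_add_orth[of "x - y" y] by simp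
  moreover have "(norm y)\<^sup>2 = (\<Sum>e\<in>A. (cmod (cinner x (u e)))\<^sup>2)"
    unfolding y_def by (rule norm_sum_orthonormal[OF u A])
  ultimately show ?thesis using zero_le_power2[of "norm (x - y)"] by linarith
qed

lemma bessel_summable:
  assumes u: "orthonormal_on E u"
  shows "(\<lambda>e. (cmod (cinner x (u e)))\<^sup>2) summable_on E"
proof (rule nonneg_bounded_partial_sums_imp_summable_on[where C="(norm x)\<^sup>2"])
  show "\<forall>\<^sub>F A in finite_subsets_at_top E. (\<Sum>e\<in>A. (cmod (cinner x (u e)))\<^sup>2) \<le> (norm x)\<^sup>2"
    by (rule eventually_finite_subsets_at_top_weakI) (rule bessel_finite[OF u])
qed simp

lemma bessel:
  assumes u: "orthonormal_on E u"
  shows "(\<Sum>\<^sub>\<infinity>e\<in>E. (cmod (cinner x (u e)))\<^sup>2) \<le> (norm x)\<^sup>2"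
  by (rule infsum_le_finite_sums[OF bessel_summable[OF u]]) (rule bessel_finite[OF u])

lemma orthonormal_summable:
  fixes u :: "'e \<Rightarrow> 'a::chilbert_space"
  assumes u: "orthonormal_on E u" and F: "(\<lambda>e. (cmod (F e))\<^sup>2) summable_on E"
  shows "(\<lambda>e. F e *\<^sub>C u e) summable_on E"
proof -
  let ?f = "\<lambda>e. F e *\<^sub>C u e" and ?g = "\<lambda>e. (cmod (F e))\<^sup>2"
  from F obtain L where lim: "(sum ?g \<longlongrightarrow> L) (finite_subsets_at_top E)"
    unfolding has_sum_def summable_on_def by blast
  have "\<exists>P. eventually P (finite_subsets_at_top E) \<and>
              (\<forall>A A'. P A \<and> P A' \<longrightarrow> dist (sum ?f A) (sum ?f A') < r)" if r: "r > 0" for r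
  proof -
    define d where "d = r\<^sup>2 / 8"
    define P where "P A \<longleftrightarrow> finite A \<and> A \<subseteq> E \<and> dist (sum ?g A) L < d" for A
    have d: "d > 0" using r by (simp add: d_def)
    have ev_P: "eventually P (finite_subsets_at_top E)"
      using lim d by (auto simp add: P_def[abs_def] eventually_conj_iff
          eventually_finite_subsets_at_top_weakI tendsto_iff)
    then obtain A' where A': "finite A'" "A' \<subseteq> E" "\<And>A. finite A \<Longrightarrow> A' \<subseteq> A \<Longrightarrow> A \<subseteq> E \<Longrightarrow> P A"
      by (auto simp add: eventually_finite_subsets_at_top)
    have "dist (sum ?f A1) (sum ?f A2) < r" if P: "P A1" "P A2" for A1 A2
    proof -
      define A where "A = A' \<union> A1 \<union> A2"
      have A: "finite A" "A \<subseteq> E" using A' P by (auto simp: A_def P_def)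
      have PA: "P A" by (rule A'(3)) (use A in \<open>auto simp: A_def\<close>)
      have sub: "dist (sum ?f A) (sum ?f C) < r / 2" if C: "C \<subseteq> A" "P C" for C
      proof -
        have "(dist (sum ?f A) (sum ?f C))\<^sup>2 = (norm (sum ?f (A - C)))\<^sup>2"
          unfolding dist_norm using A C by (subst sum_diff) auto
        also have "\<dots> = sum ?g (A - C)"
          by (rule norm_sum_orthonormal[OF u]) (use A in auto)
        also have "\<dots> = sum ?g A - sum ?g C" using A C by (subst sum_diff) auto
        also have "\<dots> < 2 * d"
        proof -
          have "\<bar>sum ?g A - L\<bar> < d" "\<bar>sum ?g C - L\<bar> < d" using PA C(2) by (auto simp: P_def dist_real_def)
          then show ?thesis by linarith
        qed
        also have "2 * d = (r / 2)\<^sup>2" by (simp add: d_def power_divide)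
        finally show ?thesis by (rule power_less_imp_less_base) (use r in simp)
      qed
      have "dist (sum ?f A1) (sum ?f A2) \<le> dist (sum ?f A) (sum ?f A1) + dist (sum ?f A) (sum ?f A2)"
        by (rule dist_triangle3)
      also have "\<dots> < r / 2 + r / 2"
        by (intro add_strict_mono sub P) (auto simp: A_def)
      finally show ?thesis by simp
    qed
    then show ?thesis using ev_P by blast
  qed
  then have "cauchy_filter (filtermap (sum ?f) (finite_subsets_at_top E))"
    by (simp add: cauchy_filter_metric_filtermap)
  moreover have "complete (UNIV :: 'a set)"
    by (rule completeI) (auto simp: Cauchy_convergent_iff convergent_def)
  ultimately obtain S where "(sum ?f \<longlongrightarrow> S) (finite_subsets_at_top E)"
    using complete_uniform[where S="UNIV :: 'a set"] by (force simp add: filterlim_def)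
  then show ?thesis unfolding summable_on_def has_sum_def by blast
qed

lemma norm_orthonormal_infsum:
  fixes u :: "'e \<Rightarrow> 'a::chilbert_space"
  assumes u: "orthonormal_on E u" and F: "(\<lambda>e. (cmod (F e))\<^sup>2) summable_on E"
  shows "(norm (\<Sum>\<^sub>\<infinity>e\<in>E. F e *\<^sub>C u e))\<^sup>2 = (\<Sum>\<^sub>\<infinity>e\<in>E. (cmod (F e))\<^sup>2)"
proof (rule tendsto_unique[OF finite_subsets_at_top_neq_bot])
  show "((\<lambda>A. (norm (\<Sum>e\<in>A. F e *\<^sub>C u e))\<^sup>2) \<longlongrightarrow> (norm (\<Sum>\<^sub>\<infinity>e\<in>E. F e *\<^sub>C u e))\<^sup>2) (finite_subsets_at_top E)"
    by (intro tendsto_intros infsum_tendsto orthonormal_summable[OF u F])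
  have "((\<lambda>A. \<Sum>e\<in>A. (cmod (F e))\<^sup>2) \<longlongrightarrow> (\<Sum>\<^sub>\<infinity>e\<in>E. (cmod (F e))\<^sup>2)) (finite_subsets_at_top E)"
    by (rule infsum_tendsto[OF F])
  moreover have "\<forall>\<^sub>F A in finite_subsets_at_top E. (\<Sum>e\<in>A. (cmod (F e))\<^sup>2) = (norm (\<Sum>e\<in>A. F e *\<^sub>C u e))\<^sup>2"
    by (rule eventually_finite_subsets_at_top_weakI) (rule norm_sum_orthonormal[OF u, symmetric])
  ultimately show "((\<lambda>A. (norm (\<Sum>e\<in>A. F e *\<^sub>C u e))\<^sup>2) \<longlongrightarrow> (\<Sum>\<^sub>\<infinity>e\<in>E. (cmod (F e))\<^sup>2)) (finite_subsets_at_top E)"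
    by (rule Lim_transform_eventually)
qed

text \<open>The partial isometry \<open>\<Sum>\<^sub>e b\<^sub>e \<langle>-, a\<^sub>e\<rangle>\<close> between the closed spans of two orthonormal families.\<close>

definition orth_map :: "'e set \<Rightarrow> ('e \<Rightarrow> 'a::chilbert_space) \<Rightarrow> ('e \<Rightarrow> 'b::chilbert_space) \<Rightarrow> 'a \<Rightarrow> 'b" where
  "orth_map E a b x = (\<Sum>\<^sub>\<infinity>e\<in>E. cinner x (a e) *\<^sub>C b e)"

lemma orth_map_has_sum:
  assumes a: "orthonormal_on E a" and b: "orthonormal_on E b"
  shows "((\<lambda>e. cinner x (a e) *\<^sub>C b e) has_sum orth_map E a b x) E"
  unfolding orth_map_def by (intro has_sum_infsum orthonormal_summable[OF b] bessel_summable[OF a])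

lemma cinner_orth_map_has_sum:
  assumes a: "orthonormal_on E a" and b: "orthonormal_on E b"
  shows "((\<lambda>e. cinner x (a e) * cinner (b e) y) has_sum cinner (orth_map E a b x) y) E"
  using has_sum_bounded_linear[OF bounded_linear_cinner_left orth_map_has_sum[OF a b]]
  by (simp add: cinner_scaleC_left)

lemma cinner_orth_map_eq_0:
  assumes a: "orthonormal_on E a" and b: "orthonormal_on E b" and y: "\<And>e. e \<in> E \<Longrightarrow> cinner (b e) y = 0"
  shows "cinner (orth_map E a b x) y = 0"
  by (rule has_sum_unique[OF cinner_orth_map_has_sum[OF a b]]) (rule has_sum_0, simp add: y)

lemma cinner_orth_map_adj:
  assumes a: "orthonormal_on E a" and b: "orthonormal_on E b"
  shows "cinner (orth_map E a b x) y = cinner x (orth_map E b a y)"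
proof (rule has_sum_unique[OF cinner_orth_map_has_sum[OF a b]])
  have "((\<lambda>e. cnj (cinner y (b e) * cinner (a e) x)) has_sum cnj (cinner (orth_map E b a y) x)) E"
    unfolding has_sum_cnj_iff by (rule cinner_orth_map_has_sum[OF b a])
  then show "((\<lambda>e. cinner x (a e) * cinner (b e) y) has_sum cinner x (orth_map E b a y)) E"
    by (simp add: cinner_commute[symmetric] mult.commute)
qed

lemma cinner_orth_map_base:
  assumes a: "orthonormal_on E a" and b: "orthonormal_on E b" and e: "e \<in> E"
  shows "cinner (orth_map E a b x) (b e) = cinner x (a e)"
proof (rule has_sum_unique[OF cinner_orth_map_has_sum[OF a b]])
  have "((\<lambda>f. cinner x (a f) * cinner (b f) (b e)) has_sum cinner x (a e)) {e}"
    using b e by (intro has_sum_finiteI) (auto simp: orthonormal_on_def)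
  then show "((\<lambda>f. cinner x (a f) * cinner (b f) (b e)) has_sum cinner x (a e)) E"
    by (rule has_sum_cong_neutral[THEN iffD1, rotated -1])
       (use b e in \<open>auto simp: orthonormal_on_def\<close>)
qed

lemma norm_orth_map:
  assumes a: "orthonormal_on E a" and b: "orthonormal_on E b"
  shows "(norm (orth_map E a b x))\<^sup>2 = (\<Sum>\<^sub>\<infinity>e\<in>E. (cmod (cinner x (a e)))\<^sup>2)"
  unfolding orth_map_def by (rule norm_orthonormal_infsum[OF b bessel_summable[OF a]])

lemma bounded_linear_orth_map:
  assumes a: "orthonormal_on E a" and b: "orthonormal_on E b"
  shows "bounded_linear (orth_map E a b)"
proof (rule bounded_linear_intro[where K=1])
  show "orth_map E a b (x + y) = orth_map E a b x + orth_map E a b y" for x y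
    by (rule cinner_ext) (simp add: cinner_add_left cinner_orth_map_adj[OF a b])
  show "orth_map E a b (r *\<^sub>R x) = r *\<^sub>R orth_map E a b x" for r x
    by (rule cinner_ext) (simp add: cinner_scaleR_left cinner_orth_map_adj[OF a b])
  fix x
  have "(norm (orth_map E a b x))\<^sup>2 \<le> (norm x)\<^sup>2"
    unfolding norm_orth_map[OF a b] by (rule bessel[OF a])
  then show "norm (orth_map E a b x) \<le> norm x * 1" using power2_le_imp_le[OF _ norm_ge_zero] by simp
qed

lemma scaleC_orth_map:
  assumes a: "orthonormal_on E a" and b: "orthonormal_on E b"
  shows "orth_map E a b (c *\<^sub>C x) = c *\<^sub>C orth_map E a b x"
  by (rule cinner_ext) (simp add: cinner_scaleC_left cinner_orth_map_adj[OF a b])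

lemma maximal_orthonormal:
  fixes M :: "'a::complex_inner set"
  assumes M: "\<And>c x. x \<in> M \<Longrightarrow> c *\<^sub>C x \<in> M"
  shows "\<exists>E\<subseteq>M. orthonormal_on E (\<lambda>e. e) \<and> (\<forall>x\<in>M. (\<forall>e\<in>E. cinner x e = 0) \<longrightarrow> x = 0)"
proof -
  let ?A = "{E. E \<subseteq> M \<and> orthonormal_on E (\<lambda>e. e)}"
  have "\<exists>E\<in>?A. \<forall>X\<in>?A. E \<subseteq> X \<longrightarrow> X = E"
  proof (rule subset_Zorn')
    fix C assume C: "subset.chain ?A C"
    have X: "X \<subseteq> M" "orthonormal_on X (\<lambda>e. e)" if "X \<in> C" for X
      using C that unfolding subset_chain_def by auto
    have "orthonormal_on (\<Union>C) (\<lambda>e. e)"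
      unfolding orthonormal_on_def
    proof (intro ballI)
      fix e f assume "e \<in> \<Union>C" "f \<in> \<Union>C"
      then obtain Y Z where YZ: "Y \<in> C" "e \<in> Y" "Z \<in> C" "f \<in> Z" by blast
      then have "Y \<subseteq> Z \<or> Z \<subseteq> Y" using C unfolding subset_chain_def by blast
      then obtain X' where X': "X' \<in> C" "e \<in> X'" "f \<in> X'" using YZ by (elim disjE) (auto 0 3)
      then show "cinner e f = (if e = f then 1 else 0)"
        using X(2)[OF X'(1)] unfolding orthonormal_on_def by blast
    qed
    then show "\<Union>C \<in> ?A" using X(1) by (simp add: Union_least)
  qed
  then obtain E where E0: "E \<in> ?A" and max0: "\<forall>X\<in>?A. E \<subseteq> X \<longrightarrow> X = E" by (rule bexE)
  have E: "E \<subseteq> M" "orthonormal_on E (\<lambda>e. e)" using E0 by simp_all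
  have max: "X = E" if "X \<subseteq> M" "orthonormal_on X (\<lambda>e. e)" "E \<subseteq> X" for X
    using max0 that by simp
  have "x = 0" if x: "x \<in> M" and orth: "\<forall>e\<in>E. cinner x e = 0" for x
  proof (rule ccontr)
    assume nz: "x \<noteq> 0"
    define y where "y = complex_of_real (inverse (norm x)) *\<^sub>C x"
    have ny: "norm y = 1" using nz by (simp add: y_def norm_scaleC norm_inverse)
    have oy: "cinner y e = 0" "cinner e y = 0" if "e \<in> E" for e
    proof -
      show 1: "cinner y e = 0" using orth that by (simp add: y_def cinner_scaleC_left)
      show "cinner e y = 0" using cinner_commute[of e y] 1 by simp
    qed
    have yy: "cinner y y = 1" using ny by (simp add: cinner_self)
    then have yE: "y \<notin> E" using oy(1) by fastforce
    have "orthonormal_on (insert y E) (\<lambda>e. e)"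
      using E(2) oy yy yE unfolding orthonormal_on_def by auto
    moreover have "insert y E \<subseteq> M" using E(1) M[OF x] by (simp add: y_def)
    ultimately show False using max[of "insert y E"] yE by blast
  qed
  then show ?thesis using E by blast
qed

theorem C_class_of_dilation:
  fixes T :: "'n::finite \<Rightarrow> ('h::chilbert_space \<Rightarrow>\<^sub>L 'h)"
    and J :: "'h \<Rightarrow>\<^sub>L 'g::chilbert_space" and V :: "'n \<Rightarrow> ('g \<Rightarrow>\<^sub>L 'g)"
  assumes T: "\<And>i. clinear_op (T i)" and dil: "rho_dilation \<rho> T J V"
  shows "T \<in> C_class \<rho>"
proof -
  have J: "clinear_op J" "\<And>h. norm (J h) = norm h"
    and V: "\<And>i. clinear_op (V i)" "\<And>i x. norm (V i x) = norm x"
    and Vorth: "\<And>i j x y. i \<noteq> j \<Longrightarrow> cinner (V i x) (V j y) = 0"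
    and TV: "\<And>\<alpha>. \<alpha> \<noteq> [] \<Longrightarrow> word_op T \<alpha> = \<rho> *\<^sub>R (adj J o\<^sub>L word_op V \<alpha> o\<^sub>L J)"
    using dil by (simp_all add: rho_dilation_def isometry_op_def)
  have word_clinear: "clinear_op (word_op V \<alpha>)" for \<alpha>
    by (induction \<alpha>) (use V(1) in \<open>auto simp: clinear_op_def\<close>)

  define N where "N = {z. \<forall>\<alpha> h. cinner (word_op V \<alpha> (J h)) z = 0}"
  define G0 where "G0 = {x. \<forall>z\<in>N. cinner x z = 0}"
  have word_G0: "word_op V \<alpha> (J h) \<in> G0" for \<alpha> h by (simp add: G0_def N_def)
  have V_G0: "V i x \<in> G0" if x: "x \<in> G0" for i x
  proof -
    have "cinner (V i x) z = 0" if z: "z \<in> N" for z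
    proof -
      have "cinner (word_op V \<alpha> (J h)) (adj (V i) z) = 0" for \<alpha> h
      proof -
        have "cinner (word_op V (i # \<alpha>) (J h)) z = 0" using z unfolding N_def by blast
        then show ?thesis by (simp add: cinner_adj[OF V(1)])
      qed
      then have "adj (V i) z \<in> N" by (simp add: N_def)
      then show ?thesis using x by (simp add: G0_def cinner_adj[OF V(1)])
    qed
    then show ?thesis by (simp add: G0_def)
  qed
  have G0_scale: "c *\<^sub>C x \<in> G0" if "x \<in> G0" for c x
    using that by (simp add: G0_def cinner_scaleC_left)

  obtain B :: "'h set" where B: "orthonormal_on B (\<lambda>e. e)" and Bmax: "\<And>x. (\<forall>e\<in>B. cinner x e = 0) \<Longrightarrow> x = 0"
    using maximal_orthonormal[of UNIV] by auto
  obtain E where EG: "E \<subseteq> G0" and E: "orthonormal_on E (\<lambda>e. e)"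
    and Emax: "\<And>x. x \<in> G0 \<Longrightarrow> (\<forall>e\<in>E. cinner x e = 0) \<Longrightarrow> x = 0"
    using maximal_orthonormal[of G0, OF G0_scale] by auto

  have "\<exists>p. snd p \<in> B \<and> cinner (word_op V (fst p) (J (snd p))) e \<noteq> 0" if e: "e \<in> E" for e
  proof (rule ccontr)
    assume neg: "\<not> ?thesis"
    have "cinner (word_op V \<alpha> (J h)) e = 0" for \<alpha> h
    proof -
      define z where "z = adj J (adj (word_op V \<alpha>) e)"
      have z: "cinner (word_op V \<alpha> (J h)) e = cinner h z" for h
        by (simp add: z_def cinner_adj[OF word_clinear] cinner_adj[OF J(1)])
      have "cinner b z = 0" if "b \<in> B" for b
        using neg[simplified, rule_format, of b \<alpha>] that by (auto simp: z)
      then have "\<forall>b\<in>B. cinner z b = 0" using cinner_commute[of z] by simp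
      then have "z = 0" by (rule Bmax)
      then show ?thesis by (simp add: z)
    qed
    then have "e \<in> N" by (simp add: N_def)
    then have "cinner e e = 0" using subsetD[OF EG e] unfolding G0_def by blast
    moreover have "cinner e e = 1" using E e by (simp add: orthonormal_on_def)
    ultimately show False by simp
  qed
  then obtain ab where ab: "\<And>e. e \<in> E \<Longrightarrow> snd (ab e) \<in> B"
      "\<And>e. e \<in> E \<Longrightarrow> cinner (word_op V (fst (ab e)) (J (snd (ab e)))) e \<noteq> 0"
    by metis
  define C where "C p = {e \<in> E. cinner (word_op V (fst p) (J (snd p))) e \<noteq> 0}" for p
  have C: "countable (C p)" for p
  proof -
    have "countable {e \<in> E. (cmod (cinner (word_op V (fst p) (J (snd p))) e))\<^sup>2 \<noteq> 0}"
      by (rule summable_countable_real[OF bessel_summable[OF E]])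
    then show ?thesis by (simp add: C_def)
  qed
  have eC: "e \<in> C (ab e)" if "e \<in> E" for e using ab(2)[OF that] that by (simp add: C_def)
  define enc where "enc e = to_nat (fst (ab e), to_nat_on (C (ab e)) e)" for e
  define u :: "'g \<Rightarrow> (nat, 'h) ell2" where "u e = ket (2 * enc e) (snd (ab e))" for e
  have u: "orthonormal_on E u"
    unfolding orthonormal_on_def
  proof (intro ballI)
    fix e f assume e: "e \<in> E" and f: "f \<in> E"
    have uef: "cinner (u e) (u f) = (if enc e = enc f then cinner (snd (ab e)) (snd (ab f)) else 0)"
      by (simp add: u_def cinner_ket_left ket_apply)
    have BB: "cinner (snd (ab e)) (snd (ab f)) = (if snd (ab e) = snd (ab f) then 1 else 0)"
      using B ab(1)[OF e] ab(1)[OF f] by (simp add: orthonormal_on_def)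
    have "e = f" if "enc e = enc f" "snd (ab e) = snd (ab f)"
    proof -
      have *: "fst (ab e) = fst (ab f)" "to_nat_on (C (ab e)) e = to_nat_on (C (ab f)) f"
        using that(1) by (simp_all add: enc_def)
      then have abef: "ab e = ab f" using that(2) by (simp add: prod_eq_iff)
      show ?thesis
        using *(2) to_nat_on_inj[OF C, of e "ab e" f] eC[OF e] eC[OF f] abef by simp
    qed
    then show "cinner (u e) (u f) = (if e = f then 1 else 0)" unfolding uef BB by auto
  qed

  define W :: "'g \<Rightarrow>\<^sub>L (nat, 'h) ell2" where "W = Blinfun (orth_map E (\<lambda>e. e) u)"
  define W' :: "(nat, 'h) ell2 \<Rightarrow>\<^sub>L 'g" where "W' = Blinfun (orth_map E u (\<lambda>e. e))"
  have W: "W x = orth_map E (\<lambda>e. e) u x" for x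
    unfolding W_def by (simp add: bounded_linear_Blinfun_apply bounded_linear_orth_map[OF E u])
  have W': "W' y = orth_map E u (\<lambda>e. e) y" for y
    unfolding W'_def by (simp add: bounded_linear_Blinfun_apply bounded_linear_orth_map[OF u E])
  have cW: "clinear_op W" "clinear_op W'"
    by (simp_all add: clinear_op_def W W' scaleC_orth_map[OF E u] scaleC_orth_map[OF u E])
  have WW': "cinner (W x) y = cinner x (W' y)" for x y
    unfolding W W' by (rule cinner_orth_map_adj[OF E u])
  have W'_G0: "W' y \<in> G0" for y
    unfolding G0_def W'
  proof (intro CollectI ballI)
    fix z assume z: "z \<in> N"
    show "cinner (orth_map E u (\<lambda>e. e) y) z = 0"
      by (rule cinner_orth_map_eq_0[OF u E]) (use EG z in \<open>auto simp: G0_def\<close>)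
  qed
  have W'W: "W' (W x) = x" if x: "x \<in> G0" for x
  proof -
    have "cinner (W' (W x)) e = cinner x e" if "e \<in> E" for e
      unfolding W' cinner_orth_map_base[OF u E that] unfolding W cinner_orth_map_base[OF E u that] ..
    then have "\<forall>e\<in>E. cinner (W' (W x) - x) e = 0" by (simp add: cinner_diff_left)
    moreover have "W' (W x) - x \<in> G0"
      using W'_G0[of "W x"] x by (simp add: G0_def cinner_diff_left)
    ultimately have "W' (W x) - x = 0" by (intro Emax)
    then show ?thesis by simp
  qed
  have cWW: "cinner (W x) (W y) = cinner x y" if "y \<in> G0" for x y
    unfolding WW' W'W[OF that] ..
  have nW: "norm (W x) = norm x" if x: "x \<in> G0" for x
  proof -
    have "complex_of_real ((norm (W x))\<^sup>2) = complex_of_real ((norm x)\<^sup>2)"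
      using cWW[OF x, of x] unfolding cinner_self .
    then have "(norm (W x))\<^sup>2 = (norm x)\<^sup>2" by (simp only: of_real_eq_iff)
    then show ?thesis by simp
  qed

  define s where "s i k = 2 * to_nat (i :: 'n, k :: nat) + 1" for i k
  have s: "inj (s i)" for i by (auto simp: inj_def s_def)
  define U :: "'n \<Rightarrow> ((nat, 'h) ell2 \<Rightarrow>\<^sub>L (nat, 'h) ell2)" where "U i = reindex_op (s i)" for i
  have U_even: "ell2_apply (U i q) (2 * k) = 0" for i q k
  proof -
    have "2 * k \<notin> range (s i)" unfolding s_def by (auto, presburger)
    then show ?thesis by (simp add: U_def reindex_op.rep_eq reindex_ell2_apply)
  qed
  have WU: "cinner (W x) (U i q) = 0" for x i q
    unfolding W by (rule cinner_orth_map_eq_0[OF E u]) (simp add: u_def cinner_ket_left U_even)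
  have UW: "cinner (U i q) (W x) = 0" for x i q
    using WU[of x i q] cinner_commute[of "U i q" "W x"] by simp
  have UU: "cinner (U i q) (U j r) = 0" if ij: "i \<noteq> j" for i j q r
  proof -
    have "cinner (ell2_apply (U i q) k) (ell2_apply (U j r) k) = 0" for k
    proof (cases "k \<in> range (s i)")
      case True
      then have "k \<notin> range (s j)" using ij by (auto simp: s_def)
      then show ?thesis by (simp add: U_def reindex_op.rep_eq reindex_ell2_apply)
    qed (simp add: U_def reindex_op.rep_eq reindex_ell2_apply)
    then show ?thesis by (simp add: cinner_ell2.rep_eq)
  qed
  have cU: "clinear_op (U i)" for i unfolding U_def by (rule clinear_reindex_op)
  have nU: "norm (U i q) = norm q" for i q
    unfolding U_def by (simp add: reindex_op.rep_eq norm_reindex_ell2 s)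

  define J' where "J' = W o\<^sub>L J"
  define V' where "V' i = (W o\<^sub>L V i o\<^sub>L W') + (U i o\<^sub>L (id_blinfun - (W o\<^sub>L W')))" for i
  have V'_apply: "V' i f = W (V i (W' f)) + U i (f - W (W' f))" for i f
    by (simp add: V'_def blinfun.add_left blinfun.diff_left)
  have J_G0: "J h \<in> G0" for h using word_G0[of "[]" h] by simp
  have isoJ': "isometry_op J'"
    using cW(1) J J_G0 by (simp add: isometry_op_def J'_def clinear_op_def nW)
  have isoV': "isometry_op (V' i)" for i
    unfolding isometry_op_def
  proof (intro conjI allI)
    have "V' i (c *\<^sub>C f) = c *\<^sub>C V' i f" for c f
      using cW V(1)[of i] cU[of i]
      by (simp add: V'_apply clinear_op_def scaleC_add_right flip: scaleC_diff_right)
    then show "clinear_op (V' i)" by (simp add: clinear_op_def)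
    fix f
    define q where "q = f - W (W' f)"
    have "cinner (W (W' f)) q = 0"
      unfolding q_def cinner_diff_right cWW[OF W'_G0] unfolding WW' by simp
    then have "(norm f)\<^sup>2 = (norm (W (W' f)))\<^sup>2 + (norm q)\<^sup>2"
      using norm_add_orth[of "W (W' f)" q] by (simp add: q_def)
    moreover have "(norm (V' i f))\<^sup>2 = (norm (W (V i (W' f))))\<^sup>2 + (norm (U i q))\<^sup>2"
      unfolding V'_apply q_def by (rule norm_add_orth[OF WU])
    ultimately have "(norm (V' i f))\<^sup>2 = (norm f)\<^sup>2"
      by (simp add: nU nW V_G0 W'_G0 V(2))
    then show "norm (V' i f) = norm f" by simp
  qed
  have V'orth: "cinner (V' i f) (V' j g) = 0" if "i \<noteq> j" for i j f g
    by (simp add: V'_apply cinner_add_left cinner_add_right WU UW UU[OF that]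
        cWW[OF V_G0[OF W'_G0]] Vorth[OF that])
  have V'W: "V' i (W x) = W (V i x)" if "x \<in> G0" for i x
    by (simp add: V'_apply W'W that)
  have word_V': "word_op V' \<alpha> (W (J h)) = W (word_op V \<alpha> (J h))" for \<alpha> h
    by (induction \<alpha>) (use word_G0 in \<open>simp_all add: V'W\<close>)
  have cJ': "clinear_op J'" using isoJ' by (simp add: isometry_op_def)
  have compress: "adj J' o\<^sub>L word_op V' \<alpha> o\<^sub>L J' = adj J o\<^sub>L word_op V \<alpha> o\<^sub>L J" for \<alpha>
  proof (rule blinfun_eqI, rule cinner_ext_right)
    fix h k
    have "cinner k (adj J' (W (word_op V \<alpha> (J h)))) = cinner k (adj J (word_op V \<alpha> (J h)))"
      by (simp add: cinner_adj[OF cJ', symmetric] cinner_adj[OF J(1), symmetric])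
         (simp add: J'_def cWW word_G0)
    then show "cinner k ((adj J' o\<^sub>L word_op V' \<alpha> o\<^sub>L J') h) = cinner k ((adj J o\<^sub>L word_op V \<alpha> o\<^sub>L J) h)"
      by (simp add: J'_def word_V')
  qed
  have "rho_dilation \<rho> T J' V'"
    unfolding rho_dilation_def compress using isoJ' isoV' V'orth TV by blast
  then show ?thesis unfolding C_class_def using T by blast
qed

section \<open>Tensor products of operators\<close>

lemma summable_on_sum:
  fixes f :: "'i \<Rightarrow> 'j \<Rightarrow> 'a::{topological_comm_monoid_add, t2_space}"
  shows "(\<And>i. f i summable_on A) \<Longrightarrow> (\<lambda>x. \<Sum>i\<in>F. f i x) summable_on A"
  by (induction F rule: infinite_finite_induct) (auto intro: summable_on_add)

lemma ket_has_sum: "((\<lambda>i. ket i (ell2_apply f i)) has_sum f) UNIV"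
proof -
  have part: "(norm (f - (\<Sum>i\<in>A. ket i (ell2_apply f i))))\<^sup>2 = (norm f)\<^sup>2 - (\<Sum>i\<in>A. (norm (ell2_apply f i))\<^sup>2)"
    if A: "finite A" for A
  proof -
    define y where "y = (\<Sum>i\<in>A. ket i (ell2_apply f i))"
    have "ell2_apply y j = (\<Sum>i\<in>A. if j = i then ell2_apply f i else 0)" for j
      unfolding y_def ell2_sum_apply ket_apply ..
    then have y: "ell2_apply y j = (if j \<in> A then ell2_apply f j else 0)" for j
      using A by (simp add: sum.delta)
    have yz: "cinner y z = (\<Sum>i\<in>A. cinner (ell2_apply f i) (ell2_apply z i))" for z
      unfolding y_def cinner_sum_left cinner_ket_left ..
    have "cinner y (f - y) = 0" unfolding yz by (rule sum.neutral) (simp add: y)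
    then have "(norm (y + (f - y)))\<^sup>2 = (norm y)\<^sup>2 + (norm (f - y))\<^sup>2" by (rule norm_add_orth)
    moreover have "complex_of_real ((norm y)\<^sup>2) = complex_of_real (\<Sum>i\<in>A. (norm (ell2_apply f i))\<^sup>2)"
      unfolding cinner_self[symmetric] yz of_real_sum by (rule sum.cong) (simp_all add: y)
    then have "(norm y)\<^sup>2 = (\<Sum>i\<in>A. (norm (ell2_apply f i))\<^sup>2)" by (simp only: of_real_eq_iff)
    ultimately show ?thesis by (simp add: y_def)
  qed
  have "((\<lambda>A. (norm f)\<^sup>2 - (\<Sum>i\<in>A. (norm (ell2_apply f i))\<^sup>2)) \<longlongrightarrow> (norm f)\<^sup>2 - (norm f)\<^sup>2)
      (finite_subsets_at_top UNIV)"
    using infsum_tendsto[OF ell2_summable[of f UNIV]]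
    by (intro tendsto_diff tendsto_const) (simp add: norm_ell2_sq)
  then have d: "((\<lambda>A. (norm f)\<^sup>2 - (\<Sum>i\<in>A. (norm (ell2_apply f i))\<^sup>2)) \<longlongrightarrow> 0) (finite_subsets_at_top UNIV)"
    unfolding diff_self .
  have "((\<lambda>A. (norm (f - (\<Sum>i\<in>A. ket i (ell2_apply f i))))\<^sup>2) \<longlongrightarrow> 0) (finite_subsets_at_top UNIV)"
    by (rule Lim_transform_eventually[OF d])
       (rule eventually_finite_subsets_at_top_weakI, rule part[symmetric])
  then have "((\<lambda>A. sqrt ((norm (f - (\<Sum>i\<in>A. ket i (ell2_apply f i))))\<^sup>2)) \<longlongrightarrow> sqrt 0) (finite_subsets_at_top UNIV)"
    by (rule tendsto_real_sqrt)
  then have "((\<lambda>A. norm ((\<Sum>i\<in>A. ket i (ell2_apply f i)) - f)) \<longlongrightarrow> 0) (finite_subsets_at_top UNIV)"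
    by (simp add: norm_minus_commute)
  then have "((\<lambda>A. (\<Sum>i\<in>A. ket i (ell2_apply f i)) - f) \<longlongrightarrow> 0) (finite_subsets_at_top UNIV)"
    by (rule tendsto_norm_zero_cancel)
  then show ?thesis unfolding has_sum_def by (rule LIM_zero_cancel)
qed

lemma tensor_vec_ket: "tensor_vec x (ket i 1) = ket i x"
  by (rule ell2_eqI) (simp add: tensor_vec.rep_eq ket_apply)

lemma tensor_op_eqI:
  fixes X :: "'h::chilbert_space \<Rightarrow>\<^sub>L 'h" and S :: "('i, complex) ell2 \<Rightarrow>\<^sub>L ('i, complex) ell2"
    and Z :: "('i, 'h) ell2 \<Rightarrow>\<^sub>L ('i, 'h) ell2"
  assumes Z: "\<And>x f. Z (tensor_vec x f) = tensor_vec (X x) (S f)"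
  shows "tensor_op X S = Z"
  unfolding tensor_op_def
proof (rule the_equality)
  fix Z' :: "('i, 'h) ell2 \<Rightarrow>\<^sub>L ('i, 'h) ell2" assume Z': "\<forall>x f. Z' (tensor_vec x f) = tensor_vec (X x) (S f)"
  have ket: "Z' (ket i x) = Z (ket i x)" for i x
  proof -
    have "Z' (tensor_vec x (ket i 1)) = Z (tensor_vec x (ket i 1))" using Z Z' by simp
    then show ?thesis by (simp only: tensor_vec_ket)
  qed
  show "Z' = Z"
  proof (rule blinfun_eqI)
    fix f
    have "((\<lambda>i. Z (ket i (ell2_apply f i))) has_sum Z' f) UNIV"
      using has_sum_bounded_linear[OF blinfun.bounded_linear_right[of Z'] ket_has_sum[of f]] by (simp add: ket)
    moreover have "((\<lambda>i. Z (ket i (ell2_apply f i))) has_sum Z f) UNIV"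
      by (rule has_sum_bounded_linear[OF blinfun.bounded_linear_right ket_has_sum])
    ultimately show "Z' f = Z f" by (rule has_sum_unique)
  qed
qed (use Z in blast)

lift_definition ell2_coeff :: "'h::chilbert_space \<Rightarrow> ('i, 'h) ell2 \<Rightarrow> ('i, complex) ell2"
  is "\<lambda>b f i. cinner (f i) b"
proof -
  fix b and f :: "'i \<Rightarrow> 'h" assume f: "(\<lambda>i. (norm (f i))\<^sup>2) summable_on UNIV"
  show "(\<lambda>i. (norm (cinner (f i) b))\<^sup>2) summable_on UNIV"
  proof (rule summable_on_comparison_test)
    show "(\<lambda>i. (norm (f i))\<^sup>2 * (norm b)\<^sup>2) summable_on UNIV" using f by (rule summable_on_cmult_left)
    show "(norm (cinner (f i) b))\<^sup>2 \<le> (norm (f i))\<^sup>2 * (norm b)\<^sup>2" for i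
      unfolding power_mult_distrib[symmetric] by (intro power_mono cauchy_schwarz) simp
  qed simp
qed

lemma sum_norm_ell2_coeff:
  assumes B: "orthonormal_on B (\<lambda>b. b)" and A: "finite A" "A \<subseteq> B"
  shows "(\<Sum>b\<in>A. (norm (ell2_coeff b f))\<^sup>2) \<le> (norm f)\<^sup>2"
proof -
  have sm: "(\<lambda>i. (cmod (cinner (ell2_apply f i) b))\<^sup>2) summable_on UNIV" for b
    using ell2_summable[of "ell2_coeff b f" UNIV] by (simp add: ell2_coeff.rep_eq)
  have "(\<Sum>b\<in>A. (norm (ell2_coeff b f))\<^sup>2) = (\<Sum>b\<in>A. \<Sum>\<^sub>\<infinity>i. (cmod (cinner (ell2_apply f i) b))\<^sup>2)"
    by (simp add: norm_ell2_sq ell2_coeff.rep_eq)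
  also have "\<dots> = (\<Sum>\<^sub>\<infinity>i. \<Sum>b\<in>A. (cmod (cinner (ell2_apply f i) b))\<^sup>2)"
    using A(1)
  proof (induction A rule: finite_induct)
    case (insert b A)
    then show ?case by (simp add: infsum_add[OF sm summable_on_sum[OF sm]])
  qed simp
  also have "\<dots> \<le> (\<Sum>\<^sub>\<infinity>i. (norm (ell2_apply f i))\<^sup>2)"
    by (intro infsum_mono summable_on_sum sm ell2_summable bessel_finite[OF B A])
  finally show ?thesis by (simp add: norm_ell2_sq)
qed

lemma tensor_id_exists:
  fixes S :: "('i, complex) ell2 \<Rightarrow>\<^sub>L ('i, complex) ell2"
  assumes S: "clinear_op S"
  shows "\<exists>Z :: ('i, 'h::chilbert_space) ell2 \<Rightarrow>\<^sub>L ('i, 'h) ell2. clinear_op Z \<and>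
    (\<forall>x f. Z (tensor_vec x f) = tensor_vec x (S f))"
proof -
  obtain B :: "'h set" where B: "orthonormal_on B (\<lambda>e. e)" and Bmax: "\<And>x. (\<forall>e\<in>B. cinner x e = 0) \<Longrightarrow> x = 0"
    using maximal_orthonormal[of UNIV] by auto
  have expand: "orth_map B (\<lambda>b. b) (\<lambda>b. b) x = x" for x
  proof -
    have "\<forall>b\<in>B. cinner (orth_map B (\<lambda>b. b) (\<lambda>b. b) x - x) b = 0"
      using cinner_orth_map_base[OF B B] by (simp add: cinner_diff_left)
    then have "orth_map B (\<lambda>b. b) (\<lambda>b. b) x - x = 0" by (rule Bmax)
    then show ?thesis by simp
  qed
  define c where "c f b i = ell2_apply (S (ell2_coeff b f)) i" for f :: "('i, 'h) ell2" and b i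
  have fin: "(\<Sum>b\<in>A. \<Sum>i\<in>F. (cmod (c f b i))\<^sup>2) \<le> (norm S * norm f)\<^sup>2"
    if A: "finite A" "A \<subseteq> B" and F: "finite F" for f A F
  proof -
    have "(\<Sum>i\<in>F. (cmod (c f b i))\<^sup>2) \<le> (norm S)\<^sup>2 * (norm (ell2_coeff b f))\<^sup>2" for b
    proof -
      have "(\<Sum>i\<in>F. (cmod (c f b i))\<^sup>2) \<le> (norm (S (ell2_coeff b f)))\<^sup>2"
        unfolding norm_ell2_sq c_def by (rule finite_sum_le_infsum[OF ell2_summable F]) auto
      also have "\<dots> \<le> (norm S * norm (ell2_coeff b f))\<^sup>2" by (intro power_mono norm_blinfun) simp
      finally show ?thesis by (simp add: power_mult_distrib)
    qed
    then have "(\<Sum>b\<in>A. \<Sum>i\<in>F. (cmod (c f b i))\<^sup>2) \<le> (norm S)\<^sup>2 * (\<Sum>b\<in>A. (norm (ell2_coeff b f))\<^sup>2)"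
      unfolding sum_distrib_left by (rule sum_mono)
    also have "\<dots> \<le> (norm S)\<^sup>2 * (norm f)\<^sup>2"
      by (intro mult_left_mono sum_norm_ell2_coeff[OF B A]) simp
    finally show ?thesis by (simp add: power_mult_distrib)
  qed
  have csm: "(\<lambda>b. (cmod (c f b i))\<^sup>2) summable_on B" for f i
  proof (rule nonneg_bounded_partial_sums_imp_summable_on[where C="(norm S * norm f)\<^sup>2"])
    show "\<forall>\<^sub>F A in finite_subsets_at_top B. (\<Sum>b\<in>A. (cmod (c f b i))\<^sup>2) \<le> (norm S * norm f)\<^sup>2"
    proof (rule eventually_finite_subsets_at_top_weakI)
      fix A assume "finite A" "A \<subseteq> B"
      then show "(\<Sum>b\<in>A. (cmod (c f b i))\<^sup>2) \<le> (norm S * norm f)\<^sup>2" using fin[of A "{i}" f] by simp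
    qed
  qed simp
  have vsm: "(\<lambda>b. c f b i *\<^sub>C b) summable_on B" for f i
    by (rule orthonormal_summable[OF B csm])
  define g where "g f i = (\<Sum>\<^sub>\<infinity>b\<in>B. c f b i *\<^sub>C b)" for f i
  have g: "((\<lambda>b. c f b i *\<^sub>C b) has_sum g f i) B" for f i
    unfolding g_def by (rule has_sum_infsum[OF vsm])
  have gF: "(\<Sum>i\<in>F. (norm (g f i))\<^sup>2) \<le> (norm S * norm f)\<^sup>2" if F: "finite F" for f F
  proof -
    have "(\<Sum>i\<in>F. (norm (g f i))\<^sup>2) = (\<Sum>i\<in>F. \<Sum>\<^sub>\<infinity>b\<in>B. (cmod (c f b i))\<^sup>2)"
      unfolding g_def by (intro sum.cong refl norm_orthonormal_infsum[OF B csm])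
    also have "\<dots> = (\<Sum>\<^sub>\<infinity>b\<in>B. \<Sum>i\<in>F. (cmod (c f b i))\<^sup>2)"
      using F
    proof (induction F rule: finite_induct)
      case (insert i F)
      then show ?case by (simp add: infsum_add[OF csm summable_on_sum[OF csm]])
    qed simp
    also have "\<dots> \<le> (norm S * norm f)\<^sup>2"
      by (rule infsum_le_finite_sums[OF summable_on_sum[OF csm]]) (rule fin[OF _ _ F])
    finally show ?thesis .
  qed
  have gsm: "(\<lambda>i. (norm (g f i))\<^sup>2) summable_on UNIV" for f
    by (rule nonneg_bounded_partial_sums_imp_summable_on[where C="(norm S * norm f)\<^sup>2"])
       (auto intro: eventually_finite_subsets_at_top_weakI gF)
  define Z where "Z f = Abs_ell2 (g f)" for f
  have Z: "ell2_apply (Z f) = g f" for f unfolding Z_def using gsm by (simp add: Abs_ell2_inverse)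
  have coeff_add: "ell2_coeff b (f + h) = ell2_coeff b f + ell2_coeff b h" for b and f h :: "('i, 'h) ell2"
    by (rule ell2_eqI) (simp add: ell2_coeff.rep_eq cinner_add_left)
  have coeff_scale: "ell2_coeff b (a *\<^sub>C f) = a *\<^sub>C ell2_coeff b f" for a b and f :: "('i, 'h) ell2"
    by (rule ell2_eqI) (simp add: ell2_coeff.rep_eq cinner_scaleC_left scaleC_complex_def)
  have Zadd: "Z (f + h) = Z f + Z h" for f h
  proof (rule ell2_eqI)
    fix i
    have "g (f + h) i = g f i + g h i"
      using has_sum_unique[OF g[of "f + h" i]] has_sum_add[OF g[of f i] g[of h i]]
      by (simp add: c_def coeff_add blinfun.add_right scaleC_add_left)
    then show "ell2_apply (Z (f + h)) i = ell2_apply (Z f + Z h) i" by (simp add: Z)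
  qed
  have Zscale: "Z (a *\<^sub>C f) = a *\<^sub>C Z f" for a f
  proof (rule ell2_eqI)
    fix i
    have "c (a *\<^sub>C f) b i = a * c f b i" for b
      using S by (simp add: c_def coeff_scale clinear_op_def scaleC_complex_def)
    then have "g (a *\<^sub>C f) i = a *\<^sub>C g f i"
      using has_sum_unique[OF g[of "a *\<^sub>C f" i]] has_sum_bounded_linear[OF bounded_linear_scaleC[of a] g[of f i]]
      by (simp add: scaleC_scaleC)
    then show "ell2_apply (Z (a *\<^sub>C f)) i = ell2_apply (a *\<^sub>C Z f) i" by (simp add: Z)
  qed
  have bl: "bounded_linear Z"
  proof (rule bounded_linear_intro[where K="norm S"])
    show "Z (r *\<^sub>R f) = r *\<^sub>R Z f" for r f using Zscale[of "complex_of_real r" f] by (simp add: scaleC_of_real)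
    fix f
    have "(norm (Z f))\<^sup>2 \<le> (norm S * norm f)\<^sup>2"
      unfolding norm_ell2_sq Z by (rule infsum_le_finite_sums[OF gsm gF])
    then show "norm (Z f) \<le> norm f * norm S"
      by (subst mult.commute) (rule power2_le_imp_le, simp_all)
  qed (rule Zadd)
  have "Z (tensor_vec x f) = tensor_vec x (S f)" for x f
  proof (rule ell2_eqI)
    fix i
    have "ell2_coeff b (tensor_vec x f) = cinner x b *\<^sub>C f" for b
      by (rule ell2_eqI) (simp add: ell2_coeff.rep_eq tensor_vec.rep_eq cinner_scaleC_left scaleC_complex_def)
    then have "c (tensor_vec x f) b i = ell2_apply (S f) i * cinner x b" for b
      using S by (simp add: c_def clinear_op_def scaleC_complex_def)
    moreover have "((\<lambda>b. ell2_apply (S f) i *\<^sub>C cinner x b *\<^sub>C b) has_sum ell2_apply (S f) i *\<^sub>C x) B"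
      using has_sum_bounded_linear[OF bounded_linear_scaleC orth_map_has_sum[OF B B, of x]] unfolding expand .
    ultimately have "((\<lambda>b. c (tensor_vec x f) b i *\<^sub>C b) has_sum ell2_apply (S f) i *\<^sub>C x) B"
      by (simp add: scaleC_scaleC)
    then have "g (tensor_vec x f) i = ell2_apply (S f) i *\<^sub>C x" by (rule has_sum_unique[OF g])
    then show "ell2_apply (Z (tensor_vec x f)) i = ell2_apply (tensor_vec x (S f)) i"
      by (simp add: Z tensor_vec.rep_eq)
  qed
  then show ?thesis
    by (intro exI[of _ "Blinfun Z"]) (simp add: clinear_op_def bounded_linear_Blinfun_apply[OF bl] Zscale)
qed

lemma tensor_amplification_exists:
  fixes X :: "'h::chilbert_space \<Rightarrow>\<^sub>L 'h"
  assumes X: "clinear_op X"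
  shows "\<exists>Z :: ('i, 'h) ell2 \<Rightarrow>\<^sub>L ('i, 'h) ell2. clinear_op Z \<and> (\<forall>x f. Z (tensor_vec x f) = tensor_vec (X x) f)"
proof -
  have le: "(norm (X (ell2_apply f i)))\<^sup>2 \<le> (norm X)\<^sup>2 * (norm (ell2_apply f i))\<^sup>2" for f :: "('i, 'h) ell2" and i
    unfolding power_mult_distrib[symmetric] by (intro power_mono norm_blinfun) simp
  have sm: "(\<lambda>i. (norm (X (ell2_apply f i)))\<^sup>2) summable_on UNIV" for f :: "('i, 'h) ell2"
    by (rule summable_on_comparison_test[OF summable_on_cmult_right[OF ell2_summable] le]) simp
  define Z where "Z f = Abs_ell2 (\<lambda>i. X (ell2_apply f i))" for f :: "('i, 'h) ell2"
  have Z: "ell2_apply (Z f) i = X (ell2_apply f i)" for f i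
    unfolding Z_def using sm[of f] by (simp add: Abs_ell2_inverse)
  have bl: "bounded_linear Z"
  proof (rule bounded_linear_intro[where K="norm X"])
    show "Z (f + h) = Z f + Z h" for f h by (rule ell2_eqI) (simp add: Z blinfun.add_right)
    show "Z (r *\<^sub>R f) = r *\<^sub>R Z f" for r f by (rule ell2_eqI) (simp add: Z blinfun.scaleR_right)
    fix f
    have "(norm (Z f))\<^sup>2 \<le> (\<Sum>\<^sub>\<infinity>i. (norm X)\<^sup>2 * (norm (ell2_apply f i))\<^sup>2)"
      unfolding norm_ell2_sq Z by (rule infsum_mono[OF sm summable_on_cmult_right[OF ell2_summable] le])
    also have "\<dots> = (norm f * norm X)\<^sup>2"
      by (simp add: norm_ell2_sq infsum_cmult_right' power_mult_distrib mult.commute)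
    finally show "norm (Z f) \<le> norm f * norm X" by (rule power2_le_imp_le) simp
  qed
  have "Z (c *\<^sub>C f) = c *\<^sub>C Z f" "Z (tensor_vec x h) = tensor_vec (X x) h" for c f x h
    by (rule ell2_eqI; use X in \<open>simp add: Z clinear_op_def tensor_vec.rep_eq\<close>)+
  then show ?thesis
    by (intro exI[of _ "Blinfun Z"]) (simp add: clinear_op_def bounded_linear_Blinfun_apply[OF bl])
qed

lemma tensor_op:
  fixes X :: "'h::chilbert_space \<Rightarrow>\<^sub>L 'h" and S :: "('i, complex) ell2 \<Rightarrow>\<^sub>L ('i, complex) ell2"
  assumes X: "clinear_op X" and S: "clinear_op S"
  shows "tensor_op X S (tensor_vec x f) = tensor_vec (X x) (S f)" "clinear_op (tensor_op X S)"
proof -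
  obtain Z :: "('i, 'h) ell2 \<Rightarrow>\<^sub>L ('i, 'h) ell2" where
    Z: "clinear_op Z" "\<And>x f. Z (tensor_vec x f) = tensor_vec x (S f)"
    using tensor_id_exists[OF S] by blast
  obtain Y :: "('i, 'h) ell2 \<Rightarrow>\<^sub>L ('i, 'h) ell2" where
    Y: "clinear_op Y" "\<And>x f. Y (tensor_vec x f) = tensor_vec (X x) f"
    using tensor_amplification_exists[OF X] by blast
  have eq: "tensor_op X S = Y o\<^sub>L Z" by (rule tensor_op_eqI) (simp add: Y(2) Z(2))
  show "tensor_op X S (tensor_vec x f) = tensor_vec (X x) (S f)" by (simp add: eq Y(2) Z(2))
  show "clinear_op (tensor_op X S)" using Y(1) Z(1) by (simp add: eq clinear_op_def)
qed

lemma cinner_tensor_vec: "cinner (tensor_vec x f) (tensor_vec y h) = cinner x y * cinner f h"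
  by (simp add: cinner_ell2.rep_eq tensor_vec.rep_eq cinner_scaleC_left cinner_scaleC_right
      cinner_complex_def mult.assoc flip: infsum_cmult_right') (simp add: mult_ac)

end

theory Submission
  imports Defs
begin

text \<open>Index by words the multi-Toeplitz kernel \<open>P\<close> with entries \<open>\<rho> I\<close>, \<open>A\<^sub>\<gamma>\<close> and \<open>A\<^sub>\<gamma>\<^sup>*\<close>; it is the matrix of
  \<open>P\<^sub>\<rho>(A, R)\<close>. Compressions of the kernel to finitely many words are themselves of the form
  \<open>\<Re> p(A) + (\<rho> - 1) \<Re> p(0)\<close> with \<open>p\<close> positive, so Harnack equivalence with 0 gives \<open>a \<le> P \<le> b\<close>; the
  upper bound makes \<open>\<Sum>\<^sub>\<alpha> A\<^sub>\<alpha> A\<^sub>\<alpha>\<^sup>*\<close> bounded, whence \<open>r(A) < 1\<close>. Conversely, any multi-Toeplitz operator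
  \<open>D > 0\<close> on \<open>\<ell>\<^sup>2(words; H)\<close> has a square root \<open>Q\<close>, and the left creation operators satisfy
  \<open>L\<^sub>i\<^sup>* D L\<^sub>j = \<delta>\<^sub>i\<^sub>j D\<close>, so \<open>Q L\<^sub>i Q\<^sup>-\<^sup>1\<close> are isometries with orthogonal ranges. For \<open>D\<close> the kernel of \<open>s A\<close>
  with \<open>s > 1\<close> close to 1 they dilate \<open>s A\<close>, which gives \<open>\<omega>\<^sub>\<rho>(A) < 1\<close>; for \<open>D = P - a/2\<close> and
  \<open>D = b - P\<close> evaluating positive polynomials at them gives the two Harnack inequalities. Finally, if
  \<open>A = t B\<close> with \<open>t < 1\<close> and \<open>B\<close> in the class, a dilation of \<open>B\<close> shows directly that \<open>r(A) < 1\<close> and that \<open>P\<close> is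
  bounded below.\<close>

text \<open>The operator \<open>rho_kernel \<rho> A\<close> is the sum of series whose convergence
  is only known once r(A) < 1. So (i) and (ii) are turned into bounds for quadratic forms over words
  of length at most \<open>N\<close>, uniform in \<open>N\<close>, and the operator enters after the
  spectral radius is under control. Strict positivity takes the place of the usual quotient and
  completion: an invertible root \<open>Q\<close> keeps the isometries on square-summable families
  over the words. This is why \<open>D\<close> is P - a/2 instead of P - a, and why b is taken
  larger than the norm of P. Strictness also leaves room to scale: r(A) < 1 gives the series in s a
  radius beyond 1, so for some s > 1 the kernel of s A is norm-close to P and still bounded below.
  Positive polynomials are tested only on strict row contractions over the space of
  \<open>K\<close>, while these isometries act elsewhere. A polynomial applied to finitely many
  vectors sees only a separable subspace, which fits into any infinite-dimensional space.\<close>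

section \<open>Calculus of complex-linear operators, adjoints and words\<close>

lemma scaleC_scaleR_commute: "c *\<^sub>C (r *\<^sub>R x) = r *\<^sub>R (c *\<^sub>C (x::'a::complex_normed_vector))"
  by (simp add: scaleC_of_real[symmetric] scaleC_scaleC mult.commute)

lemma clinear_opD: "clinear_op T \<Longrightarrow> blinfun_apply T (c *\<^sub>C x) = c *\<^sub>C blinfun_apply T x"
  by (simp add: clinear_op_def)

lemma clinear_op_id [simp]: "clinear_op id_blinfun"
  and clinear_op_zero [simp]: "clinear_op 0"
  and clinear_op_compose: "clinear_op S \<Longrightarrow> clinear_op T \<Longrightarrow> clinear_op (S o\<^sub>L T)"
  by (simp_all add: clinear_op_def)

lemma clinear_op_add: "clinear_op S \<Longrightarrow> clinear_op T \<Longrightarrow> clinear_op (S + T)"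
  and clinear_op_diff: "clinear_op S \<Longrightarrow> clinear_op T \<Longrightarrow> clinear_op (S - T)"
  and clinear_op_scaleR: "clinear_op S \<Longrightarrow> clinear_op (r *\<^sub>R S)"
  by (simp_all add: clinear_op_def blinfun.add_left blinfun.diff_left blinfun.scaleR_left
      scaleC_add_right scaleC_diff_right scaleC_scaleR_commute)

lemma clinear_op_scaleC: "clinear_op S \<Longrightarrow> clinear_op (c *\<^sub>C S)"
  by (simp add: clinear_op_def scaleC_blinfun.rep_eq scaleC_scaleC mult.commute)

lemma clinear_op_sum: "(\<And>i. i \<in> I \<Longrightarrow> clinear_op (f i)) \<Longrightarrow> clinear_op (sum f I)"
  by (induction I rule: infinite_finite_induct) (auto intro: clinear_op_add)

lemma cinner_adj_left: "clinear_op T \<Longrightarrow> cinner (adj T x) y = cinner x (blinfun_apply T y)"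
  using cinner_adj[of T y x] cinner_commute[of "adj T x" y] cinner_commute[of x "T y"] by simp

lemma adj_adj: "clinear_op T \<Longrightarrow> adj (adj T) = T"
  by (rule adj_eqI) (rule cinner_adj_left)

lemma adj_compose: "clinear_op S \<Longrightarrow> clinear_op T \<Longrightarrow> adj (S o\<^sub>L T) = adj T o\<^sub>L adj S"
  by (rule adj_eqI) (simp add: cinner_adj)

lemma adj_id [simp]: "adj id_blinfun = id_blinfun"
  and adj_zero [simp]: "adj 0 = 0"
  by (rule adj_eqI; simp)+

lemma adj_scaleR: "clinear_op T \<Longrightarrow> adj (r *\<^sub>R T) = r *\<^sub>R adj T"
  by (rule adj_eqI) (simp add: blinfun.scaleR_left cinner_scaleR_left cinner_scaleR_right cinner_adj)

text \<open>Polarisation: real parts agree by comparing norms of sums, imaginary parts by replacing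
  \<open>y\<close> with i times \<open>y\<close>.\<close>

lemma isometry_op_cinner:
  assumes "isometry_op V"
  shows "cinner (blinfun_apply V x) (blinfun_apply V y) = cinner x y"
proof -
  have n: "norm (V x) = norm x" for x using assms by (simp add: isometry_op_def)
  have re: "Re (cinner (V x) (V y)) = Re (cinner x y)" for x y
    using norm_add_sq[of "V x" "V y"] norm_add_sq[of x y] n[of "x + y"]
    by (simp add: blinfun.add_right n)
  have "Im (cinner (V x) (V y)) = Im (cinner x y)"
    using re[of x "\<i> *\<^sub>C y"] assms by (simp add: isometry_op_def clinear_opD cinner_scaleC_right)
  then show ?thesis using re by (simp add: complex_eq_iff)
qed

lemma word_op_append: "word_op T (\<alpha> @ \<beta>) = word_op T \<alpha> o\<^sub>L word_op T \<beta>"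
  by (induction \<alpha>) (auto intro!: blinfun_eqI)

lemma word_op_singleton [simp]: "word_op T [i] = T i"
  by (rule blinfun_eqI) simp

lemma clinear_word_op: "(\<And>i. clinear_op (T i)) \<Longrightarrow> clinear_op (word_op T \<alpha>)"
  by (induction \<alpha>) (simp_all add: clinear_op_compose)

lemma word_op_scaleR: "word_op (\<lambda>i. r *\<^sub>R T i) \<alpha> = r ^ length \<alpha> *\<^sub>R word_op T \<alpha>"
  by (induction \<alpha>) (auto intro!: blinfun_eqI simp: blinfun.scaleR_left blinfun.scaleR_right)

lemma word_op_zero: "word_op (\<lambda>_. 0) \<alpha> = (if \<alpha> = [] then id_blinfun else 0)"
  by (cases \<alpha>) simp_all

lemma adj_word_op_append:
  "(\<And>i. clinear_op (T i)) \<Longrightarrow> adj (word_op T (\<alpha> @ \<beta>)) = adj (word_op T \<beta>) o\<^sub>L adj (word_op T \<alpha>)"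
  by (simp add: word_op_append adj_compose clinear_word_op)

lemma finite_words_length [simp]: "finite {\<alpha> :: 'n::finite list. length \<alpha> = k}"
  using finite_lists_length_eq[of "UNIV :: 'n set" k] by simp

lemma sum_words_append:
  "(\<Sum>\<gamma> | length (\<gamma>::'n::finite list) = j + k. f \<gamma>)
     = (\<Sum>\<alpha> | length \<alpha> = j. \<Sum>\<beta> | length \<beta> = k. f (\<alpha> @ \<beta>))"
  unfolding sum.cartesian_product
  by (rule sum.reindex_bij_witness[of _ "\<lambda>(\<alpha>, \<beta>). \<alpha> @ \<beta>" "\<lambda>\<gamma>. (take j \<gamma>, drop j \<gamma>)"]) auto

lemma sum_words_Suc_0: "(\<Sum>\<gamma> | length (\<gamma>::'n::finite list) = Suc 0. f \<gamma>) = (\<Sum>i\<in>UNIV. f [i])"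
  by (rule sum.reindex_bij_witness[of _ "\<lambda>i. [i]" hd]) (auto simp: length_Suc_conv)

text \<open>For \<open>z = \<Sum>\<^sub>i V\<^sub>i V\<^sub>i\<^sup>* x\<close> the sum \<open>S\<close> on the left satisfies \<open>\<parallel>z\<parallel>\<^sup>2 \<le> S = \<langle>z, x\<rangle>\<close>.\<close>

lemma sum_norm_adj_orthogonal:
  fixes V :: "'n::finite \<Rightarrow> ('g::chilbert_space \<Rightarrow>\<^sub>L 'h::chilbert_space)"
  assumes V: "\<And>i. clinear_op (V i)" "\<And>i x. norm (V i x) \<le> norm x"
    and orth: "\<And>i j x y. i \<noteq> j \<Longrightarrow> cinner (V i x) (V j y) = 0"
  shows "(\<Sum>i\<in>UNIV. (norm (adj (V i) x))\<^sup>2) \<le> (norm x)\<^sup>2"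
proof -
  define S where "S = (\<Sum>i\<in>UNIV. (norm (adj (V i) x))\<^sup>2)"
  define z where "z = (\<Sum>i\<in>UNIV. V i (adj (V i) x))"
  have zx: "cinner z x = of_real S"
    unfolding z_def S_def by (simp add: cinner_sum_left cinner_adj V(1) cinner_self)
  have "complex_of_real ((norm z)\<^sup>2) = (\<Sum>i\<in>UNIV. \<Sum>j\<in>UNIV. if i = j then cinner (V i (adj (V i) x)) (V i (adj (V i) x)) else 0)"
    unfolding cinner_self[symmetric] z_def cinner_sum_left cinner_sum_right
    by (intro sum.cong refl) (auto simp: orth)
  also have "\<dots> = of_real (\<Sum>i\<in>UNIV. (norm (V i (adj (V i) x)))\<^sup>2)"
    by (simp add: cinner_self)
  finally have "(norm z)\<^sup>2 = (\<Sum>i\<in>UNIV. (norm (V i (adj (V i) x)))\<^sup>2)" by (simp only: of_real_eq_iff)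
  also have "\<dots> \<le> S" unfolding S_def by (intro sum_mono power_mono V) simp
  finally have zS: "(norm z)\<^sup>2 \<le> S" .
  have S0: "0 \<le> S" by (simp add: S_def sum_nonneg)
  have "S \<le> norm z * norm x" using cauchy_schwarz[of z x] S0 by (simp add: zx)
  then have "S\<^sup>2 \<le> (norm z)\<^sup>2 * (norm x)\<^sup>2" using S0 by (metis power_mono power_mult_distrib)
  also have "\<dots> \<le> S * (norm x)\<^sup>2" using zS by (intro mult_right_mono) auto
  finally have "S * S \<le> S * (norm x)\<^sup>2" by (simp add: power2_eq_square)
  then show ?thesis using S0 unfolding S_def[symmetric] by (cases "S = 0") auto
qed

section \<open>Row norms and the spectral radius\<close>

text \<open>The quadratic form of the row operator of level \<open>k\<close>. By
  \<open>lev_le_row_norm\<close> and \<open>row_norm_le\<close> its norm is the least c \<ge> 0 with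
  \<open>lev T k x\<close> at most c times the squared norm of \<open>x\<close>, so all estimates
  can be made on vectors.\<close>

definition lev :: "('n::finite \<Rightarrow> ('h::chilbert_space \<Rightarrow>\<^sub>L 'h)) \<Rightarrow> nat \<Rightarrow> 'h \<Rightarrow> real" where
  "lev T k x = (\<Sum>\<alpha> | length \<alpha> = k. (norm (adj (word_op T \<alpha>) x))\<^sup>2)"

lemma lev_0 [simp]: "lev T 0 x = (norm x)\<^sup>2"
  by (simp add: lev_def)

lemma lev_nonneg: "0 \<le> lev T k x" by (simp add: lev_def sum_nonneg)

text \<open>Adjoints reverse products: the adjoint of the prefix of length \<open>j\<close> acts
  first, and the remaining \<open>k\<close> letters see its result.\<close>

lemma lev_add:
  assumes "\<And>i. clinear_op (T i)"
  shows "lev T (j + k) x = (\<Sum>\<alpha> | length \<alpha> = j. lev T k (adj (word_op T \<alpha>) x))"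
  by (simp add: lev_def sum_words_append adj_word_op_append assms)

lemma lev_scaleR:
  assumes "\<And>i. clinear_op (T i)"
  shows "lev (\<lambda>i. r *\<^sub>R T i) k x = r ^ (2 * k) * lev T k x"
  unfolding lev_def sum_distrib_left
  by (intro sum.cong refl)
    (simp add: word_op_scaleR adj_scaleR clinear_word_op assms blinfun.scaleR_left power_mult_distrib power_mult power2_eq_square abs_mult)

text \<open>Peeling off the last letter: \<open>sum_norm_adj_orthogonal\<close>, applied to every
  \<open>adj (word_op V \<alpha>) x\<close>, shows that the levels decrease.\<close>

lemma lev_isometries_le:
  assumes V: "\<And>i. isometry_op (V i)" and orth: "\<And>i j x y. i \<noteq> j \<Longrightarrow> cinner (V i x) (V j y) = 0"
  shows "lev V k x \<le> (norm x)\<^sup>2"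
proof (induction k arbitrary: x)
  case (Suc k)
  have cl: "clinear_op (V i)" for i using V by (simp add: isometry_op_def)
  have "lev V (k + Suc 0) x = (\<Sum>\<alpha> | length \<alpha> = k. lev V (Suc 0) (adj (word_op V \<alpha>) x))"
    by (rule lev_add[OF cl])
  also have "\<dots> \<le> lev V k x"
    unfolding lev_def[of V k] lev_def[of V "Suc 0"] sum_words_Suc_0
    using sum_norm_adj_orthogonal[of V, OF cl _ orth] V
    by (intro sum_mono) (simp add: isometry_op_def del: word_op.simps)
  finally show ?case using Suc[of x] by simp
qed simp

text \<open>Compression of the bound for the dilating isometries. The level is \<open>Suc k\<close>
  because the dilation formula excludes the empty word; at level 0 the factor is 1 instead of the
  square of \<rho>.\<close>

lemma lev_C_class:
  assumes "T \<in> C_class \<rho>"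
  shows "lev T (Suc k) x \<le> \<rho>\<^sup>2 * (norm x)\<^sup>2"
proof -
  obtain J :: "'b \<Rightarrow>\<^sub>L (nat, 'b) ell2" and V where J: "isometry_op J" and V: "\<And>i. isometry_op (V i)"
    and orth: "\<And>i j x y. i \<noteq> j \<Longrightarrow> cinner (V i x) (V j y) = 0"
    and TV: "\<And>\<alpha>. \<alpha> \<noteq> [] \<Longrightarrow> word_op T \<alpha> = \<rho> *\<^sub>R (adj J o\<^sub>L word_op V \<alpha> o\<^sub>L J)"
    using assms unfolding C_class_def rho_dilation_def by blast
  have cl: "clinear_op J" "clinear_op (V i)" for i using J V by (simp_all add: isometry_op_def)
  \<comment> \<open>A family with the single index of type \<open>unit\<close>, for which
    orthogonality of ranges is vacuous.\<close>
  have le: "norm (adj J y) \<le> norm y" for y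
    using sum_norm_adj_orthogonal[of "\<lambda>_::unit. J" y] J by (simp add: isometry_op_def)
  have "lev T (Suc k) x \<le> (\<Sum>\<alpha> | length \<alpha> = Suc k. \<rho>\<^sup>2 * (norm (adj (word_op V \<alpha>) (J x)))\<^sup>2)"
    unfolding lev_def
  proof (rule sum_mono)
    fix \<alpha> :: "'a list" assume "\<alpha> \<in> {\<alpha>. length \<alpha> = Suc k}"
    then have "\<alpha> \<noteq> []" by auto
    then have "adj (word_op T \<alpha>) x = \<rho> *\<^sub>R adj J (adj (word_op V \<alpha>) (J x))"
      by (simp add: TV adj_scaleR adj_compose adj_adj clinear_op_compose clinear_adj cl clinear_word_op blinfun.scaleR_left)
    then have "(norm (adj (word_op T \<alpha>) x))\<^sup>2 = \<rho>\<^sup>2 * (norm (adj J (adj (word_op V \<alpha>) (J x))))\<^sup>2"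
      by (simp add: power_mult_distrib)
    also have "\<dots> \<le> \<rho>\<^sup>2 * (norm (adj (word_op V \<alpha>) (J x)))\<^sup>2"
      by (intro mult_left_mono power_mono le) auto
    finally show "(norm (adj (word_op T \<alpha>) x))\<^sup>2 \<le> \<dots>" .
  qed
  also have "\<dots> = \<rho>\<^sup>2 * lev V (Suc k) (J x)" by (simp add: lev_def sum_distrib_left)
  also have "\<dots> \<le> \<rho>\<^sup>2 * (norm (J x))\<^sup>2" by (intro mult_left_mono lev_isometries_le V orth) auto
  finally show ?thesis using J by (simp add: isometry_op_def)
qed

definition row_norm :: "('n::finite \<Rightarrow> ('h::chilbert_space \<Rightarrow>\<^sub>L 'h)) \<Rightarrow> nat \<Rightarrow> real" where
  "row_norm T k = norm (\<Sum>\<alpha> | length \<alpha> = k. word_op T \<alpha> o\<^sub>L adj (word_op T \<alpha>))"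

lemma row_norm_nonneg: "0 \<le> row_norm T k"
  by (simp add: row_norm_def)

lemma row_sum_cinner:
  assumes "\<And>i. clinear_op (T i)"
  shows "cinner ((\<Sum>\<alpha>\<in>S. word_op T \<alpha> o\<^sub>L adj (word_op T \<alpha>)) x) y
      = (\<Sum>\<alpha>\<in>S. cinner (adj (word_op T \<alpha>) x) (adj (word_op T \<alpha>) y))"
  by (simp add: blinfun.sum_left cinner_sum_left cinner_adj clinear_word_op assms)

lemma lev_le_row_norm:
  assumes "\<And>i. clinear_op (T i)"
  shows "lev T k x \<le> row_norm T k * (norm x)\<^sup>2"
proof -
  let ?E = "\<Sum>\<alpha> | length \<alpha> = k. word_op T \<alpha> o\<^sub>L adj (word_op T \<alpha>)"
  have "complex_of_real (lev T k x) = cinner (?E x) x"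
    by (simp add: row_sum_cinner assms lev_def cinner_self)
  then have "lev T k x = cmod (cinner (?E x) x)"
    using lev_nonneg[of T k x] by (metis abs_of_nonneg norm_of_real)
  also have "\<dots> \<le> norm (?E x) * norm x" by (rule cauchy_schwarz)
  also have "\<dots> \<le> (norm ?E * norm x) * norm x" by (intro mult_right_mono norm_blinfun) simp
  finally show ?thesis by (simp add: row_norm_def power2_eq_square mult_ac)
qed

text \<open>The row operator E is positive, so its form controls its norm: the square of the norm of
  E x is the sum of the inner products of \<open>adj (word_op T \<alpha>) x\<close> with
  \<open>adj (word_op T \<alpha>) (E x)\<close>, and Cauchy-Schwarz over the words bounds it by the
  levels of x and of E x.\<close>

lemma row_norm_le:
  assumes T: "\<And>i. clinear_op (T i)" and c: "\<And>x. lev T k x \<le> c * (norm x)\<^sup>2" and c0: "c \<ge> 0"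
  shows "row_norm T k \<le> c"
  unfolding row_norm_def
proof (rule norm_blinfun_bound[OF c0])
  fix x
  let ?S = "{\<alpha>::'a list. length \<alpha> = k}"
  let ?E = "\<Sum>\<alpha>\<in>?S. word_op T \<alpha> o\<^sub>L adj (word_op T \<alpha>)"
  let ?n = "\<lambda>y \<alpha>. norm (adj (word_op T \<alpha>) y)"
  have L: "L2_set (?n y) ?S \<le> sqrt c * norm y" for y
  proof -
    have "sqrt (lev T k y) \<le> sqrt (c * (norm y)\<^sup>2)" using c by (rule real_sqrt_le_mono)
    then show ?thesis by (simp add: L2_set_def lev_def real_sqrt_mult)
  qed
  have "(norm (?E x))\<^sup>2 = cmod (cinner (?E x) (?E x))" by (simp only: cinner_self) (simp add: norm_power)
  also have "\<dots> \<le> (\<Sum>\<alpha>\<in>?S. \<bar>?n x \<alpha>\<bar> * \<bar>?n (?E x) \<alpha>\<bar>)"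
    unfolding row_sum_cinner[OF T] by (rule sum_norm_le) (simp add: cauchy_schwarz)
  also have "\<dots> \<le> L2_set (?n x) ?S * L2_set (?n (?E x)) ?S" by (rule L2_set_mult_ineq)
  also have "\<dots> \<le> (sqrt c * norm x) * (sqrt c * norm (?E x))"
    by (intro mult_mono L) (auto simp: c0)
  also have "\<dots> = (c * norm x) * norm (?E x)" using c0 by (simp add: mult_ac flip: real_sqrt_mult)
  finally show "norm (?E x) \<le> c * norm x" by (cases "?E x = 0") (auto simp: power2_eq_square c0)
qed

lemma row_norm_submultiplicative:
  assumes T: "\<And>i. clinear_op (T i)"
  shows "row_norm T (j + k) \<le> row_norm T j * row_norm T k"
proof (rule row_norm_le[OF T])
  fix x
  have "lev T (j + k) x \<le> (\<Sum>\<alpha> | length \<alpha> = j. row_norm T k * (norm (adj (word_op T \<alpha>) x))\<^sup>2)"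
    unfolding lev_add[OF T] by (intro sum_mono lev_le_row_norm T)
  also have "\<dots> = row_norm T k * lev T j x" by (simp add: lev_def sum_distrib_left)
  also have "\<dots> \<le> row_norm T k * (row_norm T j * (norm x)\<^sup>2)"
    by (intro mult_left_mono lev_le_row_norm T) (simp add: row_norm_def)
  finally show "lev T (j + k) x \<le> row_norm T j * row_norm T k * (norm x)\<^sup>2" by (simp add: mult_ac)
qed (simp add: row_norm_def)

section \<open>Fekete's lemma and the joint spectral radius\<close>

text \<open>Fekete's lemma in multiplicative form, argued without logarithms since \<open>a\<close>
  may vanish. The limit is the infimum over k \<ge> 1, so a single level can bound it.\<close>

lemma submultiplicative_root_tendsto:
  fixes a :: "nat \<Rightarrow> real"
  assumes a0: "\<And>n. a n \<ge> 0" and sub: "\<And>j k. a (j + k) \<le> a j * a k"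
  defines "f \<equiv> \<lambda>k. a k powr (1 / (2 * real k))"
  shows "\<exists>L. f \<longlonglongrightarrow> L \<and> (\<forall>k\<ge>1. L \<le> f k)"
proof -
  define L where "L = (INF k\<in>{1..}. f k)"
  have bdd: "bdd_below (f ` {1..})" by (rule bdd_belowI[of _ 0]) (auto simp: f_def)
  have Lf: "L \<le> f k" if "k \<ge> 1" for k
    unfolding L_def using that by (intro cINF_lower bdd) auto
  have L0: "L \<ge> 0" unfolding L_def by (rule cINF_greatest) (auto simp: f_def)
  have up: "\<forall>\<^sub>F n in sequentially. f n < c" if c: "c > L" for c
  proof -
    obtain d where d: "L < d" "d < c" using c dense by blast
    have "\<exists>m\<in>{1..}. f m < d" using d(1) unfolding L_def by (subst (asm) cINF_less_iff[OF _ bdd]) auto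
    then obtain m where m: "m \<ge> 1" "f m < d" by auto
    have d0: "d > 0" using d L0 by simp
    have am: "a m \<le> d ^ (2 * m)"
    proof -
      have "a m = f m powr (2 * real m)" using m(1) a0[of m] by (simp add: f_def powr_powr)
      also have "\<dots> \<le> d powr (2 * real m)" using m by (intro powr_mono2) (auto simp: f_def)
      also have "\<dots> = d ^ (2 * m)" using d0 by (simp flip: powr_realpow)
      finally show ?thesis .
    qed
    \<comment> \<open>The sum absorbs the values below \<open>m\<close>, where the recursion in
      steps of \<open>m\<close> ends. The added 1 makes \<open>C\<close> positive, so that its roots
      tend to 1.\<close>
    define C where "C = (\<Sum>k<m. a k / d ^ (2 * k)) + 1"
    have C: "C > 0" unfolding C_def using a0 d0 by (intro add_nonneg_pos sum_nonneg) auto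
    have aC: "a n \<le> C * d ^ (2 * n)" for n
    proof (induction n rule: less_induct)
      case (less n)
      show ?case
      proof (cases "n < m")
        case True
        then have "a n / d ^ (2 * n) \<le> (\<Sum>k<m. a k / d ^ (2 * k))"
          using a0 d0 by (intro member_le_sum) auto
        then have "a n / d ^ (2 * n) \<le> C" by (simp add: C_def)
        then show ?thesis using d0 by (simp add: field_simps)
      next
        case False
        have "a n \<le> a m * a (n - m)" using sub[of m "n - m"] False by simp
        also have "\<dots> \<le> d ^ (2 * m) * (C * d ^ (2 * (n - m)))"
          using less[of "n - m"] m False a0 d0 by (intro mult_mono am) auto
        also have "\<dots> = C * d ^ (2 * m + 2 * (n - m))" by (simp add: power_add)
        also have "2 * m + 2 * (n - m) = 2 * n" using False by simp
        finally show ?thesis .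
      qed
    qed
    have fn: "f n \<le> C powr (1 / (2 * real n)) * d" if "n \<ge> 1" for n
    proof -
      have "f n \<le> (C * d ^ (2 * n)) powr (1 / (2 * real n))"
        unfolding f_def by (intro powr_mono2 aC a0) simp
      also have "\<dots> = C powr (1 / (2 * real n)) * (d ^ (2 * n)) powr (1 / (2 * real n))"
        using C d0 by (simp add: powr_mult)
      also have "(d ^ (2 * n)) powr (1 / (2 * real n)) = d"
        using d0 that by (simp add: powr_powr flip: powr_realpow)
      finally show ?thesis .
    qed
    have "(\<lambda>n. 1 / (2 * real n)) \<longlonglongrightarrow> 0"
      using tendsto_mult_right_zero[OF lim_1_over_n[where 'a=real], of "1/2"] by simp
    then have "(\<lambda>n. C powr (1 / (2 * real n)) * d) \<longlonglongrightarrow> C powr 0 * d"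
      using C by (intro tendsto_intros) auto
    then have "\<forall>\<^sub>F n in sequentially. C powr (1 / (2 * real n)) * d < c"
      using d C by (intro order_tendstoD) auto
    then show ?thesis using eventually_ge_at_top[of 1]
      by eventually_elim (use fn in force)
  qed
  have "f \<longlonglongrightarrow> L"
  proof (rule order_tendstoI)
    fix c assume "c < L"
    show "\<forall>\<^sub>F n in sequentially. c < f n"
      using eventually_ge_at_top[of 1] by eventually_elim (use Lf \<open>c < L\<close> in force)
  qed (rule up)
  then show ?thesis using Lf by auto
qed

text \<open>Shows that the \<open>lim\<close> in the definition is a genuine limit, and that one
  level with norm below 1 forces r(T) < 1.\<close>

lemma joint_spectral_radius:
  fixes T :: "'n::finite \<Rightarrow> ('h::chilbert_space \<Rightarrow>\<^sub>L 'h)"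
  assumes "\<And>i. clinear_op (T i)"
  shows "(\<lambda>k. row_norm T k powr (1 / (2 * real k))) \<longlonglongrightarrow> joint_spectral_radius T"
    and "k \<ge> 1 \<Longrightarrow> joint_spectral_radius T \<le> row_norm T k powr (1 / (2 * real k))"
proof -
  obtain L where L: "(\<lambda>k. row_norm T k powr (1 / (2 * real k))) \<longlonglongrightarrow> L"
      "\<forall>k\<ge>1. L \<le> row_norm T k powr (1 / (2 * real k))"
    using submultiplicative_root_tendsto[of "row_norm T"] row_norm_submultiplicative[of T, OF assms]
    by (auto simp: row_norm_def)
  have "joint_spectral_radius T = L"
    unfolding joint_spectral_radius_def row_norm_def[symmetric] by (rule limI[OF L(1)])
  then show "(\<lambda>k. row_norm T k powr (1 / (2 * real k))) \<longlonglongrightarrow> joint_spectral_radius T"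
    "k \<ge> 1 \<Longrightarrow> joint_spectral_radius T \<le> row_norm T k powr (1 / (2 * real k))" using L by auto
qed

lemma joint_spectral_radius_less_1I:
  fixes T :: "'n::finite \<Rightarrow> ('h::chilbert_space \<Rightarrow>\<^sub>L 'h)"
  assumes T: "\<And>i. clinear_op (T i)" and k: "k \<ge> 1" and c: "0 \<le> c" "c < 1"
    and lev: "\<And>x. lev T k x \<le> c * (norm x)\<^sup>2"
  shows "joint_spectral_radius T < 1"
proof -
  have "row_norm T k \<le> c" by (rule row_norm_le[OF T lev c(1)])
  then have "row_norm T k < 1" using c by simp
  then have "row_norm T k powr (1 / (2 * real k)) < 1 powr (1 / (2 * real k))"
    using k by (intro powr_less_mono2) (auto simp: row_norm_def)
  then show ?thesis using joint_spectral_radius(2)[of T k, OF T k] by simp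
qed

lemma joint_spectral_radius_less_1D:
  fixes T :: "'n::finite \<Rightarrow> ('h::chilbert_space \<Rightarrow>\<^sub>L 'h)"
  assumes T: "\<And>i. clinear_op (T i)" and r: "joint_spectral_radius T < 1"
  shows "\<exists>q<1. 0 < q \<and> (\<forall>\<^sub>F k in sequentially. sqrt (row_norm T k) \<le> q ^ k)"
proof -
  obtain q where q: "max 0 (joint_spectral_radius T) < q" "q < 1"
    using dense[of "max 0 (joint_spectral_radius T)" 1] r by auto
  have "\<forall>\<^sub>F k in sequentially. row_norm T k powr (1 / (2 * real k)) < q"
    using joint_spectral_radius(1)[of T, OF T] q by (intro order_tendstoD) auto
  then have "\<forall>\<^sub>F k in sequentially. sqrt (row_norm T k) \<le> q ^ k"
    using eventually_ge_at_top[of 1]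
  proof eventually_elim
    case (elim k)
    have "sqrt (row_norm T k) = (row_norm T k powr (1 / (2 * real k))) powr (real k)"
      using elim by (simp add: powr_powr powr_half_sqrt row_norm_def)
    also have "\<dots> \<le> q powr (real k)" using elim by (intro powr_mono2) auto
    finally show ?case using q by (simp add: powr_realpow)
  qed
  then show ?thesis using q by auto
qed

section \<open>Multi-Toeplitz kernels and Harnack domination\<close>

text \<open>The recursion strips the common prefix, so the multi-Toeplitz identity is the last
  equation and positivity can be proved by induction on the length of words.\<close>

fun toeplitz_kernel :: "real \<Rightarrow> ('n \<Rightarrow> ('h::chilbert_space \<Rightarrow>\<^sub>L 'h)) \<Rightarrow> 'n list \<Rightarrow> 'n list \<Rightarrow> ('h \<Rightarrow>\<^sub>L 'h)" where
  "toeplitz_kernel \<rho> T [] [] = \<rho> *\<^sub>R id_blinfun"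
| "toeplitz_kernel \<rho> T [] (j # \<beta>) = word_op T (j # \<beta>)"
| "toeplitz_kernel \<rho> T (i # \<alpha>) [] = adj (word_op T (i # \<alpha>))"
| "toeplitz_kernel \<rho> T (i # \<alpha>) (j # \<beta>) = (if i = j then toeplitz_kernel \<rho> T \<alpha> \<beta> else 0)"

lemma toeplitz_kernel_append:
  "toeplitz_kernel \<rho> T \<alpha> (\<alpha> @ \<gamma>) = (if \<gamma> = [] then \<rho> *\<^sub>R id_blinfun else word_op T \<gamma>)"
  by (induction \<alpha>) (cases \<gamma>; simp)+

lemma toeplitz_kernel_append_left:
  "toeplitz_kernel \<rho> T (\<alpha> @ \<gamma>) \<alpha> = (if \<gamma> = [] then \<rho> *\<^sub>R id_blinfun else adj (word_op T \<gamma>))"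
  by (induction \<alpha>) (cases \<gamma>; simp)+

lemma toeplitz_kernel_eq_0:
  "\<nexists>\<gamma>. \<beta> = \<alpha> @ \<gamma> \<Longrightarrow> \<nexists>\<gamma>. \<alpha> = \<beta> @ \<gamma> \<Longrightarrow> toeplitz_kernel \<rho> T \<alpha> \<beta> = 0"
  by (induction \<rho> T \<alpha> \<beta> rule: toeplitz_kernel.induct) auto

text \<open>The parameter \<rho> only affects the diagonal, exactly as the term (\<rho> - 1) Re p(0)
  does in Harnack domination.\<close>

lemma toeplitz_kernel_shift:
  "toeplitz_kernel \<rho> T \<alpha> \<beta> = toeplitz_kernel 1 T \<alpha> \<beta> + (\<rho> - 1) *\<^sub>R (if \<alpha> = \<beta> then id_blinfun else 0)"
  by (induction \<rho> T \<alpha> \<beta> rule: toeplitz_kernel.induct) (auto simp: algebra_simps)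

lemma toeplitz_kernel_zero: "toeplitz_kernel \<rho> (\<lambda>_. 0) \<alpha> \<beta> = (if \<alpha> = \<beta> then \<rho> *\<^sub>R id_blinfun else 0)"
  by (induction \<alpha> \<beta> rule: list_induct2') auto

definition words_upto :: "nat \<Rightarrow> 'n list set" where
  "words_upto N = {\<alpha>. length \<alpha> \<le> N}"

lemma finite_words_upto [simp]: "finite (words_upto N :: 'n::finite list set)"
  using finite_lists_length_le[of "UNIV :: 'n set" N] by (simp add: words_upto_def)

lemma sum_words_upto_levels:
  "(\<Sum>\<alpha>\<in>words_upto N. f \<alpha>) = (\<Sum>k\<le>N. \<Sum>\<alpha> | length (\<alpha>::'n::finite list) = k. f \<alpha>)"
proof -
  have "words_upto N = (\<Union>k\<le>N. {\<alpha>::'n list. length \<alpha> = k})" by (auto simp: words_upto_def)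
  then show ?thesis by (simp only:) (subst sum.UNION_disjoint, auto)
qed

lemma sum_words_upto_Suc:
  "(\<Sum>\<alpha>\<in>words_upto (Suc N). f \<alpha>) = f [] + (\<Sum>i\<in>UNIV. \<Sum>\<alpha>\<in>words_upto N. f ((i::'n::finite) # \<alpha>))"
proof -
  have "(\<Sum>\<alpha>\<in>words_upto (Suc N) - {[]}. f \<alpha>) = (\<Sum>(i, \<alpha>)\<in>UNIV \<times> words_upto N. f (i # \<alpha>))"
    by (rule sum.reindex_bij_witness[of _ "\<lambda>(i, \<alpha>). i # \<alpha>" "\<lambda>\<alpha>. (hd \<alpha>, tl \<alpha>)"])
       (auto simp: words_upto_def neq_Nil_conv)
  moreover have "[] \<in> (words_upto (Suc N) :: 'n list set)" by (simp add: words_upto_def)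
  ultimately show ?thesis by (subst sum.remove[of _ "[]"]) (auto simp: sum.cartesian_product)
qed

text \<open>A finite section of the kernel: no convergence is involved, so it is available before
  r(T) < 1 is known.\<close>

definition toeplitz_form ::
  "real \<Rightarrow> ('n::finite \<Rightarrow> ('h::chilbert_space \<Rightarrow>\<^sub>L 'h)) \<Rightarrow> nat \<Rightarrow> ('n list \<Rightarrow> 'h) \<Rightarrow> complex" where
  "toeplitz_form \<rho> T N h = (\<Sum>\<alpha>\<in>words_upto N. \<Sum>\<beta>\<in>words_upto N. cinner (toeplitz_kernel \<rho> T \<alpha> \<beta> (h \<beta>)) (h \<alpha>))"

lemma toeplitz_form_zero:
  "toeplitz_form \<rho> (\<lambda>_. 0) N h = of_real (\<rho> * (\<Sum>\<alpha>\<in>words_upto N. (norm (h \<alpha>))\<^sup>2))"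
  unfolding toeplitz_form_def sum_distrib_left of_real_sum
proof (intro sum.cong refl)
  fix \<alpha> :: "'a list" assume "\<alpha> \<in> words_upto N"
  have "(\<Sum>\<beta>\<in>words_upto N. cinner (toeplitz_kernel \<rho> (\<lambda>_. 0) \<alpha> \<beta> (h \<beta>)) (h \<alpha>))
     = (\<Sum>\<beta>\<in>words_upto N. if \<alpha> = \<beta> then cinner (\<rho> *\<^sub>R h \<alpha>) (h \<alpha>) else 0)"
    by (intro sum.cong refl) (auto simp: toeplitz_kernel_zero blinfun.scaleR_left)
  then show "(\<Sum>\<beta>\<in>words_upto N. cinner (toeplitz_kernel \<rho> (\<lambda>_. 0) \<alpha> \<beta> (h \<beta>)) (h \<alpha>)) = of_real (\<rho> * (norm (h \<alpha>))\<^sup>2)"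
    using \<open>\<alpha> \<in> words_upto N\<close> by (simp add: cinner_scaleR_left cinner_self)
qed

text \<open>The row and column of the empty word contribute conjugate cross terms. Entries between
  words with different first letters vanish, and removing a common first letter leaves one copy of
  the kernel for each letter.\<close>

lemma toeplitz_form_Suc:
  assumes T: "\<And>i. clinear_op (T i)"
  shows "toeplitz_form \<rho> T (Suc N) h = of_real (\<rho> * (norm (h []))\<^sup>2)
     + 2 * of_real (Re (cinner (\<Sum>i\<in>UNIV. \<Sum>\<alpha>\<in>words_upto N. word_op T (i # \<alpha>) (h (i # \<alpha>))) (h [])))
     + (\<Sum>i\<in>UNIV. toeplitz_form \<rho> T N (\<lambda>\<alpha>. h (i # \<alpha>)))"
proof -
  define Z where "Z = (\<Sum>i\<in>UNIV. \<Sum>\<alpha>\<in>words_upto N. word_op T (i # \<alpha>) (h (i # \<alpha>)))"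
  have 1: "(\<Sum>j\<in>UNIV. \<Sum>\<beta>\<in>words_upto N. cinner (word_op T (j # \<beta>) (h (j # \<beta>))) (h [])) = cinner Z (h [])"
    by (simp add: Z_def cinner_sum_left)
  have 2: "(\<Sum>i\<in>UNIV. \<Sum>\<alpha>\<in>words_upto N. cinner (adj (word_op T (i # \<alpha>)) (h [])) (h (i # \<alpha>))) = cinner (h []) Z"
    by (simp add: Z_def cinner_sum_right cinner_adj_left clinear_word_op T del: word_op.simps)
  have 3: "(\<Sum>i\<in>UNIV. \<Sum>\<alpha>\<in>words_upto N. \<Sum>j\<in>UNIV. \<Sum>\<beta>\<in>words_upto N.
        cinner (toeplitz_kernel \<rho> T (i # \<alpha>) (j # \<beta>) (h (j # \<beta>))) (h (i # \<alpha>)))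
      = (\<Sum>i\<in>UNIV. toeplitz_form \<rho> T N (\<lambda>\<alpha>. h (i # \<alpha>)))"
    unfolding toeplitz_form_def
  proof (intro sum.cong refl)
    fix i \<alpha>
    have "(\<Sum>j\<in>UNIV. \<Sum>\<beta>\<in>words_upto N. cinner (toeplitz_kernel \<rho> T (i # \<alpha>) (j # \<beta>) (h (j # \<beta>))) (h (i # \<alpha>)))
       = (\<Sum>j\<in>UNIV. if i = j then \<Sum>\<beta>\<in>words_upto N. cinner (toeplitz_kernel \<rho> T \<alpha> \<beta> (h (i # \<beta>))) (h (i # \<alpha>)) else 0)"
      by (intro sum.cong refl) auto
    then show "(\<Sum>j\<in>UNIV. \<Sum>\<beta>\<in>words_upto N. cinner (toeplitz_kernel \<rho> T (i # \<alpha>) (j # \<beta>) (h (j # \<beta>))) (h (i # \<alpha>)))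
       = (\<Sum>\<beta>\<in>words_upto N. cinner (toeplitz_kernel \<rho> T \<alpha> \<beta> (h (i # \<beta>))) (h (i # \<alpha>)))" by simp
  qed
  have "toeplitz_form \<rho> T (Suc N) h = cinner (\<rho> *\<^sub>R h []) (h [])
      + (\<Sum>j\<in>UNIV. \<Sum>\<beta>\<in>words_upto N. cinner (word_op T (j # \<beta>) (h (j # \<beta>))) (h []))
      + ((\<Sum>i\<in>UNIV. \<Sum>\<alpha>\<in>words_upto N. cinner (adj (word_op T (i # \<alpha>)) (h [])) (h (i # \<alpha>)))
      + (\<Sum>i\<in>UNIV. \<Sum>\<alpha>\<in>words_upto N. \<Sum>j\<in>UNIV. \<Sum>\<beta>\<in>words_upto N.
        cinner (toeplitz_kernel \<rho> T (i # \<alpha>) (j # \<beta>) (h (j # \<beta>))) (h (i # \<alpha>))))"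
    unfolding toeplitz_form_def sum_words_upto_Suc
    by (simp add: sum.distrib blinfun.scaleR_left del: word_op.simps toeplitz_kernel.simps(4))
  also have "\<dots> = of_real (\<rho> * (norm (h []))\<^sup>2) + (cinner Z (h []) + cnj (cinner Z (h [])))
      + (\<Sum>i\<in>UNIV. toeplitz_form \<rho> T N (\<lambda>\<alpha>. h (i # \<alpha>)))"
    unfolding 1 2 3 using cinner_commute[of "h []" Z] by (simp add: cinner_scaleR_left cinner_self)
  finally show ?thesis unfolding Z_def complex_add_cnj by simp
qed

text \<open>The hypothesis bounds the column of adjoints. Pairing Z, the sum of the
  \<open>X i (v i)\<close>, with itself moves the \<open>X i\<close> onto Z, and the
  arithmetic-geometric mean inequality leaves half of the squared norm of Z to be absorbed.\<close>

lemma norm_row_contraction_le: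
  fixes X :: "'n::finite \<Rightarrow> ('h::chilbert_space \<Rightarrow>\<^sub>L 'h)"
  assumes X: "\<And>i. clinear_op (X i)" and n: "norm (\<Sum>i\<in>UNIV. X i o\<^sub>L adj (X i)) \<le> 1"
  shows "(norm (\<Sum>i\<in>UNIV. X i (v i)))\<^sup>2 \<le> (\<Sum>i\<in>UNIV. (norm (v i))\<^sup>2)"
proof -
  define Z where "Z = (\<Sum>i\<in>UNIV. X i (v i))"
  have rn: "row_norm X (Suc 0) \<le> 1" using n unfolding row_norm_def sum_words_Suc_0
    by (simp del: word_op.simps)
  have lev: "(\<Sum>i\<in>UNIV. (norm (adj (X i) Z))\<^sup>2) \<le> (norm Z)\<^sup>2"
    using lev_le_row_norm[of X "Suc 0" Z, OF X] mult_right_mono[OF rn, of "(norm Z)\<^sup>2"]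
    unfolding lev_def sum_words_Suc_0 by (simp del: word_op.simps)
  have "(norm Z)\<^sup>2 = cmod (cinner Z Z)" by (simp only: cinner_self) (simp add: norm_power)
  also have "cinner Z Z = (\<Sum>i\<in>UNIV. cinner (v i) (adj (X i) Z))"
    by (subst Z_def) (simp add: cinner_sum_left cinner_adj X)
  also have "cmod \<dots> \<le> (\<Sum>i\<in>UNIV. ((norm (v i))\<^sup>2 + (norm (adj (X i) Z))\<^sup>2) / 2)"
  proof (rule sum_norm_le)
    fix i
    have "cmod (cinner (v i) (adj (X i) Z)) \<le> norm (v i) * norm (adj (X i) Z)" by (rule cauchy_schwarz)
    also have "\<dots> \<le> ((norm (v i))\<^sup>2 + (norm (adj (X i) Z))\<^sup>2) / 2"
      using zero_le_power2[of "norm (v i) - norm (adj (X i) Z)"] unfolding power2_diff by simp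
    finally show "cmod (cinner (v i) (adj (X i) Z)) \<le> \<dots>" .
  qed
  also have "\<dots> = ((\<Sum>i\<in>UNIV. (norm (v i))\<^sup>2) + (\<Sum>i\<in>UNIV. (norm (adj (X i) Z))\<^sup>2)) / 2"
    by (simp add: sum.distrib flip: sum_divide_distrib)
  finally show ?thesis using lev unfolding Z_def[symmetric] by simp
qed

text \<open>The lower bound makes the positivity of the kernel of a row contraction inductive.\<close>

lemma toeplitz_form_row_contraction:
  fixes X :: "'n::finite \<Rightarrow> ('h::chilbert_space \<Rightarrow>\<^sub>L 'h)"
  assumes X: "\<And>i. clinear_op (X i)" and n: "norm (\<Sum>i\<in>UNIV. X i o\<^sub>L adj (X i)) \<le> 1"
  shows "(norm (\<Sum>\<alpha>\<in>words_upto N. word_op X \<alpha> (h \<alpha>)))\<^sup>2 \<le> Re (toeplitz_form 1 X N h)"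
proof (induction N arbitrary: h)
  case 0
  have "words_upto 0 = {[]::'n list}" by (auto simp: words_upto_def)
  then show ?case by (simp add: toeplitz_form_def cinner_self)
next
  case (Suc N)
  define v where "v i = (\<Sum>\<alpha>\<in>words_upto N. word_op X \<alpha> (h (i # \<alpha>)))" for i
  define Z where "Z = (\<Sum>i\<in>UNIV. X i (v i))"
  have Z: "(\<Sum>i\<in>UNIV. \<Sum>\<alpha>\<in>words_upto N. word_op X (i # \<alpha>) (h (i # \<alpha>))) = Z"
    by (simp add: Z_def v_def blinfun.sum_right)
  \<comment> \<open>\<open>Z + h []\<close> is the vector to be bounded at level
    \<open>Suc N\<close>; completing the square produces just the cross term of
    \<open>toeplitz_form_Suc\<close>.\<close>
  have "(norm (Z + h []))\<^sup>2 = (norm Z)\<^sup>2 + 2 * Re (cinner Z (h [])) + (norm (h []))\<^sup>2" by (rule norm_add_sq)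
  also have "(norm Z)\<^sup>2 \<le> (\<Sum>i\<in>UNIV. (norm (v i))\<^sup>2)"
    unfolding Z_def by (rule norm_row_contraction_le[OF X n])
  also have "\<dots> \<le> (\<Sum>i\<in>UNIV. Re (toeplitz_form 1 X N (\<lambda>\<alpha>. h (i # \<alpha>))))"
    unfolding v_def by (intro sum_mono Suc)
  also have "\<dots> + 2 * Re (cinner Z (h [])) + (norm (h []))\<^sup>2 = Re (toeplitz_form 1 X (Suc N) h)"
    unfolding toeplitz_form_Suc[OF X] Z by simp
  finally show ?case unfolding sum_words_upto_Suc Z by (simp add: add.commute)
qed

section \<open>Matrix polynomials and Harnack domination as real inequalities\<close>

definition poly_form :: "nat \<Rightarrow> 'n matrix_poly \<Rightarrow> ('n \<Rightarrow> ('h::chilbert_space \<Rightarrow>\<^sub>L 'h)) \<Rightarrow> (nat \<Rightarrow> 'h) \<Rightarrow> complex" where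
  "poly_form m p X x = (\<Sum>i<m. \<Sum>j<m. cinner (poly_eval m p X i j (x j)) (x i))"

lemma poly_form_eq:
  "poly_form m p X x = (\<Sum>i<m. \<Sum>j<m. \<Sum>\<gamma>\<in>poly_support m p. p \<gamma> i j * cinner (word_op X \<gamma> (x j)) (x i))"
  unfolding poly_form_def poly_eval_def
  by (simp add: blinfun.sum_left cinner_sum_left scaleC_blinfun.rep_eq cinner_scaleC_left)

lemma clinear_poly_eval: "(\<And>i. clinear_op (X i)) \<Longrightarrow> clinear_op (poly_eval m p X i j)"
  unfolding poly_eval_def by (intro clinear_op_sum clinear_op_scaleC clinear_word_op)

text \<open>Swapping the two indices turns the form of the adjoint matrix into the complex conjugate
  of the original form.\<close>

lemma Re_op_matrix_form:
  assumes Q: "\<And>i j. clinear_op (Q i j)"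
  shows "(\<Sum>i<m. cinner (\<Sum>j<m. Re_op_matrix Q i j (x j)) (x i))
     = of_real (Re (\<Sum>i<m. \<Sum>j<m. cinner (Q i j (x j)) (x i)))"
proof -
  define S where "S = (\<Sum>i<m. \<Sum>j<m. cinner (Q i j (x j)) (x i))"
  have "(\<Sum>i<m. \<Sum>j<m. cinner (adj (Q j i) (x j)) (x i)) = (\<Sum>i<m. \<Sum>j<m. cnj (cinner (Q j i (x i)) (x j)))"
    by (simp add: cinner_adj_left Q cinner_commute[symmetric])
  also have "\<dots> = cnj S" unfolding S_def by (subst sum.swap) simp
  finally have "(\<Sum>i<m. cinner (\<Sum>j<m. Re_op_matrix Q i j (x j)) (x i)) = (1/2) * (cnj S + S)"
    unfolding Re_op_matrix_def S_def
    by (simp add: cinner_sum_left blinfun.scaleR_left blinfun.add_left cinner_scaleR_left cinner_add_left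
        sum.distrib add_divide_distrib flip: sum_divide_distrib)
  also have "\<dots> = of_real (Re S)" using complex_add_cnj[of S] by (simp add: add.commute)
  finally show ?thesis unfolding S_def .
qed

lemma nonneg_op_matrix_poly_iff:
  fixes X :: "'n \<Rightarrow> ('h::chilbert_space \<Rightarrow>\<^sub>L 'h)"
  assumes "\<And>i. clinear_op (X i)"
  shows "nonneg_op_matrix m (Re_op_matrix (poly_eval m p X)) \<longleftrightarrow> (\<forall>x. 0 \<le> Re (poly_form m p X x))"
  unfolding nonneg_op_matrix_def Re_op_matrix_form[of "poly_eval m p X", OF clinear_poly_eval[of X, OF assms]]
    poly_form_def[symmetric] by (simp add: Let_def)

text \<open>The value of the form of \<open>rho_Re_poly\<close>, see
  \<open>rho_Re_poly_form\<close>; operator-matrix inequalities thereby become inequalities of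
  reals.\<close>

definition rho_form :: "real \<Rightarrow> nat \<Rightarrow> 'n matrix_poly \<Rightarrow> ('n \<Rightarrow> ('h::chilbert_space \<Rightarrow>\<^sub>L 'h)) \<Rightarrow> (nat \<Rightarrow> 'h) \<Rightarrow> real" where
  "rho_form \<rho> m p X x = Re (poly_form m p X x) + (\<rho> - 1) * Re (poly_form m p (\<lambda>_. 0) x)"

lemma rho_Re_poly_form:
  assumes X: "\<And>i. clinear_op (X i)"
  shows "(\<Sum>i<m. cinner (\<Sum>j<m. rho_Re_poly \<rho> m p X i j (x j)) (x i)) = of_real (rho_form \<rho> m p X x)"
proof -
  have "(\<Sum>i<m. cinner (\<Sum>j<m. rho_Re_poly \<rho> m p X i j (x j)) (x i))
     = (\<Sum>i<m. cinner (\<Sum>j<m. Re_op_matrix (poly_eval m p X) i j (x j)) (x i))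
     + of_real (\<rho> - 1) * (\<Sum>i<m. cinner (\<Sum>j<m. Re_op_matrix (poly_eval m p (\<lambda>_. 0)) i j (x j)) (x i))"
    unfolding rho_Re_poly_def
    by (simp add: cinner_sum_left blinfun.scaleR_left blinfun.add_left cinner_scaleR_left cinner_add_left
        sum.distrib sum_distrib_left)
  then show ?thesis
    by (simp add: Re_op_matrix_form clinear_poly_eval X rho_form_def poly_form_def)
qed

lemma harnack_dominated_iff:
  fixes A B :: "'n::finite \<Rightarrow> ('h::chilbert_space \<Rightarrow>\<^sub>L 'h)"
  assumes A: "\<And>i. clinear_op (A i)" and B: "\<And>i. clinear_op (B i)"
  shows "harnack_dominated K \<rho> A B \<longleftrightarrow>
    (\<exists>c>0. \<forall>m p x. positive_poly K m p \<longrightarrow> rho_form \<rho> m p A x \<le> c\<^sup>2 * rho_form \<rho> m p B x)"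
proof -
  have "(\<Sum>i<m. cinner (\<Sum>j<m. (c\<^sup>2 *\<^sub>R rho_Re_poly \<rho> m p B i j - rho_Re_poly \<rho> m p A i j) (x j)) (x i))
     = of_real (c\<^sup>2 * rho_form \<rho> m p B x - rho_form \<rho> m p A x)" for c m p x
  proof -
    have "(\<Sum>i<m. cinner (\<Sum>j<m. (c\<^sup>2 *\<^sub>R rho_Re_poly \<rho> m p B i j - rho_Re_poly \<rho> m p A i j) (x j)) (x i))
     = of_real (c\<^sup>2) * (\<Sum>i<m. cinner (\<Sum>j<m. rho_Re_poly \<rho> m p B i j (x j)) (x i))
      - (\<Sum>i<m. cinner (\<Sum>j<m. rho_Re_poly \<rho> m p A i j (x j)) (x i))"
      by (simp add: cinner_sum_left blinfun.scaleR_left blinfun.diff_left cinner_scaleR_left cinner_diff_left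
        sum_subtractf sum_distrib_left)
    then show ?thesis by (simp add: rho_Re_poly_form A B)
  qed
  then show ?thesis
    unfolding harnack_dominated_def nonneg_op_matrix_def Let_def by simp
qed

text \<open>The polynomial whose real part is the compression of the multi-Toeplitz kernel to the words \<open>e i\<close>.\<close>

definition toeplitz_poly :: "(nat \<Rightarrow> 'n list) \<Rightarrow> 'n matrix_poly" where
  "toeplitz_poly e \<gamma> i j = (if e j = e i @ \<gamma> then if \<gamma> = [] then 1 else 2 else 0)"

lemma finite_poly_support_toeplitz_poly: "finite (poly_support m (toeplitz_poly e))"
proof (rule finite_subset)
  show "poly_support m (toeplitz_poly e) \<subseteq> (\<lambda>(i, j). drop (length (e i)) (e j)) ` ({..<m} \<times> {..<m})"
  proof
    fix \<gamma> assume "\<gamma> \<in> poly_support m (toeplitz_poly e)"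
    then obtain i j where "i < m" "j < m" "e j = e i @ \<gamma>"
      unfolding poly_support_def toeplitz_poly_def by (auto split: if_splits)
    then show "\<gamma> \<in> (\<lambda>(i, j). drop (length (e i)) (e j)) ` ({..<m} \<times> {..<m})"
      by (intro image_eqI[of _ _ "(i, j)"]) auto
  qed
qed simp

lemma poly_eval_toeplitz_poly:
  assumes ij: "i < m" "j < m"
  shows "e j = e i @ \<gamma> \<Longrightarrow> poly_eval m (toeplitz_poly e) X i j = (if \<gamma> = [] then id_blinfun else 2 *\<^sub>R word_op X \<gamma>)"
    and "\<nexists>\<gamma>. e j = e i @ \<gamma> \<Longrightarrow> poly_eval m (toeplitz_poly e) X i j = 0"
proof -
  assume *: "e j = e i @ \<gamma>"
  then have g: "\<gamma> \<in> poly_support m (toeplitz_poly e)"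
    using ij unfolding poly_support_def toeplitz_poly_def by auto
  have "poly_eval m (toeplitz_poly e) X i j
      = (\<Sum>\<gamma>'\<in>poly_support m (toeplitz_poly e). if \<gamma>' = \<gamma> then toeplitz_poly e \<gamma> i j *\<^sub>C word_op X \<gamma> else 0)"
    unfolding poly_eval_def by (intro sum.cong refl) (auto simp: toeplitz_poly_def *)
  also have "\<dots> = toeplitz_poly e \<gamma> i j *\<^sub>C word_op X \<gamma>"
    using g by (simp add: sum.delta' finite_poly_support_toeplitz_poly)
  finally show "poly_eval m (toeplitz_poly e) X i j = (if \<gamma> = [] then id_blinfun else 2 *\<^sub>R word_op X \<gamma>)"
    using * scaleC_of_real[of 2 "word_op X \<gamma>"] by (simp add: toeplitz_poly_def)
qed (simp add: poly_eval_def toeplitz_poly_def)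

text \<open>For different words at most one of the entries (i, j) and (j, i) is nonzero, so the
  coefficient 2 compensates the 1/2 of the real part; for equal words both entries contribute and
  the coefficient is 1.\<close>

lemma Re_poly_eval_toeplitz_poly:
  assumes X: "\<And>i. clinear_op (X i)" and ij: "i < m" "j < m"
  shows "Re_op_matrix (poly_eval m (toeplitz_poly e) X) i j = toeplitz_kernel 1 X (e i) (e j)"
proof -
  note ev = poly_eval_toeplitz_poly(1)[OF ij, of e _ X] poly_eval_toeplitz_poly(2)[OF ij, of e X]
    poly_eval_toeplitz_poly(1)[OF ij(2,1), of e _ X] poly_eval_toeplitz_poly(2)[OF ij(2,1), of e X]
  have eq: ?thesis if *: "e i = e j"
    using ev(1)[of "[]"] ev(3)[of "[]"] * toeplitz_kernel_append[of 1 X "e i" "[]"]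
    by (simp add: Re_op_matrix_def flip: scaleR_2)
  consider "e i = e j" | \<gamma> where "\<gamma> \<noteq> []" "e j = e i @ \<gamma>" | \<gamma> where "\<gamma> \<noteq> []" "e i = e j @ \<gamma>"
    | "\<nexists>\<gamma>. e j = e i @ \<gamma>" "\<nexists>\<gamma>. e i = e j @ \<gamma>" by (metis append_Nil2)
  then show ?thesis
  proof cases
    case 1 then show ?thesis by (rule eq)
  next
    case (2 \<gamma>)
    then have "\<nexists>\<gamma>. e i = e j @ \<gamma>" by auto
    then show ?thesis using 2 ev(1)[of \<gamma>] ev(4) toeplitz_kernel_append[of 1 X "e i" \<gamma>]
      by (simp add: Re_op_matrix_def)
  next
    case (3 \<gamma>)
    then have "\<nexists>\<gamma>. e j = e i @ \<gamma>" by auto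
    then show ?thesis using 3 ev(3)[of \<gamma>] ev(2) toeplitz_kernel_append_left[of 1 X "e j" \<gamma>]
      by (simp add: Re_op_matrix_def adj_scaleR clinear_word_op X)
  next
    case 4
    then show ?thesis using ev(2) ev(4) by (simp add: Re_op_matrix_def toeplitz_kernel_eq_0)
  qed
qed

lemma toeplitz_poly_form:
  fixes X :: "'n::finite \<Rightarrow> ('h::chilbert_space \<Rightarrow>\<^sub>L 'h)"
  assumes X: "\<And>i. clinear_op (X i)" and e: "bij_betw e {..<m} (words_upto N)"
  shows "of_real (rho_form \<rho> m (toeplitz_poly e) X (\<lambda>i. h (e i))) = toeplitz_form \<rho> X N h"
proof -
  have rho: "rho_Re_poly \<rho> m (toeplitz_poly e) X i j = toeplitz_kernel \<rho> X (e i) (e j)"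
    if "i < m" "j < m" for i j
    using that
    by (simp add: rho_Re_poly_def Re_poly_eval_toeplitz_poly X toeplitz_kernel_zero toeplitz_kernel_shift[of \<rho>])
  have "of_real (rho_form \<rho> m (toeplitz_poly e) X (\<lambda>i. h (e i)))
      = (\<Sum>i<m. \<Sum>j<m. cinner (toeplitz_kernel \<rho> X (e i) (e j) (h (e j))) (h (e i)))"
    unfolding rho_Re_poly_form[of X, OF X, symmetric] by (simp add: rho cinner_sum_left)
  also have "\<dots> = toeplitz_form \<rho> X N h"
    unfolding toeplitz_form_def sum.reindex_bij_betw[OF e, symmetric] ..
  finally show ?thesis .
qed

text \<open>At a row contraction the form of this polynomial is the finite section of the kernel
  with \<rho> = 1, which is nonnegative by \<open>toeplitz_form_row_contraction\<close>.\<close>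

lemma positive_toeplitz_poly:
  fixes K :: "'k::chilbert_space itself" and e :: "nat \<Rightarrow> 'n::finite list"
  assumes e: "bij_betw e {..<m} (words_upto N)"
  shows "positive_poly K m (toeplitz_poly e)"
  unfolding positive_poly_def
proof (intro conjI allI impI finite_poly_support_toeplitz_poly, elim conjE)
  fix X :: "'n \<Rightarrow> 'k \<Rightarrow>\<^sub>L 'k"
  assume X: "\<forall>i. clinear_op (X i)" and n: "norm (\<Sum>i\<in>UNIV. X i o\<^sub>L adj (X i)) < 1"
  have "0 \<le> Re (poly_form m (toeplitz_poly e) X x)" for x
  proof -
    define h where "h \<alpha> = x (the_inv_into {..<m} e \<alpha>)" for \<alpha>
    have h: "h (e i) = x i" if "i < m" for i
      using e that by (simp add: h_def the_inv_into_f_f bij_betw_def)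
    have "0 \<le> Re (toeplitz_form 1 X N h)"
      using toeplitz_form_row_contraction[where X=X and N=N and h=h] X n by (meson less_imp_le order_trans zero_le_power2)
    also have "\<dots> = rho_form 1 m (toeplitz_poly e) X (\<lambda>i. h (e i))"
      using toeplitz_poly_form[where X=X and e=e and m=m and N=N and h=h and \<rho>=1] X e by (metis Re_complex_of_real)
    also have "\<dots> = Re (poly_form m (toeplitz_poly e) X x)"
      by (simp add: rho_form_def poly_form_def h)
    finally show ?thesis .
  qed
  then show "nonneg_op_matrix m (Re_op_matrix (poly_eval m (toeplitz_poly e) X))"
    using nonneg_op_matrix_poly_iff[of X] X by blast
qed

text \<open>The constant does not depend on \<open>N\<close> because one Harnack constant serves all
  matrix sizes \<open>m\<close>, here the number of words of length at most
  \<open>N\<close>.\<close>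

lemma harnack_dominated_toeplitz_form:
  fixes A B :: "'n::finite \<Rightarrow> ('h::chilbert_space \<Rightarrow>\<^sub>L 'h)"
  assumes A: "\<And>i. clinear_op (A i)" and B: "\<And>i. clinear_op (B i)"
    and dom: "harnack_dominated K \<rho> A B"
  shows "\<exists>c>0. \<forall>N h. Re (toeplitz_form \<rho> A N h) \<le> c * Re (toeplitz_form \<rho> B N h)"
proof -
  obtain c where c: "c > 0" and le: "\<And>m p x. positive_poly K m p \<Longrightarrow> rho_form \<rho> m p A x \<le> c\<^sup>2 * rho_form \<rho> m p B x"
    using dom unfolding harnack_dominated_iff[of A B, OF A B] by blast
  have "Re (toeplitz_form \<rho> A N h) \<le> c\<^sup>2 * Re (toeplitz_form \<rho> B N h)" for N h
  proof -
    obtain e where e: "bij_betw e {..<card (words_upto N :: 'n list set)} (words_upto N :: 'n list set)"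
      using ex_bij_betw_nat_finite[OF finite_words_upto] by (metis atLeast0LessThan)
    show ?thesis
      using le[OF positive_toeplitz_poly[OF e], of "\<lambda>i. h (e i)"]
      unfolding toeplitz_poly_form[of A e _ N, OF A e, symmetric] toeplitz_poly_form[of B e _ N, OF B e, symmetric]
      by simp
  qed
  then show ?thesis using c by (intro exI[of _ "c\<^sup>2"]) simp
qed

section \<open>Upper bounds of the form and decay of the levels\<close>

lemma sum_lev_le_of_toeplitz_form_le:
  fixes A :: "'n::finite \<Rightarrow> ('h::chilbert_space \<Rightarrow>\<^sub>L 'h)"
  assumes A: "\<And>i. clinear_op (A i)" and rho: "\<rho> \<ge> 0" and b: "b > 0"
    and pos: "\<And>N h. 0 \<le> Re (toeplitz_form \<rho> A N h)"
    and up: "\<And>N h. Re (toeplitz_form \<rho> A N h) \<le> b * (\<Sum>\<alpha>\<in>words_upto N. (norm (h \<alpha>))\<^sup>2)"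
  shows "(\<Sum>k\<le>Suc N. lev A k x) \<le> (b\<^sup>2 + 1) * (norm x)\<^sup>2"
proof -
  \<comment> \<open>Test vector: the adjoints make every cross term a squared norm. The factor
    \<open>b\<close> at the empty word balances the two sides, 2 b S against b (S + b^2 |x|^2), so
    that S can be absorbed.\<close>
  define h where "h \<alpha> = (if \<alpha> = [] then b *\<^sub>R x else adj (word_op A \<alpha>) x)" for \<alpha>
  define S where "S = (\<Sum>i\<in>UNIV. \<Sum>\<alpha>\<in>words_upto N. (norm (adj (word_op A (i # \<alpha>)) x))\<^sup>2)"
  have "cinner (\<Sum>i\<in>UNIV. \<Sum>\<alpha>\<in>words_upto N. word_op A (i # \<alpha>) (h (i # \<alpha>))) (h [])
      = (\<Sum>i\<in>UNIV. \<Sum>\<alpha>\<in>words_upto N. of_real b * of_real ((norm (adj (word_op A (i # \<alpha>)) x))\<^sup>2))"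
    unfolding cinner_sum_left
    by (simp add: h_def cinner_scaleR_right cinner_adj clinear_word_op A cinner_self del: word_op.simps)
  then have c: "cinner (\<Sum>i\<in>UNIV. \<Sum>\<alpha>\<in>words_upto N. word_op A (i # \<alpha>) (h (i # \<alpha>))) (h []) = of_real (b * S)"
    by (simp add: S_def sum_distrib_left)
  have "2 * (b * S) \<le> Re (toeplitz_form \<rho> A (Suc N) h)"
    unfolding toeplitz_form_Suc[OF A] c using rho pos by (simp add: sum_nonneg)
  also have "\<dots> \<le> b * (\<Sum>\<alpha>\<in>words_upto (Suc N). (norm (h \<alpha>))\<^sup>2)" by (rule up)
  also have "(\<Sum>\<alpha>\<in>words_upto (Suc N). (norm (h \<alpha>))\<^sup>2) = b\<^sup>2 * (norm x)\<^sup>2 + S"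
    unfolding sum_words_upto_Suc S_def by (simp add: h_def power_mult_distrib del: word_op.simps)
  finally have "b * (2 * S) \<le> b * (b\<^sup>2 * (norm x)\<^sup>2 + S)" by simp
  then have S: "S \<le> b\<^sup>2 * (norm x)\<^sup>2" using b by simp
  have "(\<Sum>k\<le>Suc N. lev A k x) = (norm x)\<^sup>2 + S"
    unfolding lev_def sum_words_upto_levels[symmetric] sum_words_upto_Suc S_def by (simp del: word_op.simps(2))
  then show ?thesis using S by (simp add: algebra_simps)
qed

text \<open>A Datko-type argument: summability of the levels forces their uniform decay.\<close>

lemma joint_spectral_radius_less_1_of_sum_lev:
  fixes A :: "'n::finite \<Rightarrow> ('h::chilbert_space \<Rightarrow>\<^sub>L 'h)"
  assumes A: "\<And>i. clinear_op (A i)" and C: "C \<ge> 0" and le: "\<And>N x. (\<Sum>k\<le>N. lev A k x) \<le> C * (norm x)\<^sup>2"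
  shows "joint_spectral_radius A < 1"
proof -
  have lev: "lev A k x \<le> C * (norm x)\<^sup>2" for k x
  proof -
    have "lev A k x \<le> (\<Sum>k\<le>k. lev A k x)" by (rule member_le_sum) (auto simp: lev_nonneg)
    then show ?thesis using le[where N=k and x=x] by simp
  qed
  have key: "lev A N x \<le> C\<^sup>2 / real (Suc N) * (norm x)\<^sup>2" for N x
  proof -
    have "real (Suc N) * lev A N x = (\<Sum>k\<le>N. lev A N x)" by simp
    also have "\<dots> \<le> (\<Sum>k\<le>N. C * lev A k x)"
    proof (rule sum_mono)
      fix k assume "k \<in> {..N}"
      \<comment> \<open>Level \<open>N\<close> is reached from each level \<open>k\<close> below it
        by \<open>N - k\<close> further letters at the cost of a factor \<open>C\<close>; averaging
        over \<open>k\<close> gains the factor 1 / (N + 1).\<close>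
      then have "lev A N x = lev A (k + (N - k)) x" by simp
      also have "\<dots> \<le> (\<Sum>\<alpha> | length \<alpha> = k. C * (norm (adj (word_op A \<alpha>) x))\<^sup>2)"
        unfolding lev_add[OF A] by (intro sum_mono lev)
      also have "\<dots> = C * lev A k x" by (simp add: lev_def sum_distrib_left)
      finally show "lev A N x \<le> C * lev A k x" .
    qed
    also have "\<dots> \<le> C * (C * (norm x)\<^sup>2)"
      unfolding sum_distrib_left[symmetric] by (intro mult_left_mono le C)
    finally show ?thesis by (simp add: field_simps power2_eq_square)
  qed
  obtain N where N: "C\<^sup>2 < real N" using reals_Archimedean2 by blast
  \<comment> \<open>\<open>key\<close> is used at level \<open>Suc N\<close>, since the spectral
    radius is bounded by levels at least 1.\<close>
  have "C\<^sup>2 / real (Suc (Suc N)) < 1" using N by simp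
  then show ?thesis
    using joint_spectral_radius_less_1I[of A "Suc N" "C\<^sup>2 / real (Suc (Suc N))", OF A _ _ _ key] by simp
qed

section \<open>Square roots of multi-Toeplitz operators\<close>

definition selfadjoint_op :: "('a::complex_inner \<Rightarrow>\<^sub>L 'a) \<Rightarrow> bool" where
  "selfadjoint_op D \<longleftrightarrow> clinear_op D \<and> (\<forall>x y. cinner (D x) y = cinner x (D y))"

lemma selfadjoint_op_id [simp]: "selfadjoint_op id_blinfun"
  and selfadjoint_op_zero [simp]: "selfadjoint_op 0"
  by (simp_all add: selfadjoint_op_def)

lemma selfadjoint_op_add: "selfadjoint_op S \<Longrightarrow> selfadjoint_op T \<Longrightarrow> selfadjoint_op (S + T)"
  and selfadjoint_op_diff: "selfadjoint_op S \<Longrightarrow> selfadjoint_op T \<Longrightarrow> selfadjoint_op (S - T)"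
  and selfadjoint_op_scaleR: "selfadjoint_op S \<Longrightarrow> selfadjoint_op (r *\<^sub>R S)"
  by (simp_all add: selfadjoint_op_def clinear_op_add clinear_op_diff clinear_op_scaleR blinfun.add_left
      blinfun.diff_left blinfun.scaleR_left cinner_add_left cinner_add_right cinner_diff_left cinner_diff_right
      cinner_scaleR_left cinner_scaleR_right)

lemma selfadjoint_op_square: "selfadjoint_op S \<Longrightarrow> selfadjoint_op (S o\<^sub>L S)"
  by (simp add: selfadjoint_op_def clinear_op_compose)

lemma selfadjoint_op_Im: "selfadjoint_op D \<Longrightarrow> Im (cinner (D x) x) = 0"
proof -
  assume "selfadjoint_op D"
  then have "cinner (D x) x = cnj (cinner (D x) x)"
    using cinner_commute[of x "D x"] by (simp add: selfadjoint_op_def)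
  then have "Im (cinner (D x) x) = Im (cnj (cinner (D x) x))" by (rule arg_cong)
  then show ?thesis by simp
qed

lemma closed_clinear_op: "closed {T :: 'a::complex_normed_vector \<Rightarrow>\<^sub>L 'b::complex_normed_vector. clinear_op T}"
  unfolding clinear_op_def
  by (intro closed_Collect_all closed_Collect_eq blinfun.continuous_on continuous_intros
      bounded_linear.continuous_on[OF bounded_linear_scaleC])

lemma closed_selfadjoint_op: "closed {T :: 'a::complex_inner \<Rightarrow>\<^sub>L 'a. selfadjoint_op T}"
  unfolding selfadjoint_op_def
  by (intro closed_Collect_conj closed_clinear_op closed_Collect_all closed_Collect_eq continuous_intros
      bounded_linear.continuous_on[OF bounded_linear_cinner_left]
      bounded_linear.continuous_on[OF bounded_linear_cinner_right])

text \<open>The Neumann inverse as fixed point of Z = I + Y Z. Running the contraction inside the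
  closed set of complex-linear operators makes the inverse complex-linear.\<close>

lemma clinear_inverse_one_minus:
  fixes Y :: "'a::chilbert_space \<Rightarrow>\<^sub>L 'a"
  assumes Y: "clinear_op Y" and n: "norm Y < 1"
  shows "\<exists>Z. clinear_op Z \<and> (id_blinfun - Y) o\<^sub>L Z = id_blinfun"
proof -
  let ?f = "\<lambda>Z. id_blinfun + (Y o\<^sub>L Z)"
  have "\<exists>!Z\<in>{Z. clinear_op Z}. ?f Z = Z"
  proof (rule Banach_fix[of _ "norm Y"])
    show "complete {Z :: 'a \<Rightarrow>\<^sub>L 'a. clinear_op Z}" by (simp add: complete_eq_closed closed_clinear_op)
    show "{Z :: 'a \<Rightarrow>\<^sub>L 'a. clinear_op Z} \<noteq> {}" using clinear_op_zero by blast
    show "?f ` {Z. clinear_op Z} \<subseteq> {Z. clinear_op Z}" using Y by (auto intro: clinear_op_add clinear_op_compose)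
    fix U Z :: "'a \<Rightarrow>\<^sub>L 'a"
    have "?f U - ?f Z = Y o\<^sub>L (U - Z)" by (rule blinfun_eqI) (simp add: blinfun.add_left blinfun.diff_left blinfun.diff_right)
    then show "dist (?f U) (?f Z) \<le> norm Y * dist U Z" by (simp add: dist_norm norm_blinfun_compose)
  qed (use n in auto)
  then obtain Z where Z: "clinear_op Z" "?f Z = Z" by blast
  have "((id_blinfun - Y) o\<^sub>L Z) x = x" for x
    using arg_cong[OF Z(2), of "\<lambda>T. T x"] by (simp add: blinfun.add_left blinfun.diff_left algebra_simps)
  then show ?thesis using Z(1) by (intro exI[of _ Z]) (auto intro: blinfun_eqI)
qed

text \<open>With \<open>D = b (I - A0)\<close> and \<open>\<parallel>A0\<parallel> < 1\<close>, the root is \<open>\<surd>b (I - Y)\<close> for the fixed point \<open>Y\<close> of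
  \<open>Y \<mapsto> (A0 + Y\<^sup>2) / 2\<close>.\<close>

lemma selfadjoint_sqrt:
  fixes D :: "'a::chilbert_space \<Rightarrow>\<^sub>L 'a"
  assumes D: "selfadjoint_op D" and e: "e > 0" and low: "\<And>x. e * (norm x)\<^sup>2 \<le> Re (cinner (D x) x)"
  shows "\<exists>Q R. selfadjoint_op Q \<and> clinear_op R \<and> Q o\<^sub>L Q = D \<and> Q o\<^sub>L R = id_blinfun \<and> R o\<^sub>L Q = id_blinfun"
proof -
  \<comment> \<open>Chosen so that \<open>b * e\<close> dominates the square of the norm of
    \<open>D\<close>: then the squared norm of A0 x is at most (1 - 2 e/b + e/b) times that of x.
    The added 1 keeps \<open>b\<close> positive when \<open>D\<close> is 0.\<close>
  define b where "b = (norm D)\<^sup>2 / e + 1"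
  have b: "b > 0" unfolding b_def using e by (intro add_nonneg_pos) auto
  have be: "(norm D)\<^sup>2 \<le> b * e" using e by (simp add: b_def field_simps)
  define A0 where "A0 = id_blinfun - (1/b) *\<^sub>R D"
  define q where "q = sqrt (max 0 (1 - e / b))"
  have q: "0 \<le> q" "q < 1" using e b by (auto simp: q_def)
  have nA: "norm A0 \<le> q"
  proof (rule norm_blinfun_bound[OF q(1)])
    fix x
    have "norm (D x) \<le> norm D * norm x" by (rule norm_blinfun)
    then have Dx: "(norm (D x))\<^sup>2 \<le> (norm D)\<^sup>2 * (norm x)\<^sup>2"
      by (metis norm_ge_zero power_mono power_mult_distrib)
    have "(norm (A0 x))\<^sup>2 = (norm x)\<^sup>2 - 2 * Re (cinner x ((1/b) *\<^sub>R D x)) + (norm ((1/b) *\<^sub>R D x))\<^sup>2"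
      by (simp add: A0_def blinfun.diff_left blinfun.scaleR_left norm_diff_sq)
    also have "\<dots> = (norm x)\<^sup>2 - 2 / b * Re (cinner (D x) x) + (norm (D x))\<^sup>2 / b\<^sup>2"
      using D by (simp add: selfadjoint_op_def cinner_scaleR_right power_divide)
    also have "\<dots> \<le> (norm x)\<^sup>2 - 2 / b * (e * (norm x)\<^sup>2) + ((b * e) * (norm x)\<^sup>2) / b\<^sup>2"
      using b Dx mult_right_mono[OF be, of "(norm x)\<^sup>2"]
      by (intro add_mono diff_mono mult_left_mono low divide_right_mono order_refl) auto
    also have "\<dots> = (1 - e / b) * (norm x)\<^sup>2" using b by (simp add: field_simps power2_eq_square)
    also have "\<dots> \<le> (q * norm x)\<^sup>2" by (simp add: power_mult_distrib q_def mult_right_mono)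
    finally show "norm (A0 x) \<le> q * norm x" by (rule power2_le_imp_le) (use q in simp)
  qed
  have sA: "selfadjoint_op A0" unfolding A0_def by (intro selfadjoint_op_diff selfadjoint_op_scaleR D) simp
  \<comment> \<open>Radius of the ball for the fixed point: (q + s^2) / 2 = q \<le> s gives
    invariance, and \<open>s\<close> is also the contraction constant there.\<close>
  define s where "s = sqrt q"
  have s: "0 \<le> s" "s < 1" "s * s = q" "q \<le> s"
    using q real_sqrt_le_mono[of "q * q" q] by (auto simp: s_def mult_left_le)
  define S where "S = {Y :: 'a \<Rightarrow>\<^sub>L 'a. norm Y \<le> s \<and> selfadjoint_op Y}"
  let ?f = "\<lambda>Y. (1/2) *\<^sub>R (A0 + (Y o\<^sub>L Y))"
  have "\<exists>!Y\<in>S. ?f Y = Y"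
  proof (rule Banach_fix[of _ s])
    show "complete S" unfolding S_def complete_eq_closed
      by (intro closed_Collect_conj closed_selfadjoint_op closed_Collect_le continuous_intros)
    show "S \<noteq> {}" using s selfadjoint_op_zero by (auto simp: S_def intro!: exI[of _ 0])
    show "?f ` S \<subseteq> S"
    proof (clarify)
      fix Y assume Y: "Y \<in> S"
      have "norm (Y o\<^sub>L Y) \<le> s * s"
        using Y s by (intro order_trans[OF norm_blinfun_compose] mult_mono) (auto simp: S_def)
      then have "norm (?f Y) \<le> s" using norm_triangle_ineq[of A0 "Y o\<^sub>L Y"] nA s by simp
      then show "?f Y \<in> S" using Y sA
        by (auto simp: S_def intro!: selfadjoint_op_scaleR selfadjoint_op_add selfadjoint_op_square)
    qed
    fix Y Z assume YZ: "Y \<in> S" "Z \<in> S"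
    have "?f Y - ?f Z = (1/2) *\<^sub>R ((Y o\<^sub>L (Y - Z)) + ((Y - Z) o\<^sub>L Z))"
      by (rule blinfun_eqI)
        (simp add: blinfun.add_left blinfun.diff_left blinfun.diff_right blinfun.scaleR_left algebra_simps)
    then have "dist (?f Y) (?f Z) \<le> (norm (Y o\<^sub>L (Y - Z)) + norm ((Y - Z) o\<^sub>L Z)) / 2"
      using norm_triangle_ineq[of "Y o\<^sub>L (Y - Z)" "(Y - Z) o\<^sub>L Z"] by (simp add: dist_norm)
    also have "\<dots> \<le> (s * norm (Y - Z) + norm (Y - Z) * s) / 2"
      using YZ s unfolding S_def
      by (intro divide_right_mono add_mono order_trans[OF norm_blinfun_compose] mult_mono) auto
    finally show "dist (?f Y) (?f Z) \<le> s * dist Y Z" by (simp add: dist_norm)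
  qed (use s in auto)
  then obtain Y where Y: "norm Y \<le> s" "selfadjoint_op Y" "?f Y = Y" unfolding S_def by blast
  obtain Z where Z: "clinear_op Z" "(id_blinfun - Y) o\<^sub>L Z = id_blinfun"
    using clinear_inverse_one_minus[of Y] Y s by (auto simp: selfadjoint_op_def)
  define Q where "Q = sqrt b *\<^sub>R (id_blinfun - Y)"
  define R where "R = (1 / sqrt b) *\<^sub>R Z"
  have sQ: "selfadjoint_op Q" unfolding Q_def by (intro selfadjoint_op_scaleR selfadjoint_op_diff Y) simp
  have cR: "clinear_op R" unfolding R_def by (intro clinear_op_scaleR Z)
  \<comment> \<open>The fixed point equation says (I - Y)^2 = I - A0 = D / b.\<close>
  have QQ: "Q (Q x) = D x" for x
  proof -
    have "A0 x + Y (Y x) = 2 *\<^sub>R Y x"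
      using arg_cong[OF Y(3), of "\<lambda>T. 2 *\<^sub>R T x"] by (simp add: blinfun.add_left blinfun.scaleR_left)
    then have *: "Y (Y x) = 2 *\<^sub>R Y x - A0 x" by (simp add: algebra_simps)
    have "Q (Q x) = b *\<^sub>R (x - 2 *\<^sub>R Y x + Y (Y x))"
      using b by (simp add: Q_def blinfun.diff_left blinfun.diff_right blinfun.scaleR_left blinfun.scaleR_right
          algebra_simps scaleR_2)
    also have "\<dots> = D x" unfolding *
      using b by (simp add: A0_def blinfun.diff_left blinfun.scaleR_left algebra_simps)
    finally show ?thesis .
  qed
  have QR: "Q (R x) = x" for x
    using arg_cong[OF Z(2), of "\<lambda>T. T x"] b
    by (simp add: Q_def R_def blinfun.diff_left blinfun.scaleR_left blinfun.scaleR_right)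
  \<comment> \<open>\<open>R\<close> is so far a right inverse of \<open>Q\<close>; the lower bound
    makes \<open>Q\<close> injective, hence \<open>R\<close> is two-sided.\<close>
  have inj: "x = 0" if "Q x = 0" for x
  proof -
    have "D x = 0" using QQ[of x] that by simp
    then have "e * (norm x)\<^sup>2 \<le> 0" using low[of x] by simp
    then show ?thesis using e by (simp add: mult_le_0_iff)
  qed
  have "R (Q x) = x" for x
    using inj[of "R (Q x) - x"] by (simp add: blinfun.diff_right QR)
  then show ?thesis using sQ cR QQ QR
    by (intro exI[of _ Q] exI[of _ R]) (auto intro: blinfun_eqI)
qed

section \<open>Creation operators and dilations of multi-Toeplitz operators\<close>

text \<open>Left creation prepends a letter, while the kernel is built from right creations, which
  append; the two commute, and this is the source of the multi-Toeplitz relation.\<close>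

definition left_creation :: "'n \<Rightarrow> (('n list, 'h::chilbert_space) ell2 \<Rightarrow>\<^sub>L ('n list, 'h) ell2)" where
  "left_creation i = reindex_op (Cons i)"

lemma left_creation_ket: "left_creation i (ket \<alpha> x) = ket (i # \<alpha>) x"
  by (simp add: left_creation_def reindex_op.rep_eq reindex_ell2_ket)

lemma word_op_left_creation_ket: "word_op left_creation \<alpha> (ket \<beta> x) = ket (\<alpha> @ \<beta>) x"
  by (induction \<alpha>) (simp_all add: left_creation_ket)

lemma clinear_left_creation: "clinear_op (left_creation i)"
  by (simp add: left_creation_def clinear_reindex_op)

lemma cinner_ket_right: "cinner f (ket i y) = cinner (ell2_apply f i) y"
  using cinner_commute[of f "ket i y"] cinner_commute[of "ell2_apply f i" y] by (simp add: cinner_ket_left)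

lemma blinfun_eq_ketI:
  fixes S T :: "('i, 'h::chilbert_space) ell2 \<Rightarrow>\<^sub>L 'b::real_normed_vector"
  assumes "\<And>i x. S (ket i x) = T (ket i x)"
  shows "S = T"
proof (rule blinfun_eqI)
  fix f
  have "((\<lambda>i. T (ket i (ell2_apply f i))) has_sum S f) UNIV"
    using has_sum_bounded_linear[OF blinfun.bounded_linear_right[of S] ket_has_sum[of f]] by (simp add: assms)
  moreover have "((\<lambda>i. T (ket i (ell2_apply f i))) has_sum T f) UNIV"
    by (rule has_sum_bounded_linear[OF blinfun.bounded_linear_right ket_has_sum])
  ultimately show "S f = T f" by (rule has_sum_unique)
qed

lemma blinfun_eq_ket_cinnerI:
  fixes S T :: "('i, 'h::chilbert_space) ell2 \<Rightarrow>\<^sub>L ('j, 'g::chilbert_space) ell2"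
  assumes "\<And>i j x y. cinner (S (ket i x)) (ket j y) = cinner (T (ket i x)) (ket j y)"
  shows "S = T"
proof (rule blinfun_eq_ketI, rule ell2_eqI)
  fix i x j
  show "ell2_apply (S (ket i x)) j = ell2_apply (T (ket i x)) j"
    by (rule cinner_ext) (use assms in \<open>simp add: cinner_ket_right\<close>)
qed

text \<open>A positive definite multi-Toeplitz operator \<open>D = Q\<^sup>2\<close> makes \<open>Q L\<^sub>i Q\<^sup>-\<^sup>1\<close> isometries with orthogonal
  ranges, since \<open>L\<^sub>i\<^sup>* D L\<^sub>j = \<delta>\<^sub>i\<^sub>j D\<close>.\<close>

lemma toeplitz_isometries:
  fixes D :: "('n list, 'h::chilbert_space) ell2 \<Rightarrow>\<^sub>L ('n list, 'h) ell2"
  assumes D: "selfadjoint_op D" and e: "e > 0" and low: "\<And>f. e * (norm f)\<^sup>2 \<le> Re (cinner (D f) f)"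
    and toep: "\<And>i j \<alpha> \<beta> x y. cinner (D (ket (j # \<beta>) x)) (ket (i # \<alpha>) y)
        = (if i = j then cinner (D (ket \<beta> x)) (ket \<alpha> y) else 0)"
  shows "\<exists>(J :: 'h \<Rightarrow>\<^sub>L ('n list, 'h) ell2) V. clinear_op J \<and> (\<forall>i. isometry_op (V i)) \<and>
    (\<forall>i j. i \<noteq> j \<longrightarrow> (\<forall>x y. cinner (V i x) (V j y) = 0)) \<and>
    (\<forall>\<alpha> x y. cinner (word_op V \<alpha> (J x)) (J y) = cinner (D (ket \<alpha> x)) (ket [] y))"
proof -
  obtain Q R where Q: "selfadjoint_op Q" and R: "clinear_op R" and QQ: "Q o\<^sub>L Q = D"
    and RQ: "R o\<^sub>L Q = id_blinfun"  and QR: "Q o\<^sub>L R = id_blinfun"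
    using selfadjoint_sqrt[OF D e low] by blast
  have cQ: "clinear_op Q" using Q by (simp add: selfadjoint_op_def)
  have QQ': "cinner (Q f) (Q g) = cinner (D f) g" for f g
    using Q by (simp add: QQ[symmetric] selfadjoint_op_def)
  have RQ': "R (Q f) = f" for f using arg_cong[OF RQ, of "\<lambda>T. T f"] by simp
  have QR': "Q (R f) = f" for f using arg_cong[OF QR, of "\<lambda>T. T f"] by simp
  have LDL: "adj (left_creation i) o\<^sub>L D o\<^sub>L left_creation j = (if i = j then D else 0)" for i j
    by (rule blinfun_eq_ket_cinnerI) (simp add: cinner_adj_left clinear_left_creation left_creation_ket toep)
  have L: "cinner (D (left_creation j f)) (left_creation i g) = (if i = j then cinner (D f) g else 0)" for i j f g
  proof -
    have "cinner (D (left_creation j f)) (left_creation i g) = cinner ((adj (left_creation i) o\<^sub>L D o\<^sub>L left_creation j) f) g"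
      by (simp add: cinner_adj_left clinear_left_creation)
    then show ?thesis unfolding LDL by simp
  qed
  define V where "V i = Q o\<^sub>L left_creation i o\<^sub>L R" for i
  have cV: "clinear_op (V i)" for i
    unfolding V_def by (intro clinear_op_compose cQ R clinear_left_creation)
  have VV: "cinner (V j f) (V i g) = (if i = j then cinner f g else 0)" for i j f g
    using QQ'[of "R f" "R g"] by (simp add: V_def QQ' L QR')
  have iso: "isometry_op (V i)" for i
  proof -
    have "norm (V i f) = norm f" for f
    proof -
      have "complex_of_real ((norm (V i f))\<^sup>2) = complex_of_real ((norm f)\<^sup>2)"
        using VV[of i f i f] by (simp only: cinner_self if_True refl)
      then have "(norm (V i f))\<^sup>2 = (norm f)\<^sup>2" by (simp only: of_real_eq_iff)
      then show ?thesis by simp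
    qed
    then show ?thesis using cV by (simp add: isometry_op_def)
  qed
  define E :: "'h \<Rightarrow> ('n list, 'h) ell2" where "E x = ket [] x" for x
  have E: "bounded_linear E"
  proof (rule bounded_linear_intro[where K=1])
    show "E (x + y) = E x + E y" for x y by (rule ell2_eqI) (simp add: E_def ket_apply)
    show "E (r *\<^sub>R x) = r *\<^sub>R E x" for r x by (rule ell2_eqI) (simp add: E_def ket_apply)
    fix x
    have "complex_of_real ((norm (E x))\<^sup>2) = complex_of_real ((norm x)\<^sup>2)"
      unfolding cinner_self[symmetric] by (simp add: E_def cinner_ket_left ket_apply)
    then have "(norm (E x))\<^sup>2 = (norm x)\<^sup>2" by (simp only: of_real_eq_iff)
    then show "norm (E x) \<le> norm x * 1" by simp
  qed
  \<comment> \<open>With this choice \<open>word_op V \<alpha> (J x)\<close> is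
    \<open>Q (ket \<alpha> x)\<close>, which recovers the matrix of \<open>D\<close>.
    \<open>J\<close> is isometric precisely when the diagonal entry of \<open>D\<close> is the
    identity.\<close>
  define J where "J = Q o\<^sub>L Blinfun E"
  have J: "J x = Q (ket [] x)" for x by (simp add: J_def bounded_linear_Blinfun_apply[OF E] E_def)
  have "E (c *\<^sub>C x) = c *\<^sub>C E x" for c x by (rule ell2_eqI) (simp add: E_def ket_apply)
  then have cJ: "clinear_op J" unfolding J_def
    by (intro clinear_op_compose cQ) (simp add: clinear_op_def bounded_linear_Blinfun_apply[OF E])
  have word: "word_op V \<alpha> (Q f) = Q (word_op left_creation \<alpha> f)" for \<alpha> f
    by (induction \<alpha>) (simp_all add: V_def RQ')
  have "cinner (word_op V \<alpha> (J x)) (J y) = cinner (D (ket \<alpha> x)) (ket [] y)" for \<alpha> x y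
    by (simp add: J word QQ' word_op_left_creation_ket)
  then show ?thesis using cJ iso VV by (intro exI[of _ J] exI[of _ V]) auto
qed

section \<open>The kernel as an operator\<close>

lemma bounded_bilinear_cinner: "bounded_bilinear (cinner :: 'a::complex_inner \<Rightarrow> 'a \<Rightarrow> complex)"
  by (rule bounded_bilinear.intro)
    (auto simp: cinner_add_left cinner_add_right cinner_scaleR_left cinner_scaleR_right scaleR_conv_of_real
      intro!: exI[of _ 1] cauchy_schwarz)

lemmas continuous_on_cinner [continuous_intros] = bounded_bilinear.continuous_on[OF bounded_bilinear_cinner]

text \<open>In a product of operators the last factor acts first, so the reversed word appends the
  letters of \<alpha> in their order.\<close>

lemma word_op_right_creation_ket: "word_op right_creation (rev \<alpha>) (ket \<beta> c) = ket (\<beta> @ \<alpha>) c"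
  by (induction \<alpha> arbitrary: \<beta>) (simp_all add: word_op_append right_creation_ket)

lemma clinear_right_creation: "clinear_op (right_creation i)"
  by (simp add: right_creation_def clinear_reindex_op)

lemma ket_zero [simp]: "ket i 0 = 0"
  by (rule ell2_eqI) (simp add: ket_apply)

lemma ell2_eq_cinner_ketI:
  assumes "\<And>i y. cinner f (ket i y) = cinner g (ket i y)"
  shows "f = g"
proof (rule ell2_eqI)
  show "ell2_apply f i = ell2_apply g i" for i
    by (rule cinner_ext) (use assms in \<open>simp add: cinner_ket_right\<close>)
qed

lemma norm_sum_ket:
  assumes I: "finite I" and s: "inj_on s I"
  shows "(norm (\<Sum>i\<in>I. ket (s i) (y i)))\<^sup>2 = (\<Sum>i\<in>I. (norm (y i))\<^sup>2)"
proof -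
  have "complex_of_real ((norm (\<Sum>i\<in>I. ket (s i) (y i)))\<^sup>2)
      = (\<Sum>i\<in>I. \<Sum>j\<in>I. if i = j then cinner (y i) (y i) else 0)"
    unfolding cinner_self[symmetric] cinner_sum_left cinner_sum_right
    by (intro sum.cong refl) (use s in \<open>auto simp: cinner_ket_left ket_apply inj_on_def\<close>)
  also have "\<dots> = of_real (\<Sum>i\<in>I. (norm (y i))\<^sup>2)" using I by (simp add: cinner_self)
  finally show ?thesis by (simp only: of_real_eq_iff)
qed

lemma ell2_in_closed:
  assumes C: "closed C" and F: "\<And>F. finite F \<Longrightarrow> (\<Sum>i\<in>F. ket i (ell2_apply f i)) \<in> C"
  shows "f \<in> C"
proof (rule Lim_in_closed_set[OF C _ finite_subsets_at_top_neq_bot])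
  show "((\<lambda>F. \<Sum>i\<in>F. ket i (ell2_apply f i)) \<longlongrightarrow> f) (finite_subsets_at_top UNIV)"
    using ket_has_sum[of f] by (simp add: has_sum_def)
  show "\<forall>\<^sub>F F in finite_subsets_at_top UNIV. (\<Sum>i\<in>F. ket i (ell2_apply f i)) \<in> C"
    by (rule eventually_finite_subsets_at_top_weakI) (rule F)
qed

lemma norm_adj_le: "clinear_op T \<Longrightarrow> norm (adj T) \<le> norm T"
proof (rule norm_blinfun_bound)
  fix y assume T: "clinear_op T"
  have "(norm (adj T y))\<^sup>2 = cmod (cinner (T (adj T y)) y)"
    unfolding cinner_adj[OF T] by (simp add: cinner_self norm_power)
  also have "\<dots> \<le> norm (T (adj T y)) * norm y" by (rule cauchy_schwarz)
  also have "\<dots> \<le> (norm T * norm (adj T y)) * norm y" by (intro mult_right_mono norm_blinfun) simp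
  finally show "norm (adj T y) \<le> norm T * norm y"
    by (cases "adj T y = 0") (auto simp: power2_eq_square mult_ac)
qed simp

lemma adj_sum: "(\<And>i. i \<in> I \<Longrightarrow> clinear_op (f i)) \<Longrightarrow> adj (sum f I) = (\<Sum>i\<in>I. adj (f i))"
  by (rule adj_eqI) (simp add: blinfun.sum_left cinner_sum_left cinner_sum_right cinner_adj)

text \<open>Makes the first series of \<open>rho_kernel\<close> the termwise adjoint of the second,
  so that only creation parts have to be estimated.\<close>

lemma tensor_op_adj:
  fixes X :: "'h::chilbert_space \<Rightarrow>\<^sub>L 'h" and S :: "('i, complex) ell2 \<Rightarrow>\<^sub>L ('i, complex) ell2"
  assumes X: "clinear_op X" and S: "clinear_op S"
  shows "tensor_op X (adj S) = adj (tensor_op (adj X) S)"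
proof (rule tensor_op_eqI, rule ell2_eq_cinner_ketI)
  fix x f i y
  have "cinner (adj (tensor_op (adj X) S) (tensor_vec x f)) (tensor_vec y (ket i 1))
      = cinner x (adj X y) * cinner f (S (ket i 1))"
    by (simp add: cinner_adj_left tensor_op clinear_adj X S cinner_tensor_vec)
  also have "\<dots> = cinner (tensor_vec (X x) (adj S f)) (tensor_vec y (ket i 1))"
    by (simp add: cinner_tensor_vec cinner_adj X cinner_adj_left S)
  finally show "cinner (adj (tensor_op (adj X) S) (tensor_vec x f)) (ket i y)
      = cinner (tensor_vec (X x) (adj S f)) (ket i y)" by (simp only: tensor_vec_ket)
qed

lemma tensor_op_id: "tensor_op id_blinfun id_blinfun = id_blinfun"
  by (rule tensor_op_eqI) simp

section \<open>Homogeneous parts of the kernel and their convergence\<close>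

definition creation_level ::
  "('n::finite \<Rightarrow> ('h::chilbert_space \<Rightarrow>\<^sub>L 'h)) \<Rightarrow> nat \<Rightarrow> (('n list, 'h) ell2 \<Rightarrow>\<^sub>L ('n list, 'h) ell2)" where
  "creation_level T k = (\<Sum>\<alpha> | length \<alpha> = k. tensor_op (adj (word_op T \<alpha>)) (word_op right_creation (rev \<alpha>)))"

context
  fixes T :: "'n::finite \<Rightarrow> ('h::chilbert_space \<Rightarrow>\<^sub>L 'h)"
  assumes T: "\<And>i. clinear_op (T i)"
begin

lemma clinear_creation_level: "clinear_op (creation_level T k)"
  unfolding creation_level_def
  by (intro clinear_op_sum tensor_op(2) clinear_adj clinear_word_op clinear_right_creation T)

lemma creation_level_ket:
  "creation_level T k (ket \<beta> x) = (\<Sum>\<alpha> | length \<alpha> = k. ket (\<beta> @ \<alpha>) (adj (word_op T \<alpha>) x))"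
proof -
  have "tensor_op (adj (word_op T \<alpha>)) (word_op right_creation (rev \<alpha>)) (tensor_vec x (ket \<beta> 1))
      = tensor_vec (adj (word_op T \<alpha>) x) (ket (\<beta> @ \<alpha>) 1)" for \<alpha>
    by (simp add: tensor_op clinear_adj clinear_word_op clinear_right_creation T word_op_right_creation_ket)
  then show ?thesis by (simp add: creation_level_def blinfun.sum_left tensor_vec_ket)
qed

lemma adj_creation_level:
  "adj (creation_level T k) = (\<Sum>\<alpha> | length \<alpha> = k. tensor_op (word_op T \<alpha>) (adj (word_op right_creation (rev \<alpha>))))"
  unfolding creation_level_def
  by (simp add: adj_sum tensor_op(2) clinear_adj clinear_word_op clinear_right_creation T tensor_op_adj)

lemma cinner_creation_level_append:
  "cinner (creation_level T k (ket \<beta> x)) (ket (\<beta> @ \<gamma>) y)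
     = (if length \<gamma> = k then cinner (adj (word_op T \<gamma>) x) y else 0)"
proof -
  have "cinner (creation_level T k (ket \<beta> x)) (ket (\<beta> @ \<gamma>) y)
      = (\<Sum>\<alpha>\<in>{\<alpha>::'n list. length \<alpha> = k}. if \<alpha> = \<gamma> then cinner (adj (word_op T \<alpha>) x) y else 0)"
    unfolding creation_level_ket cinner_sum_left cinner_ket_left ket_apply
    by (rule sum.cong) simp_all
  also have "\<dots> = (if \<gamma> \<in> {\<alpha>::'n list. length \<alpha> = k} then cinner (adj (word_op T \<gamma>) x) y else 0)"
    by (rule sum.delta) (rule finite_words_length)
  finally show ?thesis unfolding mem_Collect_eq .
qed

lemma cinner_creation_level_eq_0:
  "\<nexists>\<gamma>. \<alpha> = \<beta> @ \<gamma> \<and> length \<gamma> = k \<Longrightarrow> cinner (creation_level T k (ket \<beta> x)) (ket \<alpha> y) = 0"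
  unfolding creation_level_ket cinner_sum_left
  by (intro sum.neutral) (auto simp: cinner_ket_left ket_apply)

text \<open>For fixed length \<open>k\<close> the word \<open>\<beta> @ \<alpha>\<close> determines
  both \<beta> and \<alpha>, so the images of the basis components are orthogonal and the squared
  norm is a sum of levels. This ties convergence of the kernel to the spectral radius.\<close>

lemma norm_creation_level: "norm (creation_level T k) \<le> sqrt (row_norm T k)"
proof (rule norm_blinfun_bound)
  fix f
  let ?c = "sqrt (row_norm T k)"
  have "f \<in> {f. norm (creation_level T k f) \<le> ?c * norm f}"
  proof (rule ell2_in_closed)
    show "closed {f. norm (creation_level T k f) \<le> ?c * norm f}"
      by (intro closed_Collect_le continuous_intros)
    fix F :: "'n list set" assume F: "finite F"
    let ?g = "\<Sum>i\<in>F. ket i (ell2_apply f i)"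
    have "creation_level T k ?g = (\<Sum>(\<beta>, \<alpha>)\<in>F \<times> {\<alpha>. length \<alpha> = k}. ket (\<beta> @ \<alpha>) (adj (word_op T \<alpha>) (ell2_apply f \<beta>)))"
      by (simp add: blinfun.sum_right creation_level_ket sum.cartesian_product)
    also have "(norm \<dots>)\<^sup>2 = (\<Sum>(\<beta>, \<alpha>)\<in>F \<times> {\<alpha>. length \<alpha> = k}. (norm (adj (word_op T \<alpha>) (ell2_apply f \<beta>)))\<^sup>2)"
      using norm_sum_ket[of "F \<times> {\<alpha>. length \<alpha> = k}" "\<lambda>(\<beta>, \<alpha>). \<beta> @ \<alpha>" "\<lambda>(\<beta>, \<alpha>). adj (word_op T \<alpha>) (ell2_apply f \<beta>)"] F
      by (auto simp: case_prod_unfold inj_on_def)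
    also have "\<dots> = (\<Sum>\<beta>\<in>F. lev T k (ell2_apply f \<beta>))"
      by (simp add: lev_def sum.cartesian_product)
    also have "\<dots> \<le> row_norm T k * (\<Sum>\<beta>\<in>F. (norm (ell2_apply f \<beta>))\<^sup>2)"
      unfolding sum_distrib_left by (intro sum_mono lev_le_row_norm T)
    also have "\<dots> = (?c * norm ?g)\<^sup>2"
      using norm_sum_ket[OF F, of "\<lambda>i. i" "ell2_apply f"] by (simp add: power_mult_distrib row_norm_def)
    finally show "?g \<in> {f. norm (creation_level T k f) \<le> ?c * norm f}"
      using power2_le_imp_le[of "norm (creation_level T k ?g)" "?c * norm ?g"] by (simp add: row_norm_def)
  qed
  then show "norm (creation_level T k f) \<le> ?c * norm f" by simp
qed (simp add: row_norm_def)

definition kernel_term :: "nat \<Rightarrow> (('n list, 'h) ell2 \<Rightarrow>\<^sub>L ('n list, 'h) ell2)" where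
  "kernel_term k = creation_level T (Suc k) + adj (creation_level T (Suc k))"

text \<open>\<open>kernel_op \<rho> s\<close> is \<open>P\<^sub>\<rho>(s T, R)\<close>; values \<open>s > 1\<close> will be needed.\<close>

definition kernel_op :: "real \<Rightarrow> real \<Rightarrow> (('n list, 'h) ell2 \<Rightarrow>\<^sub>L ('n list, 'h) ell2)" where
  "kernel_op \<rho> s = \<rho> *\<^sub>R id_blinfun + (\<Sum>k. s ^ Suc k *\<^sub>R kernel_term k)"

lemma selfadjoint_kernel_term: "selfadjoint_op (kernel_term k)"
  unfolding selfadjoint_op_def kernel_term_def
  by (simp add: clinear_op_add clinear_adj clinear_creation_level blinfun.add_left cinner_add_left
      cinner_add_right cinner_adj adj_adj add.commute)

lemma norm_kernel_term: "norm (kernel_term k) \<le> 2 * sqrt (row_norm T (Suc k))"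
  using norm_triangle_ineq[of "creation_level T (Suc k)" "adj (creation_level T (Suc k))"]
    norm_adj_le[OF clinear_creation_level, of "Suc k"] norm_creation_level[of "Suc k"]
  unfolding kernel_term_def by linarith

text \<open>A point beyond 1 where the majorant of the kernel converges; a fixed \<open>s0\<close>
  of this kind makes the kernel of s T available for all 0 \<le> s \<le> s0.\<close>

definition kernel_radius :: "real \<Rightarrow> bool" where
  "kernel_radius s \<longleftrightarrow> 1 < s \<and> summable (\<lambda>k. 2 * sqrt (row_norm T (Suc k)) * s ^ k)"

lemma kernel_radius_exists:
  assumes "joint_spectral_radius T < 1"
  shows "\<exists>s. kernel_radius s"
proof -
  obtain q where q: "q < 1" "0 < q" "\<forall>\<^sub>F k in sequentially. sqrt (row_norm T k) \<le> q ^ k"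
    using joint_spectral_radius_less_1D[of T, OF T assms] by blast
  \<comment> \<open>Halfway between 1 and 1/q on the multiplicative scale: s > 1, while s q = sqrt q
    is still below 1.\<close>
  define s where "s = 1 / sqrt q"
  have s: "s > 1" "s * q = sqrt q" using q by (auto simp: s_def real_div_sqrt)
  have "summable (\<lambda>k. (2 * q) * sqrt q ^ k)"
    using q by (intro summable_mult summable_geometric) simp
  moreover have "\<forall>\<^sub>F k in sequentially. norm (2 * sqrt (row_norm T (Suc k)) * s ^ k) \<le> (2 * q) * sqrt q ^ k"
    using q(3)[unfolded eventually_sequentially_Suc[of "\<lambda>k. sqrt (row_norm T k) \<le> q ^ k", symmetric]]
  proof eventually_elim
    case (elim k)
    have "norm (2 * sqrt (row_norm T (Suc k)) * s ^ k) \<le> 2 * q ^ Suc k * s ^ k"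
      using elim s by (simp add: row_norm_def abs_mult mult_right_mono)
    also have "\<dots> = (2 * q) * (s * q) ^ k" by (simp add: power_mult_distrib)
    finally show ?case unfolding s(2) .
  qed
  ultimately have "summable (\<lambda>k. 2 * sqrt (row_norm T (Suc k)) * s ^ k)"
    by (rule summable_comparison_test_ev[rotated])
  then show ?thesis using s by (auto simp: kernel_radius_def)
qed

context
  fixes s0 assumes s0: "kernel_radius s0"
begin

lemma summable_kernel_bound:
  assumes "0 \<le> s" "s \<le> s0"
  shows "summable (\<lambda>k. 2 * sqrt (row_norm T (Suc k)) * s ^ k)"
proof (rule summable_comparison_test')
  show "summable (\<lambda>k. 2 * sqrt (row_norm T (Suc k)) * s0 ^ k)"
    using s0 by (simp add: kernel_radius_def)
  fix k
  have "norm (2 * sqrt (row_norm T (Suc k)) * s ^ k) = 2 * sqrt (row_norm T (Suc k)) * s ^ k"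
    using assms row_norm_nonneg[of T "Suc k"] by (simp add: abs_mult)
  also have "\<dots> \<le> 2 * sqrt (row_norm T (Suc k)) * s0 ^ k"
    using assms row_norm_nonneg[of T "Suc k"] by (intro mult_left_mono power_mono) auto
  finally show "norm (2 * sqrt (row_norm T (Suc k)) * s ^ k) \<le> 2 * sqrt (row_norm T (Suc k)) * s0 ^ k" .
qed

lemma summable_kernel_term:
  assumes "0 \<le> s" "s \<le> s0"
  shows "summable (\<lambda>k. s ^ Suc k *\<^sub>R kernel_term k)"
proof (rule summable_comparison_test')
  show "summable (\<lambda>k. s * (2 * sqrt (row_norm T (Suc k)) * s ^ k))"
    by (intro summable_mult summable_kernel_bound assms)
  show "norm (s ^ Suc k *\<^sub>R kernel_term k) \<le> s * (2 * sqrt (row_norm T (Suc k)) * s ^ k)" for k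
    using mult_left_mono[OF norm_kernel_term[of k], of "s ^ Suc k"] assms by (simp add: mult_ac)
qed

lemma selfadjoint_kernel_op:
  assumes s: "0 \<le> s" "s \<le> s0"
  shows "selfadjoint_op (kernel_op \<rho> s)"
proof -
  have "selfadjoint_op (\<Sum>k<n. s ^ Suc k *\<^sub>R kernel_term k)" for n
    by (induction n) (auto intro: selfadjoint_op_add selfadjoint_op_scaleR selfadjoint_kernel_term)
  then have "selfadjoint_op (\<Sum>k. s ^ Suc k *\<^sub>R kernel_term k)"
    using closed_sequentially[OF closed_selfadjoint_op, of "\<lambda>n. \<Sum>k<n. s ^ Suc k *\<^sub>R kernel_term k"]
      summable_LIMSEQ[OF summable_kernel_term[OF s]] by simp
  then show ?thesis unfolding kernel_op_def
    by (intro selfadjoint_op_add selfadjoint_op_scaleR) simp_all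
qed

text \<open>Only the degree equal to the difference of the lengths contributes, so the series has at
  most one nonzero term. Its index is \<open>length \<gamma> - 1\<close> because
  \<open>kernel_term 0\<close> has degree 1.\<close>

lemma kernel_op_ket:
  assumes s: "0 \<le> s" "s \<le> s0"
  shows "cinner (kernel_op \<rho> s (ket \<beta> x)) (ket \<alpha> y) = cinner (toeplitz_kernel \<rho> (\<lambda>i. s *\<^sub>R T i) \<alpha> \<beta> x) y"
proof -
  define u where "u k = cinner (creation_level T (Suc k) (ket \<beta> x)) (ket \<alpha> y)" for k
  define v where "v k = cinner (ket \<beta> x) (creation_level T (Suc k) (ket \<alpha> y))" for k
  have v: "v k = cnj (cinner (creation_level T (Suc k) (ket \<alpha> y)) (ket \<beta> x))" for k
    unfolding v_def by (rule cinner_commute)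
  have bl: "bounded_linear (\<lambda>Z :: ('n list, 'h) ell2 \<Rightarrow>\<^sub>L ('n list, 'h) ell2. cinner (Z (ket \<beta> x)) (ket \<alpha> y))"
    by (rule bounded_linear_compose[OF bounded_linear_cinner_left blinfun.bounded_linear_left])
  have "cinner ((\<Sum>k. s ^ Suc k *\<^sub>R kernel_term k) (ket \<beta> x)) (ket \<alpha> y) = (\<Sum>k. complex_of_real (s ^ Suc k) * (u k + v k))"
    unfolding bounded_linear.suminf[OF bl summable_kernel_term[OF s]] u_def v_def
    by (simp add: kernel_term_def blinfun.scaleR_left blinfun.add_left cinner_scaleR_left cinner_add_left
        cinner_adj_left clinear_creation_level)
  then have main: "cinner (kernel_op \<rho> s (ket \<beta> x)) (ket \<alpha> y)
      = complex_of_real \<rho> * cinner (ket \<beta> x) (ket \<alpha> y) + (\<Sum>k. complex_of_real (s ^ Suc k) * (u k + v k))"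
    by (simp add: kernel_op_def blinfun.add_left blinfun.scaleR_left cinner_add_left cinner_scaleR_left)
  have ket: "cinner (ket \<beta> x) (ket \<alpha> y) = (if \<alpha> = \<beta> then cinner x y else 0)"
    by (simp add: cinner_ket_left ket_apply)
  have ps: "adj (word_op (\<lambda>i. s *\<^sub>R T i) \<gamma>) = s ^ length \<gamma> *\<^sub>R adj (word_op T \<gamma>)" for \<gamma>
    by (simp add: word_op_scaleR adj_scaleR clinear_word_op T)
  consider "\<alpha> = \<beta>" | \<gamma> where "\<gamma> \<noteq> []" "\<alpha> = \<beta> @ \<gamma>" | \<gamma> where "\<gamma> \<noteq> []" "\<beta> = \<alpha> @ \<gamma>"
    | "\<nexists>\<gamma>. \<beta> = \<alpha> @ \<gamma>" "\<nexists>\<gamma>. \<alpha> = \<beta> @ \<gamma>" by (metis append_Nil2)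
  then show ?thesis
  proof cases
    case 1
    have "u k = 0" "v k = 0" for k
      unfolding u_def v using cinner_creation_level_append[of "Suc k" \<beta> _ "[]"] 1 by simp_all
    then show ?thesis unfolding main ket using 1 toeplitz_kernel_append[of \<rho> "\<lambda>i. s *\<^sub>R T i" \<alpha> "[]"]
      by (simp add: blinfun.scaleR_left cinner_scaleR_left)
  next
    case (2 \<gamma>)
    have u: "u k = (if length \<gamma> = Suc k then cinner (adj (word_op T \<gamma>) x) y else 0)" for k
      unfolding u_def 2(2) by (rule cinner_creation_level_append)
    have "v k = 0" for k unfolding v by (subst cinner_creation_level_eq_0) (use 2 in auto)
    then have "(\<Sum>k. complex_of_real (s ^ Suc k) * (u k + v k)) = (\<Sum>k\<in>{length \<gamma> - 1}. complex_of_real (s ^ Suc k) * (u k + v k))"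
      by (intro suminf_finite) (auto simp: u)
    also have "\<dots> = complex_of_real (s ^ length \<gamma>) * cinner (adj (word_op T \<gamma>) x) y"
      using 2(1) \<open>\<And>k. v k = 0\<close> by (cases \<gamma>) (auto simp: u)
    finally show ?thesis unfolding main ket using 2
      by (simp add: toeplitz_kernel_append_left ps blinfun.scaleR_left cinner_scaleR_left)
  next
    case (3 \<gamma>)
    have v': "v k = (if length \<gamma> = Suc k then cinner (word_op T \<gamma> x) y else 0)" for k
      unfolding v 3(2) cinner_creation_level_append
      by (simp add: cinner_adj clinear_word_op T cinner_commute[of "adj _ y" x])
    have "u k = 0" for k unfolding u_def by (rule cinner_creation_level_eq_0) (use 3 in auto)
    then have "(\<Sum>k. complex_of_real (s ^ Suc k) * (u k + v k)) = (\<Sum>k\<in>{length \<gamma> - 1}. complex_of_real (s ^ Suc k) * (u k + v k))"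
      by (intro suminf_finite) (auto simp: v')
    also have "\<dots> = complex_of_real (s ^ length \<gamma>) * cinner (word_op T \<gamma> x) y"
      using 3(1) \<open>\<And>k. u k = 0\<close> by (cases \<gamma>) (auto simp: v')
    finally show ?thesis unfolding main ket using 3
      by (simp add: toeplitz_kernel_append word_op_scaleR blinfun.scaleR_left cinner_scaleR_left)
  next
    case 4
    have "u k = 0" for k unfolding u_def by (rule cinner_creation_level_eq_0) (use 4 in auto)
    moreover have "v k = 0" for k unfolding v by (subst cinner_creation_level_eq_0) (use 4 in auto)
    moreover have "\<alpha> \<noteq> \<beta>" using 4 by auto
    ultimately show ?thesis unfolding main ket using 4 by (simp add: toeplitz_kernel_eq_0)
  qed
qed

lemma rho_kernel_eq: "rho_kernel \<rho> T = kernel_op \<rho> 1"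
proof -
  have s1: "1 \<le> s0" using s0 by (simp add: kernel_radius_def)
  have sb: "summable (\<lambda>k. 2 * sqrt (row_norm T (Suc k)) * 1 ^ k)"
    by (rule summable_kernel_bound) (use s1 in auto)
  have le: "norm (creation_level T (Suc k)) \<le> 2 * sqrt (row_norm T (Suc k)) * 1 ^ k" for k
    using norm_creation_level[of "Suc k"] real_sqrt_ge_zero[OF row_norm_nonneg[of T "Suc k"]]
    unfolding power_one mult_1_right by linarith
  have "summable (\<lambda>k. creation_level T (Suc k))"
    by (rule summable_comparison_test'[OF sb le])
  moreover have "summable (\<lambda>k. adj (creation_level T (Suc k)))"
    by (rule summable_comparison_test'[OF sb order_trans[OF norm_adj_le[OF clinear_creation_level] le]])
  ultimately show ?thesis
    unfolding rho_kernel_def kernel_op_def kernel_term_def tensor_op_id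
    by (simp add: adj_creation_level[symmetric] creation_level_def[symmetric] suminf_add[symmetric])
qed

text \<open>The norm of the difference is at most h s - h 1 for a scalar power series
  \<open>h\<close>, which is continuous at 1 because it converges at \<open>s0\<close> > 1.\<close>

lemma kernel_op_continuous_at_1:
  assumes e: "e > 0"
  shows "\<exists>s. 1 < s \<and> s \<le> s0 \<and> norm (kernel_op \<rho> s - kernel_op \<rho> 1) \<le> e"
proof -
  define c where "c k = 2 * sqrt (row_norm T (Suc k))" for k
  define h where "h s = s * (\<Sum>k. c k * s ^ k)" for s :: real
  have s1: "1 < s0" and sm: "summable (\<lambda>k. c k * s0 ^ k)" using s0 by (simp_all add: kernel_radius_def c_def)
  have "isCont h 1"
    unfolding h_def by (intro continuous_intros isCont_powser[OF sm]) (use s1 in auto)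
  then have "(h \<longlongrightarrow> h 1) (at_right 1)"
    unfolding isCont_def by (rule tendsto_mono[rotated]) (simp add: at_le)
  then have "\<forall>\<^sub>F s in at_right 1. h s < h 1 + e"
    using e by (intro order_tendstoD) auto
  moreover have "\<forall>\<^sub>F s in at_right 1. s \<in> {1<..<s0}"
    using s1 by (rule eventually_at_right_real)
  ultimately have "\<forall>\<^sub>F s in at_right 1. h s < h 1 + e \<and> s \<in> {1<..<s0}" by (rule eventually_conj)
  then obtain s where s: "h s < h 1 + e" "1 < s" "s < s0"
    using eventually_happens'[of "at_right (1::real)"] by auto
  have sk: "summable (\<lambda>k. c k * t ^ k)" if "0 \<le> t" "t \<le> s0" for t
    using summable_kernel_bound[OF that] by (simp add: c_def)
  have ht: "h t = (\<Sum>k. c k * t ^ Suc k)" if "0 \<le> t" "t \<le> s0" for t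
    unfolding h_def suminf_mult[OF sk[OF that], symmetric] by (simp add: mult_ac)
  have sk': "summable (\<lambda>k. c k * t ^ Suc k)" if "0 \<le> t" "t \<le> s0" for t
    using summable_mult[OF sk[OF that], of t] by (simp add: mult_ac)
  have "kernel_op \<rho> s - kernel_op \<rho> 1 = (\<Sum>k. (s ^ Suc k - 1) *\<^sub>R kernel_term k)"
    unfolding kernel_op_def
    using suminf_diff[OF summable_kernel_term[of s] summable_kernel_term[of 1]] s
    by (simp add: scaleR_diff_left)
  also have "norm \<dots> \<le> (\<Sum>k. c k * s ^ Suc k - c k * 1 ^ Suc k)"
  proof (rule norm_suminf_le)
    show "norm ((s ^ Suc k - 1) *\<^sub>R kernel_term k) \<le> c k * s ^ Suc k - c k * 1 ^ Suc k" for k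
    proof -
      have d: "0 \<le> s ^ Suc k - 1" using one_le_power[of s "Suc k"] s by simp
      then have "norm ((s ^ Suc k - 1) *\<^sub>R kernel_term k) = (s ^ Suc k - 1) * norm (kernel_term k)" by simp
      also have "\<dots> \<le> (s ^ Suc k - 1) * c k"
        unfolding c_def by (intro mult_left_mono norm_kernel_term d)
      also have "\<dots> = c k * s ^ Suc k - c k * 1 ^ Suc k" by (simp only: power_one mult_1_right right_diff_distrib mult.commute[of _ "c k"])
      finally show ?thesis .
    qed
    show "summable (\<lambda>k. c k * s ^ Suc k - c k * 1 ^ Suc k)"
      by (intro summable_diff sk') (use s in auto)
  qed
  also have "\<dots> = h s - h 1"
    using suminf_diff[OF sk'[of s] sk'[of 1]] ht[of s] ht[of 1] s by simp
  finally show ?thesis using s by (intro exI[of _ s]) auto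
qed

lemma toeplitz_form_kernel_op:
  assumes s: "0 \<le> s" "s \<le> s0"
  shows "cinner (kernel_op \<rho> s (\<Sum>\<alpha>\<in>words_upto N. ket \<alpha> (h \<alpha>))) (\<Sum>\<alpha>\<in>words_upto N. ket \<alpha> (h \<alpha>))
    = toeplitz_form \<rho> (\<lambda>i. s *\<^sub>R T i) N h"
  unfolding toeplitz_form_def blinfun.sum_right cinner_sum_left cinner_sum_right
  by (simp add: kernel_op_ket[OF s])

lemma kernel_op_lower_bound:
  assumes low: "\<And>N h. a * (\<Sum>\<alpha>\<in>words_upto N. (norm (h \<alpha>))\<^sup>2) \<le> Re (toeplitz_form \<rho> T N h)"
  shows "a * (norm f)\<^sup>2 \<le> Re (cinner (kernel_op \<rho> 1 f) f)"
proof -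
  have "f \<in> {f. a * (norm f)\<^sup>2 \<le> Re (cinner (kernel_op \<rho> 1 f) f)}"
  proof (rule ell2_in_closed)
    show "closed {f. a * (norm f)\<^sup>2 \<le> Re (cinner (kernel_op \<rho> 1 f) f)}"
      by (intro closed_Collect_le continuous_intros)
    fix F :: "'n list set" assume F: "finite F"
    \<comment> \<open>Any finite support lies in some \<open>words_upto N\<close>, with zeros filled
      in; \<open>insert 0\<close> covers the empty support.\<close>
    define N where "N = Max (insert 0 (length ` F))"
    have FN: "F \<subseteq> words_upto N" using F by (auto simp: words_upto_def N_def intro!: Max_ge)
    define h where "h \<alpha> = (if \<alpha> \<in> F then ell2_apply f \<alpha> else 0)" for \<alpha>
    have eq: "(\<Sum>\<alpha>\<in>F. ket \<alpha> (ell2_apply f \<alpha>)) = (\<Sum>\<alpha>\<in>words_upto N. ket \<alpha> (h \<alpha>))"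
      using FN by (intro sum.mono_neutral_cong_left) (auto simp: h_def)
    have "1 \<le> s0" using s0 by (simp add: kernel_radius_def)
    then have "cinner (kernel_op \<rho> 1 (\<Sum>\<alpha>\<in>words_upto N. ket \<alpha> (h \<alpha>))) (\<Sum>\<alpha>\<in>words_upto N. ket \<alpha> (h \<alpha>))
        = toeplitz_form \<rho> T N h" using toeplitz_form_kernel_op[of 1] by simp
    moreover have "(norm (\<Sum>\<alpha>\<in>words_upto N. ket \<alpha> (h \<alpha>)))\<^sup>2 = (\<Sum>\<alpha>\<in>words_upto N. (norm (h \<alpha>))\<^sup>2)"
      using norm_sum_ket[of "words_upto N" "\<lambda>i. i" h] by simp
    ultimately show "(\<Sum>\<alpha>\<in>F. ket \<alpha> (ell2_apply f \<alpha>)) \<in> {f. a * (norm f)\<^sup>2 \<le> Re (cinner (kernel_op \<rho> 1 f) f)}"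
      unfolding eq using low[where N=N and h=h] by simp
  qed
  then show ?thesis by simp
qed

end

end

section \<open>Positive polynomials at isometries\<close>

text \<open>A finite maximal orthonormal set would span: subtracting the finite Fourier expansion
  from a vector leaves something orthogonal to the whole set.\<close>

lemma orthonormal_sequence_exists:
  assumes K: "\<not> (\<exists>S :: 'k::chilbert_space set. finite S \<and> cspan S = UNIV)"
  shows "\<exists>u :: nat \<Rightarrow> 'k. orthonormal_on UNIV u"
proof -
  obtain E :: "'k set" where E: "orthonormal_on E (\<lambda>e. e)" and Emax: "\<And>x. (\<forall>e\<in>E. cinner x e = 0) \<Longrightarrow> x = 0"
    using maximal_orthonormal[of UNIV] by auto
  have "infinite E"
  proof
    assume fin: "finite E"
    have "x \<in> cspan E" for x
    proof -
      define y where "y = (\<Sum>e\<in>E. cinner x e *\<^sub>C e)"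
      have "cinner (x - y) f = 0" if f: "f \<in> E" for f
      proof -
        have "cinner y f = (\<Sum>e\<in>E. if e = f then cinner x f else 0)"
          unfolding y_def cinner_sum_left cinner_scaleC_left
          by (intro sum.cong refl) (use E f in \<open>auto simp: orthonormal_on_def\<close>)
        then show ?thesis using fin f by (simp add: cinner_diff_left)
      qed
      then have "x - y = 0" by (intro Emax) blast
      moreover have "y \<in> cspan E"
        unfolding y_def by (intro complex_vector.span_sum complex_vector.span_scale complex_vector.span_base)
      ultimately show ?thesis by simp
    qed
    then show False using K fin by blast
  qed
  then obtain u :: "nat \<Rightarrow> 'k" where u: "inj u" "range u \<subseteq> E"
    using infinite_countable_subset by blast
  have "orthonormal_on UNIV u"
    unfolding orthonormal_on_def
  proof (intro ballI)
    fix i j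
    have "u i \<in> E" "u j \<in> E" using u(2) by auto
    then show "cinner (u i) (u j) = (if i = j then 1 else 0)"
      using E u(1) by (simp add: orthonormal_on_def inj_eq)
  qed
  then show ?thesis by blast
qed

text \<open>Instead of Gram-Schmidt: take a maximal orthonormal set in the double orthogonal
  complement of \<open>Z\<close>. Each of its elements is non-orthogonal to some vector of
  \<open>Z\<close>, and by Bessel each such vector sees only countably many of them.\<close>

lemma countable_orthonormal_basis:
  fixes Z :: "'g::chilbert_space set"
  assumes Z: "countable Z"
  shows "\<exists>E. countable E \<and> orthonormal_on E (\<lambda>e. e) \<and> (\<forall>z\<in>Z. orth_map E (\<lambda>e. e) (\<lambda>e. e) z = z)"
proof -
  define M where "M = {x. \<forall>z. (\<forall>v\<in>Z. cinner v z = 0) \<longrightarrow> cinner x z = 0}"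
  have "c *\<^sub>C x \<in> M" if "x \<in> M" for c x using that by (simp add: M_def cinner_scaleC_left)
  then obtain E where EM: "E \<subseteq> M" and E: "orthonormal_on E (\<lambda>e. e)"
    and Emax: "\<And>x. x \<in> M \<Longrightarrow> (\<forall>e\<in>E. cinner x e = 0) \<Longrightarrow> x = 0"
    using maximal_orthonormal[of M] by blast
  have "E \<subseteq> (\<Union>v\<in>Z. {e \<in> E. (cmod (cinner v e))\<^sup>2 \<noteq> 0})"
  proof
    fix e assume e: "e \<in> E"
    have "cinner e e \<noteq> 0" using E e by (simp add: orthonormal_on_def)
    moreover have "e \<in> M" using e EM by blast
    ultimately have "\<exists>v\<in>Z. cinner v e \<noteq> 0" unfolding M_def by blast
    then show "e \<in> (\<Union>v\<in>Z. {e \<in> E. (cmod (cinner v e))\<^sup>2 \<noteq> 0})" using e by auto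
  qed
  moreover have "countable (\<Union>v\<in>Z. {e \<in> E. (cmod (cinner v e))\<^sup>2 \<noteq> 0})"
    by (intro countable_UN Z summable_countable_real bessel_summable E)
  ultimately have "countable E" by (rule countable_subset)
  moreover have "orth_map E (\<lambda>e. e) (\<lambda>e. e) z = z" if z: "z \<in> Z" for z
  proof -
    let ?y = "orth_map E (\<lambda>e. e) (\<lambda>e. e) z"
    have "cinner ?y w = 0" if "\<forall>v\<in>Z. cinner v w = 0" for w
      by (rule cinner_orth_map_eq_0[OF E E]) (use EM that in \<open>auto simp: M_def\<close>)
    then have "z - ?y \<in> M" using z by (simp add: M_def cinner_diff_left)
    moreover have "\<forall>e\<in>E. cinner (z - ?y) e = 0"
      using cinner_orth_map_base[OF E E] by (simp add: cinner_diff_left)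
    ultimately have "z - ?y = 0" by (rule Emax)
    then show ?thesis by simp
  qed
  ultimately show ?thesis using E by blast
qed

lemma norm_orth_map_le:
  assumes a: "orthonormal_on E a" and b: "orthonormal_on E b"
  shows "norm (orth_map E a b x) \<le> norm x"
proof -
  have "(norm (orth_map E a b x))\<^sup>2 \<le> (norm x)\<^sup>2"
    unfolding norm_orth_map[OF a b] by (rule bessel[OF a])
  then show ?thesis by (rule power2_le_imp_le) simp
qed

text \<open>The finitely many vectors involved generate a separable subspace invariant under all \<open>W i\<close>; a
  partial isometry \<open>T\<close> carries it into \<open>'k\<close>, where \<open>r T W\<^sub>i T\<^sup>*\<close> is a strict row contraction.\<close>

lemma poly_form_isometries_nonneg:
  fixes K :: "'k::chilbert_space itself" and W :: "'n::finite \<Rightarrow> ('g::chilbert_space \<Rightarrow>\<^sub>L 'g)"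
  assumes K: "\<not> (\<exists>S :: 'k set. finite S \<and> cspan S = UNIV)" and p: "positive_poly K m p"
    and W: "\<And>i. isometry_op (W i)" and orth: "\<And>i j x y. i \<noteq> j \<Longrightarrow> cinner (W i x) (W j y) = 0"
  shows "0 \<le> Re (poly_form m p W x)"
proof -
  have cW: "clinear_op (W i)" and nW: "norm (W i y) = norm y" for i y using W by (simp_all add: isometry_op_def)
  \<comment> \<open>The orbit of the vectors \<open>x j\<close> under all words; it is countable
    because words over a finite alphabet and indices are.\<close>
  define Z where "Z = (\<lambda>(\<alpha>, j). word_op W \<alpha> (x j)) ` UNIV"
  have Z: "word_op W \<alpha> (x j) \<in> Z" for \<alpha> j unfolding Z_def by (rule image_eqI[of _ _ "(\<alpha>, j)"]) auto
  have "countable Z" unfolding Z_def by simp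
  then obtain E where cE: "countable E" and E: "orthonormal_on E (\<lambda>e. e)"
    and EZ: "\<And>z. z \<in> Z \<Longrightarrow> orth_map E (\<lambda>e. e) (\<lambda>e. e) z = z"
    using countable_orthonormal_basis by metis
  obtain u0 :: "nat \<Rightarrow> 'k" where u0: "orthonormal_on UNIV u0" using orthonormal_sequence_exists[OF K] by blast
  define u where "u e = u0 (to_nat_on E e)" for e
  have u: "orthonormal_on E u"
    using u0 cE by (simp add: orthonormal_on_def u_def inj_on_eq_iff[OF inj_on_to_nat_on])
  define T where "T = Blinfun (orth_map E (\<lambda>e. e) u)"
  define T' where "T' = Blinfun (orth_map E u (\<lambda>e. e))"
  have T: "T y = orth_map E (\<lambda>e. e) u y" for y
    unfolding T_def by (simp add: bounded_linear_Blinfun_apply bounded_linear_orth_map[OF E u])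
  have T': "T' y = orth_map E u (\<lambda>e. e) y" for y
    unfolding T'_def by (simp add: bounded_linear_Blinfun_apply bounded_linear_orth_map[OF u E])
  have cT: "clinear_op T" "clinear_op T'"
    by (simp_all add: clinear_op_def T T' scaleC_orth_map[OF E u] scaleC_orth_map[OF u E])
  have aT: "adj T = T'"
    by (rule adj_eqI) (simp add: T T' cinner_orth_map_adj[OF E u])
  have aT': "adj T' = T" using adj_adj[OF cT(1)] by (simp add: aT)
  have T'T: "T' (T z) = z" if "z \<in> Z" for z
  proof -
    have "T' (T z) = (\<Sum>\<^sub>\<infinity>e\<in>E. cinner z e *\<^sub>C e)"
      unfolding T' orth_map_def[of E u] by (intro infsum_cong) (simp add: T cinner_orth_map_base[OF E u])
    then show ?thesis using EZ[OF that] by (simp add: orth_map_def)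
  qed
  have scaled: "0 \<le> Re (poly_form m p (\<lambda>i. r *\<^sub>R W i) x)" if r: "0 < r" "r < 1" for r
  proof -
    define X where "X i = r *\<^sub>R (T o\<^sub>L W i o\<^sub>L T')" for i
    have cX: "clinear_op (X i)" for i
      unfolding X_def by (intro clinear_op_scaleR clinear_op_compose cT cW)
    have aX: "adj (X i) y = r *\<^sub>R T (adj (W i) (T' y))" for i y
      by (simp add: X_def adj_scaleR adj_compose clinear_op_compose cT cW aT aT' blinfun.scaleR_left)
    have "row_norm X (Suc 0) \<le> r\<^sup>2"
    proof (rule row_norm_le[OF cX])
      fix y
      have "lev X (Suc 0) y = r\<^sup>2 * (\<Sum>i\<in>UNIV. (norm (T (adj (W i) (T' y))))\<^sup>2)"
        unfolding lev_def sum_words_Suc_0 word_op_singleton aX by (simp add: power_mult_distrib sum_distrib_left)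
      also have "\<dots> \<le> r\<^sup>2 * (\<Sum>i\<in>UNIV. (norm (adj (W i) (T' y)))\<^sup>2)"
        unfolding T by (intro mult_left_mono sum_mono power_mono norm_orth_map_le E u) auto
      also have "\<dots> \<le> r\<^sup>2 * (norm (T' y))\<^sup>2"
        using nW by (intro mult_left_mono sum_norm_adj_orthogonal cW orth) auto
      also have "\<dots> \<le> r\<^sup>2 * (norm y)\<^sup>2"
        unfolding T' by (intro mult_left_mono power_mono norm_orth_map_le E u) auto
      finally show "lev X (Suc 0) y \<le> r\<^sup>2 * (norm y)\<^sup>2" .
    qed simp
    moreover have "r\<^sup>2 < 1" using r by (simp add: power_less_one_iff)
    ultimately have "norm (\<Sum>i\<in>UNIV. X i o\<^sub>L adj (X i)) < 1"
      unfolding row_norm_def sum_words_Suc_0 word_op_singleton by simp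
    then have "nonneg_op_matrix m (Re_op_matrix (poly_eval m p X))"
      using p cX unfolding positive_poly_def by blast
    then have "0 \<le> Re (poly_form m p X (\<lambda>j. T (x j)))"
      using nonneg_op_matrix_poly_iff[of X, OF cX] by blast
    \<comment> \<open>\<open>T' o\<^sub>L T\<close> fixes the orbit, so it cancels between
      consecutive letters.\<close>
    moreover have word: "word_op X \<gamma> (T (x j)) = r ^ length \<gamma> *\<^sub>R T (word_op W \<gamma> (x j))" for \<gamma> j
      by (induction \<gamma>) (simp_all add: X_def blinfun.scaleR_left blinfun.scaleR_right T'T[OF Z])
    have "cinner (word_op X \<gamma> (T (x j))) (T (x i)) = cinner (word_op (\<lambda>i. r *\<^sub>R W i) \<gamma> (x j)) (x i)" for \<gamma> i j
      using T'T[OF Z[of "[]" i]] unfolding word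
      by (simp add: cinner_scaleR_left cinner_adj[OF cT(1)] aT word_op_scaleR blinfun.scaleR_left)
    then have "poly_form m p X (\<lambda>j. T (x j)) = poly_form m p (\<lambda>i. r *\<^sub>R W i) x"
      by (simp add: poly_form_eq)
    ultimately show ?thesis by simp
  qed
  let ?f = "\<lambda>r. Re (\<Sum>i<m. \<Sum>j<m. \<Sum>\<gamma>\<in>poly_support m p. p \<gamma> i j * (of_real (r ^ length \<gamma>) * cinner (word_op W \<gamma> (x j)) (x i)))"
  have f: "?f r = Re (poly_form m p (\<lambda>i. r *\<^sub>R W i) x)" for r
    by (simp add: poly_form_eq word_op_scaleR blinfun.scaleR_left cinner_scaleR_left)
  \<comment> \<open>The form is a polynomial in \<open>r\<close>, so nonnegativity passes to the
    limit from strict contractions to the isometries.\<close>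
  have "(?f \<longlongrightarrow> ?f 1) (at_left 1)" by (intro tendsto_intros)
  moreover have "\<forall>\<^sub>F r in at_left 1. r \<in> {0<..<1::real}" by (rule eventually_at_left_real) simp
  then have "\<forall>\<^sub>F r in at_left 1. 0 \<le> ?f r"
    by eventually_elim (use scaled f in simp)
  ultimately have "0 \<le> ?f 1" by (rule tendsto_lowerbound) simp
  then show ?thesis unfolding f by simp
qed

section \<open>Scaled dilations and the equivalences\<close>

text \<open>The Toeplitz matrix \<open>t\<^bsup>|k-l|\<^esup>\<close> is diagonalised by \<open>y (k + 1) = z k + t y k\<close>.\<close>

lemma sum_geometric_toeplitz_ge:
  fixes z :: "nat \<Rightarrow> 'g::complex_inner"
  assumes t: "0 \<le> t" "t < 1"
  shows "(1 - t\<^sup>2) / 4 * (\<Sum>k<N. (norm (z k))\<^sup>2)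
    \<le> Re (\<Sum>k<N. \<Sum>l<N. of_real (t ^ ((k - l) + (l - k))) * cinner (z l) (z k))"
proof -
  define y where "y = rec_nat 0 (\<lambda>k v. z k + t *\<^sub>R v)"
  have y: "y 0 = 0" "y (Suc k) = z k + t *\<^sub>R y k" for k by (simp_all add: y_def)
  define S where "S N = (\<Sum>k<N. \<Sum>l<N. of_real (t ^ ((k - l) + (l - k))) * cinner (z l) (z k))" for N
  have ty: "t *\<^sub>R y N = (\<Sum>l<N. t ^ (N - l) *\<^sub>R z l)" for N
  proof (induction N)
    case (Suc N)
    have "(\<Sum>l<N. t ^ (Suc N - l) *\<^sub>R z l) = t *\<^sub>R (\<Sum>l<N. t ^ (N - l) *\<^sub>R z l)"
      unfolding scaleR_sum_right by (intro sum.cong refl) (simp add: Suc_diff_le)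
    then show ?case using Suc by (simp add: y scaleR_add_right add.commute)
  qed (simp add: y)
  \<comment> \<open>Adding index \<open>N\<close> adds the cross terms with
    \<open>t *\<^sub>R y N\<close>, which also occur when the squared norm of
    \<open>z N + t *\<^sub>R y N\<close> is expanded; the balance leaves a manifestly nonnegative
    expression.\<close>
  have S: "Re (S N) = (norm (y N))\<^sup>2 + (1 - t\<^sup>2) * (\<Sum>k<N. (norm (y k))\<^sup>2)" for N
  proof (induction N)
    case (Suc N)
    have 1: "(\<Sum>k<N. of_real (t ^ ((k - N) + (N - k))) * cinner (z N) (z k)) = cinner (z N) (t *\<^sub>R y N)"
      unfolding ty cinner_sum_right by (intro sum.cong refl) (simp add: cinner_scaleR_right)
    have 2: "(\<Sum>l<N. of_real (t ^ ((N - l) + (l - N))) * cinner (z l) (z N)) = cinner (t *\<^sub>R y N) (z N)"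
      unfolding ty cinner_sum_left by (intro sum.cong refl) (simp add: cinner_scaleR_left)
    have "S (Suc N) = S N + cinner (z N) (t *\<^sub>R y N) + (cinner (t *\<^sub>R y N) (z N) + cinner (z N) (z N))"
      unfolding S_def 1[symmetric] 2[symmetric] by (simp add: sum.distrib)
    then have "Re (S (Suc N)) = Re (S N) + 2 * Re (cinner (z N) (t *\<^sub>R y N)) + (norm (z N))\<^sup>2"
      using cinner_commute[of "t *\<^sub>R y N" "z N"] by (simp add: cinner_self)
    moreover have "(norm (y (Suc N)))\<^sup>2 = (norm (z N))\<^sup>2 + 2 * Re (cinner (z N) (t *\<^sub>R y N)) + t\<^sup>2 * (norm (y N))\<^sup>2"
      unfolding y norm_add_sq by (simp add: power_mult_distrib)
    ultimately show ?case using Suc by (simp add: algebra_simps)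
  qed (simp add: S_def y)
  have t2: "0 \<le> 1 - t\<^sup>2" "1 - t\<^sup>2 \<le> 1" using t by (simp_all add: power_le_one)
  \<comment> \<open>Inverting the recursion, z k = y (k + 1) - t y k. The factor 2 here, doubled
    when the two shifted sums are merged, gives the 4 in the constant.\<close>
  have zk: "(norm (z k))\<^sup>2 \<le> 2 * (norm (y (Suc k)))\<^sup>2 + 2 * (norm (y k))\<^sup>2" for k
  proof -
    have "norm (z k) \<le> norm (y (Suc k)) + norm (t *\<^sub>R y k)"
      using norm_triangle_ineq4[of "y (Suc k)" "t *\<^sub>R y k"] by (simp add: y)
    also have "\<dots> \<le> norm (y (Suc k)) + norm (y k)" using t by (simp add: mult_left_le_one_le)
    finally have "(norm (z k))\<^sup>2 \<le> (norm (y (Suc k)) + norm (y k))\<^sup>2" by (intro power_mono) auto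
    also have "\<dots> \<le> 2 * (norm (y (Suc k)))\<^sup>2 + 2 * (norm (y k))\<^sup>2"
      using zero_le_power2[of "norm (y (Suc k)) - norm (y k)"] unfolding power2_diff power2_sum by linarith
    finally show ?thesis .
  qed
  have "(\<Sum>k<N. (norm (z k))\<^sup>2) \<le> (\<Sum>k<N. 2 * (norm (y (Suc k)))\<^sup>2 + 2 * (norm (y k))\<^sup>2)"
    by (intro sum_mono zk)
  also have "\<dots> = 2 * (\<Sum>k<N. (norm (y (Suc k)))\<^sup>2) + 2 * (\<Sum>k<N. (norm (y k))\<^sup>2)"
    by (simp add: sum.distrib sum_distrib_left)
  also have "(\<Sum>k<N. (norm (y (Suc k)))\<^sup>2) = (\<Sum>k<N. (norm (y k))\<^sup>2) + (norm (y N))\<^sup>2"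
    using sum.lessThan_Suc_shift[of "\<lambda>k. (norm (y k))\<^sup>2" N] by (simp add: y)
  finally have "(\<Sum>k<N. (norm (z k))\<^sup>2) \<le> 4 * (\<Sum>k<N. (norm (y k))\<^sup>2) + 2 * (norm (y N))\<^sup>2" by simp
  then have "(1 - t\<^sup>2) / 4 * (\<Sum>k<N. (norm (z k))\<^sup>2)
      \<le> (1 - t\<^sup>2) / 4 * (4 * (\<Sum>k<N. (norm (y k))\<^sup>2) + 2 * (norm (y N))\<^sup>2)"
    using t2 by (intro mult_left_mono) auto
  also have "\<dots> = (1 - t\<^sup>2) * (\<Sum>k<N. (norm (y k))\<^sup>2) + (1 - t\<^sup>2) / 2 * (norm (y N))\<^sup>2"
    by (simp add: field_simps)
  also have "(1 - t\<^sup>2) / 2 * (norm (y N))\<^sup>2 \<le> 1 * (norm (y N))\<^sup>2"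
  proof (rule mult_right_mono)
    have "- 1 \<le> t\<^sup>2" by (rule order_trans[OF _ zero_le_power2]) simp
    then show "(1 - t\<^sup>2) / 2 \<le> 1" by simp
  qed simp
  finally show ?thesis unfolding S_def[symmetric] S by simp
qed

text \<open>With truncated subtraction the exponent is the absolute difference of the lengths.
  Removing a common first letter does not change it.\<close>

lemma toeplitz_kernel_scaleR:
  assumes T: "\<And>i. clinear_op (T i)"
  shows "toeplitz_kernel \<rho> (\<lambda>i. t *\<^sub>R T i) \<alpha> \<beta>
    = t ^ ((length \<alpha> - length \<beta>) + (length \<beta> - length \<alpha>)) *\<^sub>R toeplitz_kernel \<rho> T \<alpha> \<beta>"
proof (induction \<alpha> \<beta> rule: list_induct2')
  case (2 i \<alpha>)
  show ?case using word_op_scaleR[of t T "i # \<alpha>"] adj_scaleR[OF clinear_word_op[of T "i # \<alpha>", OF T]]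
    by (simp del: word_op.simps)
next
  case (3 j \<beta>)
  show ?case using word_op_scaleR[of t T "j # \<beta>"] by (simp del: word_op.simps)
qed simp_all

lemma cinner_word_op_isometries:
  assumes V: "\<And>i. isometry_op (V i)" and orth: "\<And>i j x y. i \<noteq> j \<Longrightarrow> cinner (V i x) (V j y) = 0"
    and "length \<alpha> = length \<beta>"
  shows "cinner (word_op V \<alpha> x) (word_op V \<beta> y) = (if \<alpha> = \<beta> then cinner x y else 0)"
  using assms(3)
proof (induction \<alpha> \<beta> rule: list_induct2)
  case (Cons i \<alpha> j \<beta>)
  then show ?case by (cases "i = j") (simp_all add: orth isometry_op_cinner[OF V])
qed simp

text \<open>The kernel is \<rho> times a Gram matrix: a common prefix cancels since the
  \<open>V i\<close> are isometries, and different first letters give orthogonal vectors.\<close>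

lemma toeplitz_kernel_dilation:
  assumes dil: "rho_dilation \<rho> T J V" and T: "\<And>i. clinear_op (T i)"
  shows "cinner (toeplitz_kernel \<rho> T \<alpha> \<beta> x) y = of_real \<rho> * cinner (word_op V \<beta> (J x)) (word_op V \<alpha> (J y))"
proof -
  have J: "isometry_op J" and V: "\<And>i. isometry_op (V i)"
    and orth: "\<And>i j x y. i \<noteq> j \<Longrightarrow> cinner (V i x) (V j y) = 0"
    and TV: "\<And>\<alpha>. \<alpha> \<noteq> [] \<Longrightarrow> word_op T \<alpha> = \<rho> *\<^sub>R (adj J o\<^sub>L word_op V \<alpha> o\<^sub>L J)"
    using dil unfolding rho_dilation_def by blast+
  have cJ: "clinear_op J" using J by (simp add: isometry_op_def)
  have TV': "cinner (word_op T \<alpha> x) y = of_real \<rho> * cinner (word_op V \<alpha> (J x)) (J y)" if "\<alpha> \<noteq> []" for \<alpha> x y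
    by (simp add: TV[OF that] blinfun.scaleR_left cinner_scaleR_left cinner_adj_left cJ)
  show ?thesis
  proof (induction \<alpha> \<beta> rule: list_induct2')
    case 1
    show ?case by (simp add: blinfun.scaleR_left cinner_scaleR_left isometry_op_cinner[OF J])
  next
    case (2 i \<alpha>)
    have "cinner (adj (word_op T (i # \<alpha>)) x) y = cnj (cinner (word_op T (i # \<alpha>) y) x)"
      by (simp add: cinner_adj_left clinear_word_op T cinner_commute[of x] del: word_op.simps)
    also have "\<dots> = of_real \<rho> * cinner (J x) (word_op V (i # \<alpha>) (J y))"
      unfolding TV'[OF list.distinct(2)] using cinner_commute[of "J x"] by simp
    finally show ?case by simp
  next
    case (3 j \<beta>)
    show ?case using TV'[of "j # \<beta>" x y] by simp
  next
    case (4 i \<alpha> j \<beta>)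
    then show ?case by (simp add: isometry_op_cinner[OF V] orth)
  qed
qed

text \<open>Vectors of the same level are orthogonal and the weights depend only on lengths.
  Collecting each level into one vector \<open>z k\<close> reduces the claim to
  \<open>sum_geometric_toeplitz_ge\<close>.\<close>

lemma toeplitz_form_scaled_dilation:
  assumes dil: "rho_dilation \<rho> T J V" and T: "\<And>i. clinear_op (T i)" and rho: "\<rho> > 0" and t: "0 \<le> t" "t < 1"
  shows "\<rho> * (1 - t\<^sup>2) / 4 * (\<Sum>\<alpha>\<in>words_upto N. (norm (h \<alpha>))\<^sup>2) \<le> Re (toeplitz_form \<rho> (\<lambda>i. t *\<^sub>R T i) N h)"
proof -
  have J: "isometry_op J" and V: "\<And>i. isometry_op (V i)"
    and orth: "\<And>i j x y. i \<noteq> j \<Longrightarrow> cinner (V i x) (V j y) = 0"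
    using dil unfolding rho_dilation_def by blast+
  define z where "z k = (\<Sum>\<alpha> | length \<alpha> = k. word_op V \<alpha> (J (h \<alpha>)))" for k
  have nz: "(norm (z k))\<^sup>2 = (\<Sum>\<alpha> | length \<alpha> = k. (norm (h \<alpha>))\<^sup>2)" for k
  proof -
    have "complex_of_real ((norm (z k))\<^sup>2)
        = (\<Sum>\<alpha> | length \<alpha> = k. \<Sum>\<beta> | length \<beta> = k. if \<alpha> = \<beta> then cinner (J (h \<alpha>)) (J (h \<alpha>)) else 0)"
      unfolding cinner_self[symmetric] z_def cinner_sum_left cinner_sum_right
      by (intro sum.cong refl) (auto simp: cinner_word_op_isometries[OF V orth])
    also have "\<dots> = of_real (\<Sum>\<alpha> | length \<alpha> = k. (norm (h \<alpha>))\<^sup>2)"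
      unfolding isometry_op_cinner[OF J] by (simp add: cinner_self)
    finally show ?thesis by (simp only: of_real_eq_iff)
  qed
  have "toeplitz_form \<rho> (\<lambda>i. t *\<^sub>R T i) N h = (\<Sum>k\<le>N. \<Sum>\<alpha> | length \<alpha> = k. \<Sum>l\<le>N. \<Sum>\<beta> | length \<beta> = l.
      of_real (\<rho> * t ^ ((k - l) + (l - k))) * cinner (word_op V \<beta> (J (h \<beta>))) (word_op V \<alpha> (J (h \<alpha>))))"
    unfolding toeplitz_form_def sum_words_upto_levels
    by (intro sum.cong refl)
      (simp add: toeplitz_kernel_scaleR[of T, OF T] blinfun.scaleR_left cinner_scaleR_left toeplitz_kernel_dilation[OF dil T])
  also have "\<dots> = (\<Sum>k\<le>N. \<Sum>l\<le>N. \<Sum>\<alpha> | length \<alpha> = k. \<Sum>\<beta> | length \<beta> = l.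
      of_real (\<rho> * t ^ ((k - l) + (l - k))) * cinner (word_op V \<beta> (J (h \<beta>))) (word_op V \<alpha> (J (h \<alpha>))))"
    by (intro sum.cong refl sum.swap)
  also have "\<dots> = (\<Sum>k\<le>N. \<Sum>l\<le>N. of_real (\<rho> * t ^ ((k - l) + (l - k))) * cinner (z l) (z k))"
    unfolding z_def cinner_sum_left cinner_sum_right sum_distrib_left
    by (intro sum.cong refl sum.swap)
  also have "\<dots> = of_real \<rho> * (\<Sum>k<Suc N. \<Sum>l<Suc N. of_real (t ^ ((k - l) + (l - k))) * cinner (z l) (z k))"
    by (simp add: sum_distrib_left lessThan_Suc_atMost mult.assoc del: sum.lessThan_Suc)
  finally have form: "Re (toeplitz_form \<rho> (\<lambda>i. t *\<^sub>R T i) N h)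
      = \<rho> * Re (\<Sum>k<Suc N. \<Sum>l<Suc N. of_real (t ^ ((k - l) + (l - k))) * cinner (z l) (z k))" by (simp del: sum.lessThan_Suc)
  have "\<rho> * ((1 - t\<^sup>2) / 4 * (\<Sum>k<Suc N. (norm (z k))\<^sup>2)) \<le> Re (toeplitz_form \<rho> (\<lambda>i. t *\<^sub>R T i) N h)"
    unfolding form using rho by (intro mult_left_mono sum_geometric_toeplitz_ge t) auto
  then show ?thesis unfolding sum_words_upto_levels nz lessThan_Suc_atMost by simp
qed

section \<open>The implications between the three conditions\<close>

text \<open>At the zero tuple the form is \<rho> times the sum of squared norms, so the two
  dominations are an upper and a lower bound for the form of \<open>A\<close>; the upper one
  controls the levels.\<close>

lemma harnack_equivalent_zero_imp:
  fixes A :: "'n::finite \<Rightarrow> ('h::chilbert_space \<Rightarrow>\<^sub>L 'h)"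
  assumes A: "\<And>i. clinear_op (A i)" and rho: "\<rho> > 0" and eq: "harnack_equivalent K \<rho> A (\<lambda>_. 0)"
  shows "joint_spectral_radius A < 1"
    and "\<exists>a>0. \<forall>N h. a * (\<Sum>\<alpha>\<in>words_upto N. (norm (h \<alpha>))\<^sup>2) \<le> Re (toeplitz_form \<rho> A N h)"
proof -
  obtain b where b: "b > 0"
    and up: "\<And>N h. Re (toeplitz_form \<rho> A N h) \<le> b * (\<rho> * (\<Sum>\<alpha>\<in>words_upto N. (norm (h \<alpha>))\<^sup>2))"
    using harnack_dominated_toeplitz_form[of A "\<lambda>_. 0" K \<rho>] A eq
    by (auto simp: harnack_equivalent_def toeplitz_form_zero)
  obtain c where c: "c > 0"
    and low: "\<And>N h. \<rho> * (\<Sum>\<alpha>\<in>words_upto N. (norm (h \<alpha>))\<^sup>2) \<le> c * Re (toeplitz_form \<rho> A N h)"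
    using harnack_dominated_toeplitz_form[of "\<lambda>_. 0" A K \<rho>] A eq
    by (auto simp: harnack_equivalent_def toeplitz_form_zero)
  have low': "\<rho> / c * (\<Sum>\<alpha>\<in>words_upto N. (norm (h \<alpha>))\<^sup>2) \<le> Re (toeplitz_form \<rho> A N h)" for N h
    using low[where N=N and h=h] c by (simp add: field_simps)
  have pos: "0 \<le> Re (toeplitz_form \<rho> A N h)" for N h
  proof (rule order_trans[OF _ low'])
    show "0 \<le> \<rho> / c * (\<Sum>\<alpha>\<in>words_upto N. (norm (h \<alpha>))\<^sup>2)"
      using rho c by (intro mult_nonneg_nonneg sum_nonneg) auto
  qed
  show "\<exists>a>0. \<forall>N h. a * (\<Sum>\<alpha>\<in>words_upto N. (norm (h \<alpha>))\<^sup>2) \<le> Re (toeplitz_form \<rho> A N h)"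
    using low' rho c by (intro exI[of _ "\<rho> / c"]) auto
  let ?C = "(b * \<rho>)\<^sup>2 + 1"
  have "(\<Sum>k\<le>N. lev A k x) \<le> ?C * (norm x)\<^sup>2" for N x
  proof -
    have "(\<Sum>k\<le>N. lev A k x) \<le> (\<Sum>k\<le>Suc N. lev A k x)" by (simp add: lev_nonneg)
    also have "\<dots> \<le> ?C * (norm x)\<^sup>2"
      by (rule sum_lev_le_of_toeplitz_form_le[OF A, of \<rho>])
        (use rho b pos up in \<open>auto simp: mult.assoc\<close>)
    finally show ?thesis .
  qed
  then show "joint_spectral_radius A < 1"
    by (intro joint_spectral_radius_less_1_of_sum_lev[of A ?C, OF A]) auto
qed

lemma op_radius_less_1_imp:
  fixes A :: "'n::finite \<Rightarrow> ('h::chilbert_space \<Rightarrow>\<^sub>L 'h)"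
  assumes A: "A \<in> C_class \<rho>" and rho: "\<rho> > 0" and w: "joint_op_radius \<rho> A < 1"
  shows "joint_spectral_radius A < 1"
    and "\<exists>a>0. \<forall>N h. a * (\<Sum>\<alpha>\<in>words_upto N. (norm (h \<alpha>))\<^sup>2) \<le> Re (toeplitz_form \<rho> A N h)"
proof -
  \<comment> \<open>Nonemptiness, from t = 1, makes the infimum meaningful, so that some admissible
    t is below 1.\<close>
  have "{t. t > 0 \<and> (\<lambda>i. (1 / t) *\<^sub>R A i) \<in> C_class \<rho>} \<noteq> {}"
    using A by (auto intro!: exI[of _ 1])
  then obtain t where t: "0 < t" "t < 1" and B: "(\<lambda>i. (1 / t) *\<^sub>R A i) \<in> C_class \<rho>"
    using cInf_lessD[OF _ w[unfolded joint_op_radius_def]] by blast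
  define B where "B i = (1 / t) *\<^sub>R A i" for i
  have AB: "A = (\<lambda>i. t *\<^sub>R B i)" using t by (simp add: B_def)
  have BC: "B \<in> C_class \<rho>" using B by (simp add: B_def[abs_def])
  then have cB: "\<And>i. clinear_op (B i)" by (simp add: C_class_def)
  obtain J :: "'h \<Rightarrow>\<^sub>L (nat, 'h) ell2" and V where dil: "rho_dilation \<rho> B J V"
    using BC unfolding C_class_def by blast
  have t2: "t\<^sup>2 < 1" using t by (simp add: power_less_one_iff)
  show "\<exists>a>0. \<forall>N h. a * (\<Sum>\<alpha>\<in>words_upto N. (norm (h \<alpha>))\<^sup>2) \<le> Re (toeplitz_form \<rho> A N h)"
    using toeplitz_form_scaled_dilation[OF dil cB rho, of t] t t2 rho unfolding AB
    by (intro exI[of _ "\<rho> * (1 - t\<^sup>2) / 4"]) auto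
  \<comment> \<open>Since \<rho> may exceed 1, the first level need not suffice; at a high level the
    power of \<open>t\<close> beats the square of \<rho>.\<close>
  have "(\<lambda>k. (t\<^sup>2) ^ k * \<rho>\<^sup>2) \<longlonglongrightarrow> 0 * \<rho>\<^sup>2"
    using t2 by (intro tendsto_intros LIMSEQ_power_zero) simp
  then have "\<forall>\<^sub>F k in sequentially. (t\<^sup>2) ^ k * \<rho>\<^sup>2 < 1" by (intro order_tendstoD) auto
  then obtain k where "(t\<^sup>2) ^ Suc k * \<rho>\<^sup>2 < 1"
    unfolding eventually_sequentially by (meson le_SucI order_refl)
  then have k: "t ^ (2 * Suc k) * \<rho>\<^sup>2 < 1" by (simp only: power_mult)
  have "lev A (Suc k) x \<le> t ^ (2 * Suc k) * \<rho>\<^sup>2 * (norm x)\<^sup>2" for x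
    unfolding AB lev_scaleR[of B, OF cB] mult.assoc using t
    by (intro mult_left_mono lev_C_class[OF BC]) auto
  moreover have "clinear_op (A i)" for i using A by (simp add: C_class_def)
  ultimately show "joint_spectral_radius A < 1"
    using joint_spectral_radius_less_1I[of A "Suc k" "t ^ (2 * Suc k) * \<rho>\<^sup>2"] k t by simp
qed

lemma kernel_op_bounded_below_imp_op_radius:
  fixes A :: "'n::finite \<Rightarrow> ('h::chilbert_space \<Rightarrow>\<^sub>L 'h)"
  assumes A: "\<And>i. clinear_op (A i)" and rho: "\<rho> > 0" and s0: "kernel_radius A s0"
    and a: "a > 0" and low: "\<And>f. a * (norm f)\<^sup>2 \<le> Re (cinner (kernel_op A \<rho> 1 f) f)"
  shows "joint_op_radius \<rho> A < 1"
proof -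
  have "a / 2 > 0" using a by simp
  then obtain s where s: "1 < s" "s \<le> s0" and near: "norm (kernel_op A \<rho> s - kernel_op A \<rho> 1) \<le> a / 2"
    using kernel_op_continuous_at_1[of A, OF A s0] by blast
  let ?P = "kernel_op A \<rho> s"
  define B where "B i = s *\<^sub>R A i" for i
  have cB: "clinear_op (B i)" for i unfolding B_def by (intro clinear_op_scaleR A)
  have s': "0 \<le> s" using s by simp
  have Pket: "cinner (?P (ket \<beta> x)) (ket \<alpha> y) = cinner (toeplitz_kernel \<rho> B \<alpha> \<beta> x) y" for \<alpha> \<beta> x y
    unfolding B_def by (rule kernel_op_ket[of A, OF A s0 s' s(2)])
  \<comment> \<open>A perturbation of norm at most a / 2 costs at most half of the lower
    bound.\<close>
  have Plow: "a / 2 * (norm f)\<^sup>2 \<le> Re (cinner (?P f) f)" for f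
  proof -
    let ?E = "?P - kernel_op A \<rho> 1"
    have "cmod (cinner (?E f) f) \<le> norm (?E f) * norm f" by (rule cauchy_schwarz)
    also have "\<dots> \<le> (norm ?E * norm f) * norm f" by (intro mult_right_mono norm_blinfun) simp
    also have "\<dots> \<le> (a / 2 * norm f) * norm f" by (intro mult_right_mono near) simp_all
    finally have "\<bar>Re (cinner (?E f) f)\<bar> \<le> a / 2 * (norm f)\<^sup>2"
      using abs_Re_le_cmod[of "cinner (?E f) f"] by (simp add: power2_eq_square)
    moreover have "Re (cinner (?E f) f) = Re (cinner (?P f) f) - Re (cinner (kernel_op A \<rho> 1 f) f)"
      by (simp add: blinfun.diff_left cinner_diff_left)
    ultimately show ?thesis using low[of f] unfolding abs_le_iff by linarith
  qed
  \<comment> \<open>Dividing by \<rho> turns the diagonal entries into the identity, which makes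
    \<open>J\<close> an isometry.\<close>
  define D where "D = (1 / \<rho>) *\<^sub>R ?P"
  have Dket: "cinner (D (ket \<beta> x)) (ket \<alpha> y) = of_real (1 / \<rho>) * cinner (toeplitz_kernel \<rho> B \<alpha> \<beta> x) y" for \<alpha> \<beta> x y
    by (simp add: D_def blinfun.scaleR_left cinner_scaleR_left Pket)
  have toep: "cinner (D (ket (j # \<beta>) x)) (ket (i # \<alpha>) y) = (if i = j then cinner (D (ket \<beta> x)) (ket \<alpha> y) else 0)"
    for i j \<alpha> \<beta> x y by (simp add: Dket)
  have saD: "selfadjoint_op D"
    unfolding D_def by (intro selfadjoint_op_scaleR selfadjoint_kernel_op[of A, OF A s0 s' s(2)])
  have lowD: "a / 2 / \<rho> * (norm f)\<^sup>2 \<le> Re (cinner (D f) f)" for f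
    using mult_left_mono[OF Plow[of f], of "1 / \<rho>"] rho
    by (simp add: D_def blinfun.scaleR_left cinner_scaleR_left)
  have "a / 2 / \<rho> > 0" using a rho by simp
  from toeplitz_isometries[OF saD this lowD toep]
  obtain J :: "'h \<Rightarrow>\<^sub>L ('n list, 'h) ell2" and V where cJ: "clinear_op J"
    and V: "\<forall>i. isometry_op (V i)" "\<forall>i j. i \<noteq> j \<longrightarrow> (\<forall>x y. cinner (V i x) (V j y) = 0)"
    and VJ: "\<And>\<alpha> x y. cinner (word_op V \<alpha> (J x)) (J y) = cinner (D (ket \<alpha> x)) (ket [] y)"
    by blast
  have "norm (J x) = norm x" for x
  proof -
    have "complex_of_real ((norm (J x))\<^sup>2) = complex_of_real ((norm x)\<^sup>2)"
      using VJ[of "[]" x x] rho unfolding cinner_self[symmetric]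
      by (simp add: Dket blinfun.scaleR_left cinner_scaleR_left)
    then have "(norm (J x))\<^sup>2 = (norm x)\<^sup>2" by (simp only: of_real_eq_iff)
    then show ?thesis by simp
  qed
  then have isoJ: "isometry_op J" using cJ by (simp add: isometry_op_def)
  have "word_op B \<alpha> = \<rho> *\<^sub>R (adj J o\<^sub>L word_op V \<alpha> o\<^sub>L J)" if "\<alpha> \<noteq> []" for \<alpha>
  proof (rule blinfun_eqI, rule cinner_ext)
    fix x y
    have "cinner ((\<rho> *\<^sub>R (adj J o\<^sub>L word_op V \<alpha> o\<^sub>L J)) x) y = of_real \<rho> * cinner (word_op V \<alpha> (J x)) (J y)"
      by (simp add: blinfun.scaleR_left cinner_scaleR_left cinner_adj_left cJ)
    also have "\<dots> = cinner (word_op B \<alpha> x) y"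
      using that rho toeplitz_kernel_append[of \<rho> B "[]" \<alpha>] by (simp add: VJ Dket)
    finally show "cinner (word_op B \<alpha> x) y = cinner ((\<rho> *\<^sub>R (adj J o\<^sub>L word_op V \<alpha> o\<^sub>L J)) x) y" by simp
  qed
  then have "rho_dilation \<rho> B J V" using isoJ V by (simp add: rho_dilation_def)
  \<comment> \<open>The dilation lives on families indexed by words, while \<open>C_class\<close>
    asks for families indexed by naturals.\<close>
  then have "B \<in> C_class \<rho>" by (rule C_class_of_dilation[OF cB])
  then have "1 / s \<in> {t. t > 0 \<and> (\<lambda>i. (1 / t) *\<^sub>R A i) \<in> C_class \<rho>}" using s by (simp add: B_def[abs_def])
  then have "joint_op_radius \<rho> A \<le> 1 / s"
    unfolding joint_op_radius_def by (rule cInf_lower) (auto intro!: bdd_belowI[of _ 0])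
  also have "1 / s < 1" using s by simp
  finally show ?thesis .
qed

text \<open>The expression is the form of \<open>p\<close> at the isometries that belong to D = c P
  + d I, where positive polynomials are nonnegative. Both signs of \<open>c\<close> occur, one for
  each Harnack inequality.\<close>

lemma kernel_combination_poly_nonneg:
  fixes A :: "'n::finite \<Rightarrow> ('h::chilbert_space \<Rightarrow>\<^sub>L 'h)" and K :: "'k::chilbert_space itself"
  assumes K: "\<not> (\<exists>S :: 'k set. finite S \<and> cspan S = UNIV)" and p: "positive_poly K m p"
    and A: "\<And>i. clinear_op (A i)" and s0: "kernel_radius A s0" and e: "e > 0"
    and low: "\<And>f. e * (norm f)\<^sup>2 \<le> c * Re (cinner (kernel_op A \<rho> 1 f) f) + d * (norm f)\<^sup>2"
  shows "0 \<le> c * rho_form \<rho> m p A x + d * Re (poly_form m p (\<lambda>_. 0) x)"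
proof -
  define D where "D = c *\<^sub>R kernel_op A \<rho> 1 + d *\<^sub>R id_blinfun"
  have s1: "1 \<le> s0" using s0 by (simp add: kernel_radius_def[OF A])
  have Pket: "cinner (kernel_op A \<rho> 1 (ket \<beta> x)) (ket \<alpha> y) = cinner (toeplitz_kernel \<rho> A \<alpha> \<beta> x) y" for \<alpha> \<beta> x y
    using kernel_op_ket[of A, OF A s0 _ s1] by simp
  have Dket: "cinner (D (ket \<beta> x)) (ket \<alpha> y)
      = of_real c * cinner (toeplitz_kernel \<rho> A \<alpha> \<beta> x) y + of_real d * (if \<alpha> = \<beta> then cinner x y else 0)" for \<alpha> \<beta> x y
    by (simp add: D_def blinfun.add_left blinfun.scaleR_left cinner_add_left cinner_scaleR_left Pket cinner_ket_left ket_apply)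
  have toep: "cinner (D (ket (j # \<beta>) x)) (ket (i # \<alpha>) y) = (if i = j then cinner (D (ket \<beta> x)) (ket \<alpha> y) else 0)"
    for i j \<alpha> \<beta> x y by (simp add: Dket)
  have saD: "selfadjoint_op D"
    unfolding D_def by (intro selfadjoint_op_add selfadjoint_op_scaleR selfadjoint_kernel_op[of A, OF A s0 _ s1]) simp_all
  have lowD: "e * (norm f)\<^sup>2 \<le> Re (cinner (D f) f)" for f
    using low[of f] by (simp add: D_def blinfun.add_left blinfun.scaleR_left cinner_add_left cinner_scaleR_left cinner_self)
  from toeplitz_isometries[OF saD e lowD toep]
  obtain J :: "'h \<Rightarrow>\<^sub>L ('n list, 'h) ell2" and V where
    V: "\<And>i. isometry_op (V i)" "\<And>i j x y. i \<noteq> j \<Longrightarrow> cinner (V i x) (V j y) = 0"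
    and VJ: "\<And>\<alpha> x y. cinner (word_op V \<alpha> (J x)) (J y) = cinner (D (ket \<alpha> x)) (ket [] y)"
    by blast
  \<comment> \<open>At the zero tuple only the empty word survives; there the coefficient is c (1 +
    (\<rho> - 1)) + d = c \<rho> + d, the diagonal entry of \<open>D\<close>.\<close>
  have word: "cinner (word_op V \<gamma> (J v)) (J w) = of_real c * (cinner (word_op A \<gamma> v) w
      + of_real (\<rho> - 1) * cinner (word_op (\<lambda>_. 0) \<gamma> v) w) + of_real d * cinner (word_op (\<lambda>_. 0) \<gamma> v) w" for \<gamma> v w
    using toeplitz_kernel_append[of \<rho> A "[]" \<gamma>]
    by (auto simp: VJ Dket word_op_zero blinfun.scaleR_left cinner_scaleR_left algebra_simps)
  have "poly_form m p V (\<lambda>i. J (x i)) = of_real c * (poly_form m p A x + of_real (\<rho> - 1) * poly_form m p (\<lambda>_. 0) x)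
      + of_real d * poly_form m p (\<lambda>_. 0) x"
    unfolding poly_form_eq word
    by (simp only: sum_distrib_left sum.distrib distrib_left mult.left_commute)
  then have "c * rho_form \<rho> m p A x + d * Re (poly_form m p (\<lambda>_. 0) x) = Re (poly_form m p V (\<lambda>i. J (x i)))"
    by (simp add: rho_form_def)
  also have "0 \<le> \<dots>" by (rule poly_form_isometries_nonneg[OF K p V])
  finally show ?thesis by simp
qed

lemma kernel_op_bounded_below_imp_harnack:
  fixes A :: "'n::finite \<Rightarrow> ('h::chilbert_space \<Rightarrow>\<^sub>L 'h)" and K :: "'k::chilbert_space itself"
  assumes K: "\<not> (\<exists>S :: 'k set. finite S \<and> cspan S = UNIV)"
    and A: "\<And>i. clinear_op (A i)" and rho: "\<rho> > 0" and s0: "kernel_radius A s0"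
    and a: "a > 0" and low: "\<And>f. a * (norm f)\<^sup>2 \<le> Re (cinner (kernel_op A \<rho> 1 f) f)"
  shows "harnack_equivalent K \<rho> A (\<lambda>_. 0)"
proof -
  let ?P = "kernel_op A \<rho> 1"
  \<comment> \<open>The added 1 is the strict lower bound of b - P.\<close>
  define b where "b = norm ?P + 1"
  have b: "b > 0" by (simp add: b_def add_nonneg_pos)
  have zero: "rho_form \<rho> m p (\<lambda>_. 0) x = \<rho> * Re (poly_form m p (\<lambda>_. 0) x)" for m p and x :: "nat \<Rightarrow> 'h"
    by (simp add: rho_form_def algebra_simps)
  have lower: "a / 2 * Re (poly_form m p (\<lambda>_. 0) x) \<le> rho_form \<rho> m p A x" if p: "positive_poly K m p" for m p x
  proof -
    have "0 \<le> 1 * rho_form \<rho> m p A x + (- (a / 2)) * Re (poly_form m p (\<lambda>_. 0) x)"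
      by (rule kernel_combination_poly_nonneg[OF K p A s0, of "a / 2"]) (use a low in \<open>auto simp: field_simps\<close>)
    then show ?thesis by simp
  qed
  have upper: "rho_form \<rho> m p A x \<le> b * Re (poly_form m p (\<lambda>_. 0) x)" if p: "positive_poly K m p" for m p x
  proof -
    have "0 \<le> - 1 * rho_form \<rho> m p A x + b * Re (poly_form m p (\<lambda>_. 0) x)"
    proof (rule kernel_combination_poly_nonneg[OF K p A s0, of 1])
      fix f
      have "Re (cinner (?P f) f) \<le> norm (?P f) * norm f"
        using complex_Re_le_cmod[of "cinner (?P f) f"] cauchy_schwarz[of "?P f" f] by linarith
      also have "\<dots> \<le> (norm ?P * norm f) * norm f" by (intro mult_right_mono norm_blinfun) simp
      finally show "1 * (norm f)\<^sup>2 \<le> - 1 * Re (cinner (?P f) f) + b * (norm f)\<^sup>2"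
        by (simp add: b_def power2_eq_square algebra_simps)
    qed simp
    then show ?thesis by simp
  qed
  \<comment> \<open>Since \<open>rho_form\<close> at the zero tuple is \<rho> Re p(0), the constants
    are fixed by c^2 \<rho> = b here, and by c^2 a / 2 = \<rho> in the converse domination.\<close>
  have "harnack_dominated K \<rho> A (\<lambda>_. 0)"
    unfolding harnack_dominated_iff[of A "\<lambda>_. 0", OF A clinear_op_zero]
    using upper rho b by (intro exI[of _ "sqrt (b / \<rho>)"]) (simp add: zero)
  moreover have "harnack_dominated K \<rho> (\<lambda>_. 0) A"
    unfolding harnack_dominated_iff[of "\<lambda>_. 0" A, OF clinear_op_zero A]
  proof (intro exI[of _ "sqrt (2 * \<rho> / a)"] conjI allI impI)
    fix m x and p :: "'n matrix_poly" assume "positive_poly K m p"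
    then have "2 * \<rho> / a * (a / 2 * Re (poly_form m p (\<lambda>_. 0) x)) \<le> 2 * \<rho> / a * rho_form \<rho> m p A x"
      using rho a by (intro mult_left_mono lower) auto
    then show "rho_form \<rho> m p (\<lambda>_. 0) x \<le> (sqrt (2 * \<rho> / a))\<^sup>2 * rho_form \<rho> m p A x"
      using rho a by (simp add: zero)
  qed (use rho a in simp)
  ultimately show ?thesis by (simp add: harnack_equivalent_def)
qed

theorem theorem3p2:
  fixes A :: "'n::finite \<Rightarrow> ('h::chilbert_space \<Rightarrow>\<^sub>L 'h)"
    and K :: "'k::chilbert_space itself"
    and \<rho> :: real
  assumes K: "\<not> (\<exists>S :: 'k set. finite S \<and> cspan S = UNIV)"
    and rho: "\<rho> > 0"
    and A: "A \<in> C_class \<rho>"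
  shows "(joint_op_radius \<rho> A < 1 \<longleftrightarrow> harnack_equivalent K \<rho> A (\<lambda>_. 0)) \<and>
    (harnack_equivalent K \<rho> A (\<lambda>_. 0) \<longleftrightarrow>
       joint_spectral_radius A < 1 \<and> (\<exists>a>0. nonneg_op (rho_kernel \<rho> A - a *\<^sub>R id_blinfun)))"
proof -
  let ?iii = "joint_spectral_radius A < 1 \<and> (\<exists>a>0. nonneg_op (rho_kernel \<rho> A - a *\<^sub>R id_blinfun))"
  have cA: "clinear_op (A i)" for i using A by (simp add: C_class_def)
  \<comment> \<open>Common endpoint of (i) and (ii): only with r(A) < 1 at hand can the uniform
    bound for finite sections be restated for \<open>rho_kernel\<close>.\<close>
  have form_imp: ?iii if r: "joint_spectral_radius A < 1"
    and low: "\<exists>a>0. \<forall>N h. a * (\<Sum>\<alpha>\<in>words_upto N. (norm (h \<alpha>))\<^sup>2) \<le> Re (toeplitz_form \<rho> A N h)"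
  proof -
    obtain s0 where s0: "kernel_radius A s0" using kernel_radius_exists[of A, OF cA r] by blast
    then have s1: "1 \<le> s0" by (simp add: kernel_radius_def[OF cA])
    obtain a where a: "a > 0" "\<And>N h. a * (\<Sum>\<alpha>\<in>words_upto N. (norm (h \<alpha>))\<^sup>2) \<le> Re (toeplitz_form \<rho> A N h)"
      using low by blast
    have sa: "selfadjoint_op (kernel_op A \<rho> 1 - a *\<^sub>R id_blinfun)"
      by (intro selfadjoint_op_diff selfadjoint_op_scaleR selfadjoint_kernel_op[of A, OF cA s0 _ s1]) simp_all
    have "nonneg_op (rho_kernel \<rho> A - a *\<^sub>R id_blinfun)"
      unfolding rho_kernel_eq[of A, OF cA s0] nonneg_op_def
    proof (intro allI conjI)
      fix f
      show "0 \<le> Re (cinner ((kernel_op A \<rho> 1 - a *\<^sub>R id_blinfun) f) f)"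
        using kernel_op_lower_bound[of A, OF cA s0 a(2)]
        by (simp add: blinfun.diff_left blinfun.scaleR_left cinner_diff_left cinner_scaleR_left cinner_self)
    qed (rule selfadjoint_op_Im[OF sa])
    then show ?thesis using r a(1) by blast
  qed
  have iii_imp: "joint_op_radius \<rho> A < 1" "harnack_equivalent K \<rho> A (\<lambda>_. 0)" if iii: ?iii
  proof -
    obtain s0 where s0: "kernel_radius A s0" using kernel_radius_exists[of A, OF cA] iii by blast
    obtain a where a: "a > 0" "nonneg_op (rho_kernel \<rho> A - a *\<^sub>R id_blinfun)" using iii by blast
    have low: "a * (norm f)\<^sup>2 \<le> Re (cinner (kernel_op A \<rho> 1 f) f)" for f
      using a(2) unfolding rho_kernel_eq[of A, OF cA s0] nonneg_op_def
      by (simp add: blinfun.diff_left blinfun.scaleR_left cinner_diff_left cinner_scaleR_left cinner_self)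
    show "joint_op_radius \<rho> A < 1" by (rule kernel_op_bounded_below_imp_op_radius[OF cA rho s0 a(1) low])
    show "harnack_equivalent K \<rho> A (\<lambda>_. 0)" by (rule kernel_op_bounded_below_imp_harnack[OF K cA rho s0 a(1) low])
  qed
  have "?iii" if "joint_op_radius \<rho> A < 1"
    by (rule form_imp) (rule op_radius_less_1_imp[OF A rho that])+
  moreover have "?iii" if "harnack_equivalent K \<rho> A (\<lambda>_. 0)"
    by (rule form_imp) (rule harnack_equivalent_zero_imp[OF cA rho that])+
  ultimately show ?thesis using iii_imp by blast
qed

end
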